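(* Let $Q\in C^2([0,\infty))$ be complex-valued with $Q(0)=0$, and let $q$ be the unique global classical solution, $q\in C^1([0,\infty);L^2(0,\infty))\cap C^0([0,\infty);H^2(0,\infty))$, of the defocusing NLS problem $$\mathrm{i}q_t+q_{xx}-2|q|^2q=0\quad (x>0,\ t>0),\qquad q(x,0)=0\ (x\ge 0),\qquad q(0,t)=Q(t)\ (t\ge 0).$$ Assume that, as $t\to\infty$, $q(0,t)=\mathcal{O}(t^{-\alpha})$ and $q_t(0,t)=\mathcal{O}(t^{-\beta})$ for some $\alpha>3/2$ and $\beta>5/2$. Then there exists a constant $c>0$ independent of $t$ such that $$\int_0^\infty|q(x,t)|^4\,dx\le\frac{c}{t}\qquad\text{for all } t\ge 1 .$$
   Context: Existence and uniqueness of the global classical solution $q$ is known (Carroll–Bu). *)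

theory Defs
  imports "HOL-Analysis.Analysis" "HOL-Library.Landau_Symbols"
begin

text \<open>
  Elements of Lebesgue and Sobolev spaces on \<open>(0,\<infinity>)\<close> are represented by functions
  \<open>real \<Rightarrow> complex\<close>; equality in these spaces is equality almost everywhere on \<open>{0<..}\<close>.
\<close>

definition L2 :: "(real \<Rightarrow> complex) set" where
  "L2 = {f \<in> borel_measurable (lebesgue_on {0<..}).
           integrable (lebesgue_on {0<..}) (\<lambda>x. (cmod (f x))\<^sup>2)}"

definition L2_norm :: "(real \<Rightarrow> complex) \<Rightarrow> real" where
  "L2_norm f = sqrt (LINT x|lebesgue_on {0<..}. (cmod (f x))\<^sup>2)"

definition test_function :: "(real \<Rightarrow> real) \<Rightarrow> bool" where
  "test_function \<phi> \<longleftrightarrow>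
     (\<forall>n x. (deriv ^^ n) \<phi> field_differentiable (at x)) \<and>
     compact (closure {x. \<phi> x \<noteq> 0}) \<and> closure {x. \<phi> x \<noteq> 0} \<subseteq> {0<..}"

definition locally_integrable :: "(real \<Rightarrow> complex) \<Rightarrow> bool" where
  "locally_integrable f \<longleftrightarrow> (\<forall>a b. 0 < a \<longrightarrow> integrable (lebesgue_on {a..b}) f)"

definition has_weak_deriv :: "(real \<Rightarrow> complex) \<Rightarrow> (real \<Rightarrow> complex) \<Rightarrow> bool" where
  "has_weak_deriv f g \<longleftrightarrow>
     locally_integrable f \<and> locally_integrable g \<and>
     (\<forall>\<phi>. test_function \<phi> \<longrightarrow>
        (LINT x|lebesgue_on {0<..}. deriv \<phi> x *\<^sub>R f x) =
        - (LINT x|lebesgue_on {0<..}. \<phi> x *\<^sub>R g x))"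

text \<open>A representative of the weak derivative, which is unique up to null sets if it exists.\<close>

definition weak_deriv :: "(real \<Rightarrow> complex) \<Rightarrow> real \<Rightarrow> complex" where
  "weak_deriv f = (SOME g. has_weak_deriv f g)"

definition H2 :: "(real \<Rightarrow> complex) set" where
  "H2 = {f \<in> L2. \<exists>g\<in>L2. \<exists>h\<in>L2. has_weak_deriv f g \<and> has_weak_deriv g h}"

definition H2_norm :: "(real \<Rightarrow> complex) \<Rightarrow> real" where
  "H2_norm f = sqrt ((L2_norm f)\<^sup>2 + (L2_norm (weak_deriv f))\<^sup>2
                      + (L2_norm (weak_deriv (weak_deriv f)))\<^sup>2)"

text \<open>Curves \<open>u :: [0,\<infinity>) \<rightarrow> V\<close>, where \<open>u t\<close> is a function of \<open>x\<close>, that are continuous for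
  the norm \<open>N\<close> of \<open>V\<close>.\<close>

definition C0_curve ::
  "(real \<Rightarrow> complex) set \<Rightarrow> ((real \<Rightarrow> complex) \<Rightarrow> real) \<Rightarrow> (real \<Rightarrow> real \<Rightarrow> complex) \<Rightarrow> bool" where
  "C0_curve V N u \<longleftrightarrow>
     (\<forall>t\<ge>0. u t \<in> V) \<and>
     (\<forall>t\<ge>0. ((\<lambda>s. N (\<lambda>x. u s x - u t x)) \<longlongrightarrow> 0) (at t within {0..}))"

text \<open>\<open>u\<close> belongs to \<open>C\<^sup>1([0,\<infinity>); L\<^sup>2(0,\<infinity>))\<close> with derivative \<open>v\<close>.\<close>

definition C1_L2_curve ::
  "(real \<Rightarrow> real \<Rightarrow> complex) \<Rightarrow> (real \<Rightarrow> real \<Rightarrow> complex) \<Rightarrow> bool" where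
  "C1_L2_curve u v \<longleftrightarrow>
     C0_curve L2 L2_norm u \<and> C0_curve L2 L2_norm v \<and>
     (\<forall>t\<ge>0. ((\<lambda>s. L2_norm (\<lambda>x. (u s x - u t x) / complex_of_real (s - t) - v t x)) \<longlongrightarrow> 0)
              (at t within {0..}))"

definition C2_halfline :: "(real \<Rightarrow> complex) \<Rightarrow> bool" where
  "C2_halfline Q \<longleftrightarrow>
     (\<exists>Q' Q''. (\<forall>t\<ge>0. (Q has_vector_derivative Q' t) (at t within {0..})) \<and>
               (\<forall>t\<ge>0. (Q' has_vector_derivative Q'' t) (at t within {0..})) \<and>
               continuous_on {0..} Q'')"

text \<open>
  Global classical solutions of the defocusing NLS problem on the half-line with zero initial
  data and Dirichlet data \<open>Q\<close>.  In the solution class, \<open>q\<^sub>t\<close> and \<open>q\<^sub>x\<^sub>x\<close> are elements of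
  \<open>L\<^sup>2(0,\<infinity>)\<close>, so for each \<open>t > 0\<close> the equation is an identity in that space.
  Each \<open>q(\<cdot>,t)\<close> is taken to be the representative of its \<open>H\<^sup>2\<close> class that is continuous on
  \<open>[0,\<infinity>)\<close>; this is what gives the values at \<open>x = 0\<close> their meaning.
\<close>

definition defocusing_NLS_solution :: "(real \<Rightarrow> complex) \<Rightarrow> (real \<Rightarrow> real \<Rightarrow> complex) \<Rightarrow> bool" where
  "defocusing_NLS_solution Q q \<longleftrightarrow>
     C0_curve H2 H2_norm (\<lambda>t x. q x t) \<and>
     (\<forall>t\<ge>0. continuous_on {0..} (\<lambda>x. q x t)) \<and>
     (\<exists>q\<^sub>t. C1_L2_curve (\<lambda>t x. q x t) q\<^sub>t \<and>
        (\<forall>t>0. AE x in lebesgue_on {0<..}.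
           \<i> * q\<^sub>t t x + weak_deriv (weak_deriv (\<lambda>y. q y t)) x
             - 2 * complex_of_real ((cmod (q x t))\<^sup>2) * q x t = 0)) \<and>
     (\<forall>x\<ge>0. q x 0 = 0) \<and>
     (\<forall>t\<ge>0. q 0 t = Q t)"

end

(*
  Pseudoconformal energy method.  With E(t) = int |x q + 2 i t q_x|^2 + 4 t^2 |q|^4 dx and
  F(t) = int |q|^4 dx one finds
    E'(t) = 4 t F(t) - 4 t Re (conj Q(t) q_x(0,t)) - 8 t^2 Re (conj Q'(t) q_x(0,t)).
  The momentum, mass and energy identities bound q_x(0,.) in L^2(0,oo), so for alpha > 3/2 and
  beta > 5/2 the boundary terms are integrable in t by AM-GM.  Since E >= 4 t^2 F, this gives
  4 t^2 F(t) <= K + int_0^t 4 s F(s) ds, and Gronwall's lemma yields F(t) <= c/t.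

  x q(.,t) is not known to lie in L^2 and q_xt need not exist.  Hence x^2 is replaced by
  sin(e x)^2 / e^2, with e -> 0 at the end, and the time derivatives of the functionals that
  contain q_x are computed from difference quotients, moving the x-derivative off the increment
  of q_x by an integration by parts.
*)
theory Submission
  imports Defs
begin

section \<open>Smooth bump functions\<close>

text \<open>Two obstacles shape the proof. The solution class speaks of weak derivatives through a
  chosen representative \<open>weak_deriv\<close>, fixed only up to null sets, while the identities
  need the boundary value q_x(0,t). So everything is rewritten with integral representations
  (\<open>AC_deriv\<close>). This rests on uniqueness of weak derivatives and hence on a supply of
  test functions, made from exp(-1/x). Mass and energy change by terms linear in the unknown
  q_x(0,t), so neither is bounded a priori. Momentum changes by |q_x(0,t)|^2 and is at most half of
  mass plus kinetic energy; hence momentum - (mass + energy)/2 stays \<le> 0 while its growth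
  controls the flux. The thresholds come from pairing t Q and t^2 Q' with q_x(0,t): t^2 |Q|^2 and
  t^4 |Q'|^2 must be integrable at infinity, that is 2\<alpha> - 2 > 1 and 2\<beta> - 4 > 1. The
  rate is 1/t and not 1/t^2 because the bulk term 4 t F survives and lets the bound on E grow
  linearly. Like x^2, the weight sin(e x)^2 / e^2 vanishes to second order at 0 and has |b'| \<le> 2
  sqrt b, which keeps E above 4 t^2 F; unlike x^2 it is bounded.\<close>

definition smooth :: "(real \<Rightarrow> real) \<Rightarrow> bool" where
  "smooth f \<longleftrightarrow> (\<forall>n x. (deriv ^^ n) f field_differentiable (at x))"

text \<open>Smooth functions form the largest class closed under differentiation, so exhibiting any
  such class replaces formulas for n-th derivatives.\<close>

lemma smooth_coinduct:
  assumes "f \<in> C"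
    and C: "\<And>f. f \<in> C \<Longrightarrow> \<exists>f'\<in>C. \<forall>x. (f has_field_derivative f' x) (at x)"
  shows "smooth f"
proof -
  have "(deriv ^^ n) f \<in> C" for n
  proof (induction n)
    case 0
    then show ?case using assms(1) by simp
  next
    case (Suc n)
    then obtain f' where "f' \<in> C" "\<forall>x. ((deriv ^^ n) f has_field_derivative f' x) (at x)"
      using C by blast
    moreover from this have "deriv ((deriv ^^ n) f) = f'"
      by (auto intro: DERIV_imp_deriv)
    ultimately show ?case by simp
  qed
  then show ?thesis
    unfolding smooth_def field_differentiable_def using C by blast
qed

lemma smooth_has_deriv: "smooth f \<Longrightarrow> (f has_field_derivative deriv f x) (at x)"
  unfolding smooth_def by (metis DERIV_deriv_iff_field_differentiable funpow_0)

lemma smooth_deriv: "smooth f \<Longrightarrow> smooth (deriv f)"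
  unfolding smooth_def by (metis comp_apply funpow_Suc_right)

lemma smooth_continuous_on: "smooth f \<Longrightarrow> continuous_on A f"
  using smooth_has_deriv DERIV_isCont continuous_at_imp_continuous_on by blast

lemma smooth_if_deriv_smooth:
  assumes "\<And>x. (f has_field_derivative f' x) (at x)" "smooth f'"
  shows "smooth f"
proof (rule smooth_coinduct)
  show "f \<in> insert f (Collect smooth)" by simp
  fix h assume "h \<in> insert f (Collect smooth)"
  then show "\<exists>h'\<in>insert f (Collect smooth). \<forall>x. (h has_field_derivative h' x) (at x)"
    using assms smooth_has_deriv smooth_deriv by blast
qed

text \<open>Products alone are not closed under differentiation. The Leibniz rule leads to sums of
  products, and these are; this is the class for \<open>smooth_coinduct\<close>.\<close>

inductive_set sums_of_smooth_products :: "(real \<Rightarrow> real) set" where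
  prod: "smooth f \<Longrightarrow> smooth g \<Longrightarrow> (\<lambda>x. f x * g x) \<in> sums_of_smooth_products"
| add: "f \<in> sums_of_smooth_products \<Longrightarrow> g \<in> sums_of_smooth_products
          \<Longrightarrow> (\<lambda>x. f x + g x) \<in> sums_of_smooth_products"

lemma smooth_sums_of_products:
  assumes "f \<in> sums_of_smooth_products"
  shows "smooth f"
proof (rule smooth_coinduct[OF assms])
  fix h assume "h \<in> sums_of_smooth_products"
  then show "\<exists>h'\<in>sums_of_smooth_products. \<forall>x. (h has_field_derivative h' x) (at x)"
  proof induction
    case (prod f g)
    have "(\<lambda>x. deriv f x * g x + f x * deriv g x) \<in> sums_of_smooth_products"
      using prod by (intro sums_of_smooth_products.intros smooth_deriv)
    moreover have "((\<lambda>x. f x * g x) has_field_derivative deriv f x * g x + f x * deriv g x) (at x)" for x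
      using prod smooth_has_deriv by (auto intro!: derivative_eq_intros)
    ultimately show ?case by (intro bexI) auto
  next
    case (add f g)
    then obtain f' g' where "f' \<in> sums_of_smooth_products" "g' \<in> sums_of_smooth_products"
      "\<forall>x. (f has_field_derivative f' x) (at x)" "\<forall>x. (g has_field_derivative g' x) (at x)"
      by blast
    then show ?case
      by (intro bexI[of _ "\<lambda>x. f' x + g' x"]) (auto intro: sums_of_smooth_products.intros derivative_intros)
  qed
qed

lemma smooth_const: "smooth (\<lambda>x. c)"
proof (rule smooth_coinduct)
  show "(\<lambda>x. c) \<in> range (\<lambda>d x. d)" by simp
  fix h :: "real \<Rightarrow> real" assume "h \<in> range (\<lambda>d x. d)"
  then show "\<exists>h'\<in>range (\<lambda>d x. d). \<forall>x. (h has_field_derivative h' x) (at x)"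
    by (intro bexI[of _ "\<lambda>x. 0"]) (auto intro!: derivative_eq_intros)
qed

lemma smooth_mult: "smooth f \<Longrightarrow> smooth g \<Longrightarrow> smooth (\<lambda>x. f x * g x)"
  by (rule smooth_sums_of_products[OF sums_of_smooth_products.prod])

lemma smooth_diff:
  assumes "smooth f" "smooth g" shows "smooth (\<lambda>x. f x - g x)"
proof -
  have "(\<lambda>x. f x * 1 + (-1) * g x) \<in> sums_of_smooth_products"
    using assms by (intro sums_of_smooth_products.intros smooth_const)
  then show ?thesis using smooth_sums_of_products by fastforce
qed

lemma smooth_affine:
  assumes "smooth f" shows "smooth (\<lambda>x. f (c * x + d))"
proof (rule smooth_coinduct)
  \<comment> \<open>The free factor \<open>e\<close> absorbs the powers of \<open>c\<close> produced
    by the chain rule.\<close>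
  let ?C = "{h. \<exists>e f. smooth f \<and> h = (\<lambda>x. e * f (c * x + d))}"
  show "(\<lambda>x. f (c * x + d)) \<in> ?C"
    using assms by (auto intro!: exI[of _ "1::real"])
  fix h assume "h \<in> ?C"
  then obtain e g where g: "smooth g" "h = (\<lambda>x. e * g (c * x + d))" by blast
  have "(h has_field_derivative e * c * deriv g (c * x + d)) (at x)" for x
    unfolding g(2)
    by (rule derivative_eq_intros DERIV_chain2[OF smooth_has_deriv[OF g(1)]] refl)+ simp
  moreover have "(\<lambda>x. e * c * deriv g (c * x + d)) \<in> ?C"
    using smooth_deriv[OF g(1)] by blast
  ultimately show "\<exists>h'\<in>?C. \<forall>x. (h has_field_derivative h' x) (at x)" by (intro bexI) auto
qed

text \<open>The classical flat function p(1/x) exp(-1/x), extended by 0. The polynomial is a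
  parameter so that the family is closed under differentiation.\<close>

definition flat_exp :: "real poly \<Rightarrow> real \<Rightarrow> real" where
  "flat_exp p x = (if x > 0 then poly p (1 / x) * exp (- (1 / x)) else 0)"

lemma poly_times_exp_tendsto_0:
  fixes p :: "real poly"
  shows "((\<lambda>y. poly p y * exp (- y)) \<longlongrightarrow> 0) at_top"
proof -
  have "((\<lambda>y. \<Sum>i\<le>degree p. coeff p i * (y ^ i / exp y)) \<longlongrightarrow> (\<Sum>i\<le>degree p. coeff p i * 0)) at_top"
    by (intro tendsto_intros tendsto_power_div_exp_0)
  then show ?thesis
    by (simp add: poly_altdef sum_distrib_right exp_minus divide_inverse mult.assoc)
qed

text \<open>With y = 1/x, differentiating p(y) exp(-y) gives the factor -y^2 times (p' - p)(y)
  exp(-y); \<open>[:0, 0, 1:]\<close> is y^2. Only x = 0 needs a limit argument.\<close>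

lemma flat_exp_deriv:
  "(flat_exp p has_field_derivative flat_exp ([:0, 0, 1:] * (p - pderiv p)) x) (at x)"
proof -
  consider "x > 0" | "x < 0" | "x = 0" by linarith
  then show ?thesis
  proof cases
    case 1
    have "((\<lambda>x. poly p (1 / x) * exp (- (1 / x))) has_field_derivative
            flat_exp ([:0, 0, 1:] * (p - pderiv p)) x) (at x)"
      using 1 unfolding flat_exp_def
      by (auto intro!: derivative_eq_intros DERIV_chain2[OF poly_DERIV]
               simp: field_simps power2_eq_square)
    moreover have "eventually (\<lambda>y. y > 0) (nhds x)"
      using 1 eventually_nhds_in_open[of "{0<..}" x] by simp
    then have "eventually (\<lambda>y. flat_exp p y = poly p (1 / y) * exp (- (1 / y))) (nhds x)"
      by eventually_elim (simp add: flat_exp_def)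
    ultimately show ?thesis
      by (subst DERIV_cong_ev[OF refl _ refl])
  next
    case 2
    have "eventually (\<lambda>y. y < 0) (nhds x)"
      using 2 eventually_nhds_in_open[of "{..<0}" x] by simp
    then have "eventually (\<lambda>y. flat_exp p y = 0) (nhds x)"
      by eventually_elim (simp add: flat_exp_def)
    moreover have "((\<lambda>y. 0) has_field_derivative flat_exp ([:0, 0, 1:] * (p - pderiv p)) x) (at x)"
      using 2 by (simp add: flat_exp_def)
    ultimately show ?thesis
      by (subst DERIV_cong_ev[OF refl _ refl])
  next
    case 3
    have "((\<lambda>h. flat_exp p h / h) \<longlongrightarrow> 0) (at_right 0)"
    proof -
      \<comment> \<open>Dividing by h multiplies the polynomial by y = 1/h, so the right-hand
        difference quotient at 0 is again a polynomial times exp(-y), with y tending to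
        infinity.\<close>
      have "((\<lambda>h. poly ([:0, 1:] * p) (inverse h) * exp (- inverse h)) \<longlongrightarrow> 0) (at_right (0::real))"
        using filterlim_compose[OF poly_times_exp_tendsto_0 filterlim_inverse_at_top_right] .
      then show ?thesis
        by (rule Lim_transform_eventually)
           (auto intro!: eventually_mono[OF eventually_at_right_less] simp: flat_exp_def inverse_eq_divide)
    qed
    moreover have "((\<lambda>h. flat_exp p h / h) \<longlongrightarrow> 0) (at_left 0)"
      by (rule Lim_transform_eventually[OF tendsto_const])
         (auto simp: flat_exp_def eventually_at_filter)
    ultimately have "((\<lambda>h. flat_exp p h / h) \<longlongrightarrow> 0) (at 0)"
      by (simp add: filterlim_split_at)
    then show ?thesis
      using 3 by (simp add: DERIV_def flat_exp_def)
  qed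
qed

lemma smooth_flat_exp: "smooth (flat_exp p)"
proof (rule smooth_coinduct)
  show "flat_exp p \<in> range flat_exp" by simp
  fix h assume "h \<in> range flat_exp"
  then show "\<exists>h'\<in>range flat_exp. \<forall>x. (h has_field_derivative h' x) (at x)"
    using flat_exp_deriv by blast
qed

text \<open>Increasing \<open>c\<close> steepens both factors while the support stays in [a,b] and
  the values stay in [0,1]. The limit is the indicator of (a,b), and the constant 1 is a
  majorant.\<close>

definition bump :: "real \<Rightarrow> real \<Rightarrow> real \<Rightarrow> real \<Rightarrow> real" where
  "bump c a b x = flat_exp 1 (c * (x - a)) * flat_exp 1 (c * (b - x))"

lemma smooth_bump: "smooth (bump c a b)"
proof -
  have "bump c a b = (\<lambda>x. flat_exp 1 (c * x + (- c * a)) * flat_exp 1 (- c * x + c * b))"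
    by (auto simp: bump_def algebra_simps)
  then show ?thesis
    by (simp only:) (rule smooth_mult[OF smooth_affine[OF smooth_flat_exp] smooth_affine[OF smooth_flat_exp]])
qed

lemma flat_exp_1_range: "0 \<le> flat_exp 1 x" "flat_exp 1 x \<le> 1"
  by (auto simp: flat_exp_def)

lemma bump_range: "0 \<le> bump c a b x" "bump c a b x \<le> 1"
  using flat_exp_1_range by (auto simp: bump_def intro!: mult_le_one)

lemma bump_eq_0: "c > 0 \<Longrightarrow> x \<notin> {a<..<b} \<Longrightarrow> bump c a b x = 0"
  by (auto simp: bump_def flat_exp_def zero_less_mult_iff)

lemma bump_pos: "c > 0 \<Longrightarrow> x \<in> {a<..<b} \<Longrightarrow> bump c a b x > 0"
  by (auto simp: bump_def flat_exp_def zero_less_mult_iff)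

lemma bump_tendsto: "(\<lambda>n. bump (real (Suc n)) a b x) \<longlonglongrightarrow> indicator {a<..<b} x"
proof (cases "x \<in> {a<..<b}")
  case True
  have 1: "(\<lambda>n. exp (- (1 / (real (Suc n) * d)))) \<longlonglongrightarrow> 1" if "d > 0" for d
  proof -
    have "(\<lambda>n. inverse (real (Suc n)) * (1 / d)) \<longlonglongrightarrow> 0 * (1 / d)"
      by (intro tendsto_intros LIMSEQ_inverse_real_of_nat)
    then have "(\<lambda>n. exp (- (inverse (real (Suc n)) * (1 / d)))) \<longlonglongrightarrow> exp (- 0)"
      by (intro tendsto_intros) simp
    then show ?thesis by (simp add: field_simps)
  qed
  have "(\<lambda>n. exp (- (1 / (real (Suc n) * (x - a)))) * exp (- (1 / (real (Suc n) * (b - x))))) \<longlonglongrightarrow> 1 * 1"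
    using True by (intro tendsto_mult 1) auto
  moreover have "bump (real (Suc n)) a b x = exp (- (1 / (real (Suc n) * (x - a)))) * exp (- (1 / (real (Suc n) * (b - x))))" for n
    using True unfolding bump_def flat_exp_def by (subst if_P, simp)+ simp
  ultimately show ?thesis using True by simp
next
  case False
  then show ?thesis by (simp add: bump_eq_0 del: of_nat_Suc)
qed

section \<open>Absolutely continuous functions on the half-line\<close>

text \<open>Absolute continuity is encoded as an integral representation rather than as
  differentiability almost everywhere: increments, continuity and the value at 0 can be read off
  directly, and changing \<open>g\<close> on a null set is harmless.\<close>

definition AC_deriv :: "(real \<Rightarrow> complex) \<Rightarrow> (real \<Rightarrow> complex) \<Rightarrow> bool" where
  "AC_deriv f g \<longleftrightarrow> (\<forall>x\<ge>0. g absolutely_integrable_on {0..x} \<and> f x = f 0 + integral {0..x} g)"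

lemma AC_deriv_eq: "AC_deriv f g \<Longrightarrow> 0 \<le> x \<Longrightarrow> f x = f 0 + integral {0..x} g"
  unfolding AC_deriv_def by blast

lemma AC_deriv_abs_integrable:
  assumes "AC_deriv f g" "0 \<le> x"
  shows "g absolutely_integrable_on {x..y}"
proof (cases "x \<le> y")
  case True
  then have "g absolutely_integrable_on {0..y}"
    using assms unfolding AC_deriv_def by (meson order_trans)
  then show ?thesis
    by (rule set_integrable_subset) (use assms in auto)
qed (simp add: set_integrable_def)

lemma AC_deriv_integrable_on: "AC_deriv f g \<Longrightarrow> 0 \<le> x \<Longrightarrow> g integrable_on {x..y}"
  using AC_deriv_abs_integrable absolutely_integrable_on_def by blast

lemma AC_deriv_increment:
  assumes "AC_deriv f g" "0 \<le> x" "x \<le> y"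
  shows "f y - f x = integral {x..y} g"
proof -
  have "integral {0..x} g + integral {x..y} g = integral {0..y} g"
    using assms by (intro Henstock_Kurzweil_Integration.integral_combine AC_deriv_integrable_on) auto
  then show ?thesis
    using AC_deriv_eq[OF assms(1), of x] AC_deriv_eq[OF assms(1), of y] assms(2,3)
    by (simp add: algebra_simps)
qed

lemma continuous_on_halfline:
  fixes f :: "real \<Rightarrow> 'a::topological_space"
  assumes "\<And>b. b \<ge> 0 \<Longrightarrow> continuous_on {0..b} f"
  shows "continuous_on {0..} f"
  unfolding continuous_on_eq_continuous_within
proof
  fix x :: real assume x: "x \<in> {0..}"
  have "continuous (at x within {0..x+1}) f"
    using assms[of "x+1"] x by (auto simp: continuous_on_eq_continuous_within)
  moreover have "at x within {0..x+1} = at x within {0..}"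
    by (rule at_within_nhd[of _ "{..<x+1}"]) auto
  ultimately show "continuous (at x within {0..}) f" by simp
qed

lemma AC_deriv_continuous_on:
  assumes "AC_deriv f g"
  shows "continuous_on {0..} f"
proof (rule continuous_on_halfline)
  fix b :: real assume "b \<ge> 0"
  have "continuous_on {0..b} (\<lambda>x. f 0 + integral {0..x} g)"
    by (intro continuous_intros indefinite_integral_continuous_1 AC_deriv_integrable_on[OF assms]) simp
  moreover have "f x = f 0 + integral {0..x} g" if "x \<in> {0..b}" for x
    by (rule AC_deriv_eq[OF assms]) (use that in simp)
  ultimately show "continuous_on {0..b} f"
    by (metis (no_types, lifting) continuous_on_cong)
qed

lemma AC_derivI_has_derivative:
  assumes "\<And>x. x \<ge> 0 \<Longrightarrow> (f has_vector_derivative f' x) (at x within {0..})"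
    and "continuous_on {0..} f'"
  shows "AC_deriv f f'"
  unfolding AC_deriv_def
proof (intro allI impI conjI)
  fix x :: real assume x: "x \<ge> 0"
  show "f' absolutely_integrable_on {0..x}"
    by (rule absolutely_integrable_continuous_real) (rule continuous_on_subset[OF assms(2)], auto)
  have "(f' has_integral f x - f 0) {0..x}"
    by (rule fundamental_theorem_of_calculus[OF x])
       (auto intro!: has_vector_derivative_within_subset[OF assms(1)])
  then show "f x = f 0 + integral {0..x} f'"
    by (simp add: integral_unique)
qed

lemma AC_deriv_diff:
  assumes "AC_deriv f f'" "AC_deriv h h'"
  shows "AC_deriv (\<lambda>x. f x - h x) (\<lambda>x. f' x - h' x)"
  unfolding AC_deriv_def
proof (intro allI impI conjI)
  fix x :: real assume x: "x \<ge> 0"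
  show "(\<lambda>x. f' x - h' x) absolutely_integrable_on {0..x}"
    using assms x by (intro set_integral_diff AC_deriv_abs_integrable) auto
  have "integral {0..x} (\<lambda>x. f' x - h' x) = integral {0..x} f' - integral {0..x} h'"
    using assms x by (intro Henstock_Kurzweil_Integration.integral_diff AC_deriv_integrable_on) auto
  then show "f x - h x = f 0 - h 0 + integral {0..x} (\<lambda>x. f' x - h' x)"
    by (subst (1) AC_deriv_eq[OF assms(1) x], subst (1) AC_deriv_eq[OF assms(2) x]) simp
qed

lemma AC_deriv_cnj:
  assumes "AC_deriv f f'"
  shows "AC_deriv (\<lambda>x. cnj (f x)) (\<lambda>x. cnj (f' x))"
  unfolding AC_deriv_def
proof (intro allI impI conjI)
  fix x :: real assume x: "0 \<le> x"
  have a: "f' absolutely_integrable_on {0..x}" using AC_deriv_abs_integrable[OF assms] by simp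
  then show "(\<lambda>x. cnj (f' x)) absolutely_integrable_on {0..x}"
    by (auto simp: absolutely_integrable_on_def integrable_on_cnj_iff)
  have "integral {0..x} (\<lambda>x. cnj (f' x)) = cnj (integral {0..x} f')"
    by (simp add: integral_cnj)
  then show "cnj (f x) = cnj (f 0) + integral {0..x} (\<lambda>x. cnj (f' x))"
    using AC_deriv_eq[OF assms x] by (metis complex_cnj_add)
qed

lemma absolutely_integrable_mult_continuous:
  fixes f g :: "real \<Rightarrow> complex"
  assumes "g absolutely_integrable_on {a..b}" "continuous_on {a..b} f"
  shows "(\<lambda>x. g x * f x) absolutely_integrable_on {a..b}"
proof -
  have "(\<lambda>x. f x * g x) absolutely_integrable_on {a..b}"
  proof (rule absolutely_integrable_bounded_measurable_product[where h="(*)"])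
    show "bilinear ((*) :: complex \<Rightarrow> complex \<Rightarrow> complex)"
      by (simp add: bilinear_conv_bounded_bilinear bounded_bilinear_mult)
    show "f \<in> borel_measurable (lebesgue_on {a..b})"
      using assms(2) by (intro continuous_imp_measurable_on_sets_lebesgue) auto
    show "bounded (f ` {a..b})"
      using assms(2) compact_continuous_image compact_imp_bounded by blast
  qed (use assms in auto)
  then show ?thesis by (simp add: mult.commute)
qed

text \<open>Chaining steps of length d/2 extends the bound from short intervals to all of [a,b]. In
  the product rule below, the defect is controlled only on short intervals, where uniform continuity
  applies.\<close>

lemma increment_bound_of_local:
  fixes D :: "real \<Rightarrow> 'a::real_normed_vector" and N :: "real \<Rightarrow> real"
  assumes "\<And>x y. a \<le> x \<Longrightarrow> x \<le> y \<Longrightarrow> y \<le> b \<Longrightarrow> y - x < d \<Longrightarrow> norm (D y - D x) \<le> N y - N x"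
    and "d > 0" "a \<le> b"
  shows "norm (D b - D a) \<le> N b - N a"
proof -
  have *: "norm (D y - D x) \<le> N y - N x" if "a \<le> x" "x \<le> y" "y \<le> b" "y - x \<le> real n * (d / 2)" for n x y
    using that
  proof (induction n arbitrary: y)
    case 0
    then show ?case by simp
  next
    case (Suc n)
    show ?case
    proof (cases "y - x < d")
      case True
      then show ?thesis using assms Suc by auto
    next
      case False
      let ?m = "y - d / 2"
      have "norm (D ?m - D x) \<le> N ?m - N x"
        using Suc False assms by (intro Suc.IH) (auto simp: algebra_simps)
      moreover have "norm (D y - D ?m) \<le> N y - N ?m"
        using False Suc assms(2) by (intro assms(1)) auto
      moreover have "norm (D y - D x) \<le> norm (D y - D ?m) + norm (D ?m - D x)"
        by (metis diff_add_cancel norm_triangle_ineq diff_diff_eq2 add_diff_eq)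
      ultimately show ?thesis by linarith
    qed
  qed
  obtain n :: nat where "b - a \<le> real n * (d / 2)"
    using assms(2) reals_Archimedean3[of "d/2"] by (metis half_gt_zero less_imp_le)
  then show ?thesis using * assms(3) by blast
qed

text \<open>The defect in the product rule has increments of size \<open>o(1)\<close> times those of
  \<open>\<integral> |f'| + |h'|\<close>, because \<open>f\<close> and \<open>h\<close> are uniformly continuous; hence it is constant.\<close>

lemma AC_deriv_mult:
  assumes f: "AC_deriv f f'" and h: "AC_deriv h h'"
  shows "AC_deriv (\<lambda>x. f x * h x) (\<lambda>x. f' x * h x + h' x * f x)"
proof -
  let ?g = "\<lambda>x. f' x * h x + h' x * f x"
  have cont: "continuous_on {x..y} f" "continuous_on {x..y} h" if "0 \<le> x" for x y
    using AC_deriv_continuous_on[OF f] AC_deriv_continuous_on[OF h] that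
    by (auto elim!: continuous_on_subset)
  have ai: "?g absolutely_integrable_on {x..y}" if "0 \<le> x" for x y
    using that by (intro set_integral_add absolutely_integrable_mult_continuous cont
                    AC_deriv_abs_integrable[OF f] AC_deriv_abs_integrable[OF h])
  have io: "(\<lambda>s. f' s * h s) integrable_on {x..y}" "(\<lambda>s. h' s * f s) integrable_on {x..y}" if "0 \<le> x" for x y
    using that by (auto intro!: set_lebesgue_integral_eq_integral(1) absolutely_integrable_mult_continuous cont
                    AC_deriv_abs_integrable[OF f] AC_deriv_abs_integrable[OF h])
  have nio: "(\<lambda>s. norm (f' s)) integrable_on {x..y}" "(\<lambda>s. norm (h' s)) integrable_on {x..y}" if "0 \<le> x" for x y
    using AC_deriv_abs_integrable[OF f] AC_deriv_abs_integrable[OF h] that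
    by (auto simp: absolutely_integrable_on_def)
  define N where "N x = integral {0..x} (\<lambda>s. norm (f' s) + norm (h' s))" for x
  define D where "D x = f x * h x - integral {0..x} ?g" for x
  have "D b = D 0" if b: "0 \<le> b" for b
  proof -
    have "norm (D b - D 0) \<le> e * (N b - N 0)" if e: "e > 0" for e
    proof -
      have "uniformly_continuous_on {0..b} f" "uniformly_continuous_on {0..b} h"
        by (auto intro!: compact_uniformly_continuous cont)
      then obtain d1 d2 where d: "d1 > 0" "d2 > 0"
        "\<And>x y. x \<in> {0..b} \<Longrightarrow> y \<in> {0..b} \<Longrightarrow> dist y x < d1 \<Longrightarrow> dist (f y) (f x) < e"
        "\<And>x y. x \<in> {0..b} \<Longrightarrow> y \<in> {0..b} \<Longrightarrow> dist y x < d2 \<Longrightarrow> dist (h y) (h x) < e"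
        using e unfolding uniformly_continuous_on_def by metis
      have "norm (D b - D 0) \<le> e * N b - e * N 0"
      proof (rule increment_bound_of_local[where d = "min d1 d2" and N = "\<lambda>x. e * N x"])
        fix x y assume xy: "0 \<le> x" "x \<le> y" "y \<le> b" "y - x < min d1 d2"
        have gi: "?g integrable_on {x..y}"
          using ai[OF xy(1)] by (rule set_lebesgue_integral_eq_integral(1))
        let ?F = "\<lambda>s. f' s * (h x - h s) + h' s * (f y - f s)"
        have "integral {0..x} ?g + integral {x..y} ?g = integral {0..y} ?g"
          using xy ai by (intro Henstock_Kurzweil_Integration.integral_combine set_lebesgue_integral_eq_integral(1)) auto
        \<comment> \<open>Evaluating \<open>h\<close> at the left end and \<open>f\<close> at the
          right end splits the increment of the product exactly, without a quadratic
          remainder.\<close>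
        then have "D y - D x = (f y - f x) * h x + (h y - h x) * f y - integral {x..y} ?g"
          by (simp add: D_def algebra_simps)
        also have "\<dots> = integral {x..y} f' * h x + integral {x..y} h' * f y - integral {x..y} ?g"
          using AC_deriv_increment[OF f xy(1,2)] AC_deriv_increment[OF h xy(1,2)] by simp
        also have "\<dots> = integral {x..y} (\<lambda>s. f' s * h x + h' s * f y) - integral {x..y} ?g"
          using AC_deriv_integrable_on[OF f xy(1)] AC_deriv_integrable_on[OF h xy(1)]
          by (subst Henstock_Kurzweil_Integration.integral_add) (auto intro: integrable_on_mult_left)
        also have "\<dots> = integral {x..y} (\<lambda>s. (f' s * h x + h' s * f y) - ?g s)"
          using AC_deriv_integrable_on[OF f xy(1)] AC_deriv_integrable_on[OF h xy(1)]
          by (intro Henstock_Kurzweil_Integration.integral_diff[symmetric] gi integrable_add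
               integrable_on_mult_left) auto
        also have "\<dots> = integral {x..y} ?F"
          by (rule arg_cong[where f="integral {x..y}"]) (auto simp: algebra_simps)
        finally have D: "D y - D x = integral {x..y} ?F" .
        have "norm (D y - D x) \<le> integral {x..y} (\<lambda>s. e * (norm (f' s) + norm (h' s)))"
          unfolding D
        proof (rule integral_norm_bound_integral)
          have "(\<lambda>s. (f' s * h x + h' s * f y) - ?g s) integrable_on {x..y}"
            using AC_deriv_integrable_on[OF f xy(1)] AC_deriv_integrable_on[OF h xy(1)]
            by (intro integrable_diff gi integrable_add integrable_on_mult_left) auto
          then show "?F integrable_on {x..y}"
            by (rule integrable_eq) (auto simp: algebra_simps)
          show "(\<lambda>s. e * (norm (f' s) + norm (h' s))) integrable_on {x..y}"
            using nio xy by (intro integrable_on_mult_right integrable_add) auto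
          fix s assume s: "s \<in> {x..y}"
          have "norm (h x - h s) \<le> e" "norm (f y - f s) \<le> e"
            using d(3)[of s y] d(4)[of s x] s xy by (auto simp: dist_norm)
          then have "norm (f' s) * norm (h x - h s) + norm (h' s) * norm (f y - f s) \<le> norm (f' s) * e + norm (h' s) * e"
            by (intro add_mono mult_left_mono) auto
          moreover have "norm (?F s) \<le> norm (f' s) * norm (h x - h s) + norm (h' s) * norm (f y - f s)"
            by (metis norm_mult norm_triangle_ineq)
          ultimately show "norm (?F s) \<le> e * (norm (f' s) + norm (h' s))"
            by (simp only: distrib_left mult.commute[of e])
        qed
        also have "\<dots> = e * (N y - N x)"
        proof -
          have "N x + integral {x..y} (\<lambda>s. norm (f' s) + norm (h' s)) = N y"
            unfolding N_def using xy nio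
            by (intro Henstock_Kurzweil_Integration.integral_combine integrable_add) auto
          then have "integral {x..y} (\<lambda>s. norm (f' s) + norm (h' s)) = N y - N x" by simp
          then show ?thesis by (simp only: Henstock_Kurzweil_Integration.integral_mult_right)
        qed
        finally show "norm (D y - D x) \<le> e * N y - e * N x" by (simp add: algebra_simps)
      qed (use d b in auto)
      then show ?thesis by (simp add: algebra_simps)
    qed
    \<comment> \<open>Dividing by a positive number not depending on \<open>e\<close> leaves a
      quantity below every e > 0, hence \<le> 0.\<close>
    then have "norm (D b - D 0) / (1 + \<bar>N b - N 0\<bar>) \<le> 0 + e" if "e > 0" for e
    proof -
      have "norm (D b - D 0) \<le> e * (1 + \<bar>N b - N 0\<bar>)"
        using \<open>\<And>e. e > 0 \<Longrightarrow> norm (D b - D 0) \<le> e * (N b - N 0)\<close>[OF that]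
          mult_left_mono[of "N b - N 0" "1 + \<bar>N b - N 0\<bar>" e] that by linarith
      then show ?thesis by (simp add: pos_divide_le_eq add_pos_nonneg)
    qed
    then have "norm (D b - D 0) / (1 + \<bar>N b - N 0\<bar>) \<le> 0"
      by (rule field_le_epsilon)
    moreover have "1 + \<bar>N b - N 0\<bar> > 0" by (simp add: add_pos_nonneg)
    ultimately show ?thesis by (simp add: divide_le_0_iff)
  qed
  note D0 = this
  have "f x * h x = f 0 * h 0 + integral {0..x} ?g" if "0 \<le> x" for x
  proof -
    have "D x = f 0 * h 0"
      using D0[OF that] by (simp add: D_def)
    then show ?thesis
      unfolding D_def by (simp only: diff_eq_eq)
  qed
  then show ?thesis
    unfolding AC_deriv_def using ai by blast
qed

section \<open>Integrals over subsets of the half-line and limits at infinity\<close>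

lemma lebesgue_on_restrict_support:
  fixes h :: "real \<Rightarrow> 'a::{banach,second_countable_topology}"
  assumes "S \<subseteq> T" "S \<in> sets lebesgue" "T \<in> sets lebesgue" "\<And>x. x \<in> T - S \<Longrightarrow> h x = 0"
  shows "integrable (lebesgue_on T) h \<longleftrightarrow> integrable (lebesgue_on S) h"
    "integral\<^sup>L (lebesgue_on T) h = integral\<^sup>L (lebesgue_on S) h"
proof -
  have "(\<lambda>x. indicator T x *\<^sub>R h x) = (\<lambda>x. indicat_real S x *\<^sub>R h x)"
    using assms by (force simp: indicator_def)
  then show "integrable (lebesgue_on T) h \<longleftrightarrow> integrable (lebesgue_on S) h"
    "integral\<^sup>L (lebesgue_on T) h = integral\<^sup>L (lebesgue_on S) h"
    using assms by (auto simp: integrable_restrict_space integral_restrict_space)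
qed

lemma lebesgue_on_spike_set:
  fixes h :: "real \<Rightarrow> 'a::euclidean_space"
  assumes S: "S \<in> sets lebesgue" "T \<in> sets lebesgue" "negligible (S - T)" "negligible (T - S)"
  shows "integrable (lebesgue_on S) h \<longleftrightarrow> integrable (lebesgue_on T) h"
    "integral\<^sup>L (lebesgue_on S) h = integral\<^sup>L (lebesgue_on T) h"
proof -
  have neg: "negligible {x \<in> S - T. h x \<noteq> 0}" "negligible {x \<in> T - S. h x \<noteq> 0}"
    by (rule negligible_subset[OF S(3)], blast) (rule negligible_subset[OF S(4)], blast)
  show A: "integrable (lebesgue_on S) h \<longleftrightarrow> integrable (lebesgue_on T) h"
    using absolutely_integrable_spike_set_eq[OF neg] S by (simp add: set_integrable_def integrable_restrict_space)
  show "integral\<^sup>L (lebesgue_on S) h = integral\<^sup>L (lebesgue_on T) h"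
  proof (cases "integrable (lebesgue_on S) h")
    case True
    moreover from this have "integrable (lebesgue_on T) h" using A by simp
    ultimately show ?thesis
      using integral_spike_set[OF neg] S by (simp add: lebesgue_integral_eq_integral)
  next
    case False
    then show ?thesis using A not_integrable_integral_eq by metis
  qed
qed

lemma lebesgue_on_atLeast_0:
  fixes h :: "real \<Rightarrow> 'a::euclidean_space"
  shows "integrable (lebesgue_on {0..}) h \<longleftrightarrow> integrable (lebesgue_on {0<..}) h"
    "integral\<^sup>L (lebesgue_on {0..}) h = integral\<^sup>L (lebesgue_on {0<..}) h"
proof -
  have "{0..} - {0<..} = {0::real}" "{0<..} - {0..} = ({}::real set)" by auto
  then show "integrable (lebesgue_on {0..}) h \<longleftrightarrow> integrable (lebesgue_on {0<..}) h"
    "integral\<^sup>L (lebesgue_on {0..}) h = integral\<^sup>L (lebesgue_on {0<..}) h"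
    by (intro lebesgue_on_spike_set; simp)+
qed

lemma integrable_halfline_subinterval:
  fixes h :: "real \<Rightarrow> 'a::euclidean_space"
  assumes "integrable (lebesgue_on {0<..}) h" "0 \<le> a"
  shows "h absolutely_integrable_on {a..b}"
proof -
  have "h absolutely_integrable_on {0..}"
    using assms lebesgue_on_atLeast_0(1)[of h] by (simp add: set_integrable_def integrable_restrict_space)
  then show ?thesis
    by (rule set_integrable_subset) (use assms in auto)
qed

lemma integral_halfline_limit:
  fixes h :: "real \<Rightarrow> 'a::euclidean_space"
  assumes "integrable (lebesgue_on {0<..}) h"
  shows "((\<lambda>b. integral {0..b} h) \<longlongrightarrow> integral\<^sup>L (lebesgue_on {0<..}) h) at_top"
proof -
  have i: "set_integrable lebesgue {0..} h"
    using assms lebesgue_on_atLeast_0(1)[of h] by (simp add: set_integrable_def integrable_restrict_space)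
  have "((\<lambda>b. LINT x:{0..b}|lebesgue. h x) \<longlongrightarrow> (LINT x:{0..}|lebesgue. h x)) at_top"
    by (rule tendsto_set_lebesgue_integral_at_top[OF _ i]) auto
  moreover have "(LINT x:{0..b}|lebesgue. h x) = integral {0..b} h" for b
    using integrable_halfline_subinterval[OF assms] by (intro set_lebesgue_integral_eq_integral(2)) auto
  moreover have "(LINT x:{0..}|lebesgue. h x) = integral\<^sup>L (lebesgue_on {0<..}) h"
    using lebesgue_on_atLeast_0(2)[of h] by (simp add: set_lebesgue_integral_def integral_restrict_space)
  ultimately show ?thesis by simp
qed

text \<open>Integrability of \<open>g\<close> gives \<open>f\<close> a limit at infinity, and
  integrability of \<open>f\<close> forces this limit to be 0. This removes the boundary term at
  infinity from every later integration by parts.\<close>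

lemma AC_deriv_integral_halfline:
  assumes f: "AC_deriv f g" and i: "integrable (lebesgue_on {0<..}) f" "integrable (lebesgue_on {0<..}) g"
  shows "integral\<^sup>L (lebesgue_on {0<..}) g = - f 0"
proof -
  define L where "L = f 0 + integral\<^sup>L (lebesgue_on {0<..}) g"
  have "((\<lambda>x. f 0 + integral {0..x} g) \<longlongrightarrow> L) at_top"
    unfolding L_def by (intro tendsto_intros integral_halfline_limit i)
  then have lim: "(f \<longlongrightarrow> L) at_top"
    by (rule Lim_transform_eventually)
       (rule eventually_mono[OF eventually_ge_at_top[of 0]], rule AC_deriv_eq[OF f, symmetric])
  have "L = 0"
  proof (rule ccontr)
    assume "L \<noteq> 0"
    then have "eventually (\<lambda>x. dist (f x) L < norm L / 2) at_top"
      using lim tendstoD by (metis half_gt_zero zero_less_norm_iff)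
    then obtain X0 where X0: "\<And>x. x \<ge> X0 \<Longrightarrow> dist (f x) L < norm L / 2"
      by (auto simp: eventually_at_top_linorder)
    define X where "X = max X0 0"
    have low: "norm (f x) \<ge> norm L / 2" if "x \<ge> X" for x
      using X0[of x] that norm_triangle_ineq2[of L "f x"] by (auto simp: X_def dist_norm norm_minus_commute)
    define I where "I = (LINT x|lebesgue_on {0<..}. norm (f x))"
    have "norm L / 2 * real n \<le> I" for n
    proof -
      have ai: "f absolutely_integrable_on {X..X+real n}"
        using i(1) by (rule integrable_halfline_subinterval) (simp add: X_def)
      have "integral {X..X+real n} (\<lambda>x. norm L / 2) \<le> integral {X..X+real n} (\<lambda>x. norm (f x))"
        using ai low by (intro integral_le) (auto simp: absolutely_integrable_on_def)
      also have "\<dots> = (LINT x|lebesgue_on {X..X+real n}. norm (f x))"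
        using ai absolutely_integrable_imp_integrable[OF ai]
        by (intro lebesgue_integral_eq_integral[symmetric]) auto
      also have "\<dots> = (LINT x|lebesgue_on {X<..X+real n}. norm (f x))"
        by (intro lebesgue_on_spike_set) (auto intro: negligible_subset[of "{X}"])
      also have "\<dots> \<le> I"
        unfolding I_def using i(1) by (intro integral_mono_lebesgue_on_AE) (auto simp: X_def)
      finally show ?thesis by (simp add: field_simps)
    qed
    moreover obtain n :: nat where "real n * (norm L / 2) > I"
      using reals_Archimedean3[of "norm L / 2"] \<open>L \<noteq> 0\<close> by (metis half_gt_zero zero_less_norm_iff)
    ultimately show False by (metis linorder_not_le mult.commute)
  qed
  then show ?thesis by (simp add: L_def eq_neg_iff_add_eq_0 add.commute)
qed

section \<open>Weak derivatives\<close>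

lemma test_functionI:
  assumes "smooth \<phi>" "0 < a" "\<And>x. x \<notin> {a..b} \<Longrightarrow> \<phi> x = 0"
  shows "test_function \<phi>"
proof -
  have sub: "closure {x. \<phi> x \<noteq> 0} \<subseteq> {a..b}"
    using assms(3) by (intro closure_minimal) force+
  moreover have "compact (closure {x. \<phi> x \<noteq> 0})"
    using sub by (meson bounded_subset bounded_closed_interval closed_closure compact_eq_bounded_closed)
  ultimately show ?thesis
    using assms unfolding test_function_def smooth_def by force
qed

lemma test_function_support:
  assumes "test_function \<phi>"
  obtains a b where "0 < a" "a \<le> b" "\<And>x. x \<notin> {a..b} \<Longrightarrow> \<phi> x = 0"
proof (cases "closure {x. \<phi> x \<noteq> 0} = {}")
  case True
  then have "{x. \<phi> x \<noteq> 0} \<subseteq> {}" using closure_subset by metis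
  then show ?thesis using that[of 1 1] by auto
next
  case False
  let ?K = "closure {x. \<phi> x \<noteq> 0}"
  have K: "compact ?K" "?K \<subseteq> {0<..}" using assms by (auto simp: test_function_def)
  obtain a where a: "a \<in> ?K" "\<And>x. x \<in> ?K \<Longrightarrow> a \<le> x"
    using compact_attains_inf[OF K(1) False] by blast
  obtain b where b: "b \<in> ?K" "\<And>x. x \<in> ?K \<Longrightarrow> x \<le> b"
    using compact_attains_sup[OF K(1) False] by blast
  show ?thesis
  proof (rule that[of a b])
    show "0 < a" using a K by auto
    show "a \<le> b" using a b by blast
    show "\<phi> x = 0" if "x \<notin> {a..b}" for x
      using that a(2)[of x] b(2)[of x] closure_subset[of "{x. \<phi> x \<noteq> 0}"] by auto
  qed
qed

lemma test_function_smooth: "test_function \<phi> \<Longrightarrow> smooth \<phi>"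
  by (simp add: test_function_def smooth_def)

lemma deriv_eq_0_outside:
  fixes \<phi> :: "real \<Rightarrow> real"
  assumes "\<And>x. x \<notin> {a..b} \<Longrightarrow> \<phi> x = 0" "x \<notin> {a..b}"
  shows "deriv \<phi> x = 0"
proof -
  have "eventually (\<lambda>y. y \<in> - {a..b}) (nhds x)"
    using assms(2) by (intro eventually_nhds_in_open) auto
  then have "eventually (\<lambda>y. \<phi> y = 0) (nhds x)"
    by eventually_elim (use assms(1) in auto)
  then have "deriv \<phi> x = deriv (\<lambda>_. 0) x"
    by (intro deriv_cong_ev) auto
  then show ?thesis by simp
qed

lemma integrable_scaleR_compact_support:
  assumes f: "locally_integrable f" and \<phi>: "continuous_on UNIV \<phi>" "\<And>x. x \<notin> {a..b} \<Longrightarrow> \<phi> x = 0" "0 < a"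
  shows "integrable (lebesgue_on {0<..}) (\<lambda>x. \<phi> x *\<^sub>R f x)"
proof -
  have "f absolutely_integrable_on {a..b}"
    using f \<phi>(3) by (simp add: locally_integrable_def set_integrable_def integrable_restrict_space)
  moreover have "continuous_on {a..b} (\<lambda>x. complex_of_real (\<phi> x))"
    by (intro continuous_intros continuous_on_subset[OF \<phi>(1)]) auto
  ultimately have "(\<lambda>x. f x * complex_of_real (\<phi> x)) absolutely_integrable_on {a..b}"
    by (rule absolutely_integrable_mult_continuous)
  then have "integrable (lebesgue_on {a..b}) (\<lambda>x. \<phi> x *\<^sub>R f x)"
    by (simp add: set_integrable_def integrable_restrict_space scaleR_conv_of_real mult.commute)
  then show ?thesis
    using \<phi> by (subst lebesgue_on_restrict_support(1)[of "{a..b}"]) auto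
qed

lemma integrable_test_function:
  assumes "locally_integrable f" "test_function \<phi>"
  shows "integrable (lebesgue_on {0<..}) (\<lambda>x. \<phi> x *\<^sub>R f x)"
    "integrable (lebesgue_on {0<..}) (\<lambda>x. deriv \<phi> x *\<^sub>R f x)"
proof -
  obtain a b where ab: "0 < a" "\<And>x. x \<notin> {a..b} \<Longrightarrow> \<phi> x = 0"
    using test_function_support[OF assms(2)] by metis
  have sm: "smooth \<phi>" by (rule test_function_smooth[OF assms(2)])
  show "integrable (lebesgue_on {0<..}) (\<lambda>x. \<phi> x *\<^sub>R f x)"
    by (rule integrable_scaleR_compact_support[OF assms(1) smooth_continuous_on[OF sm] ab(2) ab(1)])
  show "integrable (lebesgue_on {0<..}) (\<lambda>x. deriv \<phi> x *\<^sub>R f x)"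
    by (rule integrable_scaleR_compact_support[OF assms(1) smooth_continuous_on[OF smooth_deriv[OF sm]]
          deriv_eq_0_outside[OF ab(2)] ab(1)])
qed

text \<open>Lebesgue differentiation: almost everywhere the value is the limit of averages, which
  all vanish. \<open>k\<close> is first cut off to [1/n, n], because it need not be integrable near
  0 or near infinity.\<close>

lemma AE_zero_if_interval_integrals_zero:
  fixes k :: "real \<Rightarrow> complex"
  assumes k: "locally_integrable k" and z: "\<And>a b. 0 < a \<Longrightarrow> integral {a..b} k = 0"
  shows "AE x in lebesgue_on {0<..}. k x = 0"
proof -
  have "negligible {x. 1 / real (Suc n) < x \<and> x < real (Suc n) \<and> k x \<noteq> 0}" for n
  proof -
    define K where "K x = (if x \<in> {1 / real (Suc n)..real (Suc n)} then k x else 0)" for x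
    have int: "k integrable_on {c..d}" if "0 < c" for c d
      using k that by (auto simp: locally_integrable_def intro: integrable_on_lebesgue_on)
    have K: "K integrable_on cbox c d" "integral (cbox c d) K = 0" for c d
    proof -
      have eq: "cbox c d \<inter> {1 / real (Suc n)..real (Suc n)} = {max c (1 / real (Suc n))..min d (real (Suc n))}"
        by auto
      have pos: "0 < max c (1 / real (Suc n))"
        by (simp add: less_max_iff_disj)
      have "k integrable_on (cbox c d \<inter> {1 / real (Suc n)..real (Suc n)})"
        unfolding eq by (rule int[OF pos])
      then show "K integrable_on cbox c d"
        unfolding K_def by (subst integrable_restrict_Int) (simp add: Int_commute)
      show "integral (cbox c d) K = 0"
        unfolding K_def by (subst integral_restrict_Int) (simp only: Int_commute[of "{1 / real (Suc n)..real (Suc n)}"] eq z[OF pos])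
    qed
    obtain N where N: "negligible N"
      "\<And>x e. x \<notin> N \<Longrightarrow> 0 < e \<Longrightarrow> \<exists>d>0. \<forall>h. 0 < h \<and> h < d \<longrightarrow>
          norm (integral (cbox x (x + h *\<^sub>R One)) K /\<^sub>R h ^ DIM(real) - K x) < e"
      using integrable_ccontinuous_explicit[of K] K(1) by metis
    have "K x = 0" if xN: "x \<notin> N" for x
    proof (rule ccontr)
      assume "K x \<noteq> 0"
      then obtain d where "d > 0" "\<forall>h. 0 < h \<and> h < d \<longrightarrow>
          norm (integral (cbox x (x + h *\<^sub>R One)) K /\<^sub>R h ^ DIM(real) - K x) < norm (K x)"
        using N(2)[OF xN, of "norm (K x)"] by auto
      moreover from this have "0 < d / 2 \<and> d / 2 < d" by simp
      ultimately have "norm (integral (cbox x (x + (d/2) *\<^sub>R One)) K /\<^sub>R (d/2) ^ DIM(real) - K x) < norm (K x)"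
        by blast
      then show False by (simp only: K(2)) simp
    qed
    then have "k x = 0" if "x \<notin> N" "1 / real (Suc n) < x" "x < real (Suc n)" for x
      using that K_def[of x] by fastforce
    then show ?thesis
      by (intro negligible_subset[OF N(1)]) blast
  qed
  then have "negligible (\<Union>n. {x. 1 / real (Suc n) < x \<and> x < real (Suc n) \<and> k x \<noteq> 0})"
    by (rule negligible_Union_nat)
  moreover have "{x \<in> {0<..}. k x \<noteq> 0} \<subseteq> (\<Union>n. {x. 1 / real (Suc n) < x \<and> x < real (Suc n) \<and> k x \<noteq> 0})"
  proof safe
    fix x :: real assume x: "x > 0" "k x \<noteq> 0"
    obtain n where n: "x < real n" "1 / x < real n"
      using reals_Archimedean2[of "max x (1/x)"] by auto
    then have "x < real (Suc n)" "1 / real (Suc n) < x"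
      using x by (auto simp: field_simps)
    then show "x \<in> (\<Union>n. {x. 1 / real (Suc n) < x \<and> x < real (Suc n) \<and> k x \<noteq> 0})"
      using x by blast
  qed
  ultimately have "negligible {x \<in> {0<..}. k x \<noteq> 0}"
    using negligible_subset by blast
  then show ?thesis
    by (intro AE_I'[of "{x \<in> {0<..}. k x \<noteq> 0}"])
       (auto simp: negligible_iff_null_sets null_sets_restrict_space)
qed

text \<open>Bumps converge boundedly to indicators of intervals, so by dominated convergence all
  interval integrals of \<open>k\<close> vanish.\<close>

lemma fundamental_lemma_variations:
  assumes k: "locally_integrable k"
    and z: "\<And>\<phi>. test_function \<phi> \<Longrightarrow> (LINT x|lebesgue_on {0<..}. \<phi> x *\<^sub>R k x) = 0"
  shows "AE x in lebesgue_on {0<..}. k x = 0"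
proof (rule AE_zero_if_interval_integrals_zero[OF k])
  fix a b :: real assume a: "0 < a"
  have i: "integrable (lebesgue_on {a..b}) k" using k a by (auto simp: locally_integrable_def)
  have zero: "(LINT x|lebesgue_on {a..b}. bump (real (Suc n)) a b x *\<^sub>R k x) = 0" for n
  proof -
    have out: "bump (real (Suc n)) a b x = 0" if "x \<notin> {a..b}" for x
      using that by (intro bump_eq_0) auto
    have "(LINT x|lebesgue_on {0<..}. bump (real (Suc n)) a b x *\<^sub>R k x) = 0"
      by (rule z[OF test_functionI[OF smooth_bump a out]])
    then show ?thesis
      using a out by (subst (asm) lebesgue_on_restrict_support(2)[of "{a..b}"]) auto
  qed
  have "(\<lambda>n. LINT x|lebesgue_on {a..b}. bump (real (Suc n)) a b x *\<^sub>R k x) \<longlonglongrightarrow>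
          (LINT x|lebesgue_on {a..b}. indicator {a<..<b} x *\<^sub>R k x)"
  proof (rule integral_dominated_convergence[where w = "\<lambda>x. norm (k x)"])
    have "(bump (real (Suc n)) a b) \<in> borel_measurable (lebesgue_on {a..b})" for n
      by (intro continuous_imp_measurable_on_sets_lebesgue smooth_continuous_on smooth_bump) auto
    then show "(\<lambda>x. bump (real (Suc n)) a b x *\<^sub>R k x) \<in> borel_measurable (lebesgue_on {a..b})" for n
      using i by (intro borel_measurable_scaleR) auto
    have "indicat_real {a<..<b} \<in> borel_measurable (lebesgue_on {a..b})"
      by (intro measurable_restrict_space1 borel_measurable_indicator) auto
    then show "(\<lambda>x. indicat_real {a<..<b} x *\<^sub>R k x) \<in> borel_measurable (lebesgue_on {a..b})"
      using i by (intro borel_measurable_scaleR) auto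
    show "integrable (lebesgue_on {a..b}) (\<lambda>x. norm (k x))" using i by simp
    show "AE x in lebesgue_on {a..b}. (\<lambda>n. bump (real (Suc n)) a b x *\<^sub>R k x) \<longlonglongrightarrow> indicat_real {a<..<b} x *\<^sub>R k x"
      by (intro AE_I2 tendsto_intros bump_tendsto)
    show "AE x in lebesgue_on {a..b}. norm (bump (real (Suc n)) a b x *\<^sub>R k x) \<le> norm (k x)" for n
      using bump_range[of "real (Suc n)" a b]
      by (intro AE_I2) (simp add: mult_left_le_one_le del: of_nat_Suc)
  qed
  then have "(LINT x|lebesgue_on {a..b}. indicator {a<..<b} x *\<^sub>R k x) = 0"
    by (simp only: zero LIMSEQ_const_iff)
  moreover have "(LINT x|lebesgue_on {a..b}. indicator {a<..<b} x *\<^sub>R k x) = (LINT x|lebesgue_on {a<..<b}. indicator {a<..<b} x *\<^sub>R k x)"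
    by (rule lebesgue_on_restrict_support(2)) (auto simp: indicator_def)
  moreover have "\<dots> = (LINT x|lebesgue_on {a<..<b}. k x)"
    by (rule Bochner_Integration.integral_cong) auto
  moreover have "(LINT x|lebesgue_on {a<..<b}. k x) = (LINT x|lebesgue_on {a..b}. k x)"
    by (intro lebesgue_on_spike_set) (auto intro!: negligible_subset[of "{a,b}" "{a..b} - {a<..<b}"] negligible_subset[of "{}" "{a<..<b} - {a..b}"])
  ultimately show "integral {a..b} k = 0"
    using i by (simp add: lebesgue_integral_eq_integral)
qed

section \<open>Uniqueness and continuous representatives of weak derivatives\<close>

lemma locally_integrable_diff:
  "locally_integrable f \<Longrightarrow> locally_integrable g \<Longrightarrow> locally_integrable (\<lambda>x. f x - g x)"
  by (auto simp: locally_integrable_def)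

lemma has_weak_deriv_diff:
  assumes "has_weak_deriv f f'" "has_weak_deriv h h'"
  shows "has_weak_deriv (\<lambda>x. f x - h x) (\<lambda>x. f' x - h' x)"
  using assms unfolding has_weak_deriv_def
  by (auto simp: locally_integrable_diff scaleR_diff_right integrable_test_function)

lemma has_weak_deriv_unique:
  assumes "has_weak_deriv f g" "has_weak_deriv f h"
  shows "AE x in lebesgue_on {0<..}. g x = h x"
proof -
  have "AE x in lebesgue_on {0<..}. g x - h x = 0"
  proof (rule fundamental_lemma_variations)
    show "locally_integrable (\<lambda>x. g x - h x)"
      using assms by (auto simp: has_weak_deriv_def locally_integrable_diff)
    fix \<phi> assume "test_function \<phi>"
    then show "(LINT x|lebesgue_on {0<..}. \<phi> x *\<^sub>R (g x - h x)) = 0"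
      using assms unfolding has_weak_deriv_def
      by (simp add: scaleR_diff_right integrable_test_function)
  qed
  then show ?thesis by eventually_elim simp
qed

lemma integral_cong_AE_locally_integrable:
  assumes "locally_integrable f" "locally_integrable h" "AE x in lebesgue_on {0<..}. f x = h x" "test_function \<phi>"
  shows "(LINT x|lebesgue_on {0<..}. \<phi> x *\<^sub>R f x) = (LINT x|lebesgue_on {0<..}. \<phi> x *\<^sub>R h x)"
    "(LINT x|lebesgue_on {0<..}. deriv \<phi> x *\<^sub>R f x) = (LINT x|lebesgue_on {0<..}. deriv \<phi> x *\<^sub>R h x)"
  using integrable_test_function[OF assms(1,4)] integrable_test_function[OF assms(2,4)] assms(3)
  by (auto intro!: integral_cong_AE)

lemma has_weak_deriv_cong_AE:
  assumes "has_weak_deriv f g" "locally_integrable f1" "locally_integrable g1"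
    "AE x in lebesgue_on {0<..}. f x = f1 x" "AE x in lebesgue_on {0<..}. g x = g1 x"
  shows "has_weak_deriv f1 g1"
  using assms integral_cong_AE_locally_integrable[of f f1] integral_cong_AE_locally_integrable[of g g1]
  unfolding has_weak_deriv_def by metis

lemma AC_deriv_locally_integrable:
  assumes "AC_deriv f g"
  shows "locally_integrable f" "locally_integrable g"
proof -
  show "locally_integrable f"
    using AC_deriv_continuous_on[OF assms] unfolding locally_integrable_def
    by (auto intro!: continuous_imp_integrable_real elim: continuous_on_subset)
  show "locally_integrable g"
    using AC_deriv_abs_integrable[OF assms]
    by (auto simp: locally_integrable_def intro!: absolutely_integrable_imp_integrable)
qed

text \<open>The product of a test function and \<open>f\<close> is absolutely continuous and
  vanishes at 0, so its derivative has integral 0; the product rule splits this into the two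
  sides.\<close>

lemma AC_deriv_has_weak_deriv:
  assumes "AC_deriv f g"
  shows "has_weak_deriv f g"
  unfolding has_weak_deriv_def
proof (intro conjI allI impI AC_deriv_locally_integrable[OF assms])
  fix \<phi> assume \<phi>: "test_function \<phi>"
  have sm: "smooth \<phi>" by (rule test_function_smooth[OF \<phi>])
  have "AC_deriv (\<lambda>x. complex_of_real (\<phi> x)) (\<lambda>x. complex_of_real (deriv \<phi> x))"
  proof (rule AC_derivI_has_derivative)
    show "((\<lambda>x. complex_of_real (\<phi> x)) has_vector_derivative complex_of_real (deriv \<phi> x)) (at x within {0..})" for x
      using smooth_has_deriv[OF sm, of x]
      by (intro has_vector_derivative_of_real)
         (auto simp flip: has_real_derivative_iff_has_vector_derivative intro: has_field_derivative_at_within)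
  qed (intro continuous_intros smooth_continuous_on[OF smooth_deriv[OF sm]])
  then have "AC_deriv (\<lambda>x. complex_of_real (\<phi> x) * f x) (\<lambda>x. complex_of_real (deriv \<phi> x) * f x + g x * complex_of_real (\<phi> x))"
    using AC_deriv_mult assms by blast
  then have ac: "AC_deriv (\<lambda>x. \<phi> x *\<^sub>R f x) (\<lambda>x. deriv \<phi> x *\<^sub>R f x + \<phi> x *\<^sub>R g x)"
    by (simp add: scaleR_conv_of_real mult.commute)
  have i: "integrable (lebesgue_on {0<..}) (\<lambda>x. \<phi> x *\<^sub>R f x)" "integrable (lebesgue_on {0<..}) (\<lambda>x. deriv \<phi> x *\<^sub>R f x)"
     "integrable (lebesgue_on {0<..}) (\<lambda>x. \<phi> x *\<^sub>R g x)"
    using integrable_test_function \<phi> AC_deriv_locally_integrable[OF assms] by blast+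
  obtain a b where "0 < a" "\<And>x. x \<notin> {a..b} \<Longrightarrow> \<phi> x = 0"
    using test_function_support[OF \<phi>] by metis
  then have "\<phi> 0 = 0" by auto
  then show "(LINT x|lebesgue_on {0<..}. deriv \<phi> x *\<^sub>R f x) = - (LINT x|lebesgue_on {0<..}. \<phi> x *\<^sub>R g x)"
    using AC_deriv_integral_halfline[OF ac i(1)] i by (simp add: eq_neg_iff_add_eq_0)
qed

lemma integral_restrict_support:
  fixes h :: "real \<Rightarrow> 'a::banach"
  assumes "S \<subseteq> T" "\<And>x. x \<in> T - S \<Longrightarrow> h x = 0"
  shows "integral T h = integral S h"
proof (rule integral_spike_set)
  have "{x \<in> T - S. h x \<noteq> 0} = {}" "{x \<in> S - T. h x \<noteq> 0} = {}" using assms by auto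
  then show "negligible {x \<in> T - S. h x \<noteq> 0}" "negligible {x \<in> S - T. h x \<noteq> 0}"
    by (simp_all only: negligible_empty)
qed

text \<open>A test function \<open>\<psi>\<close> minus a suitable multiple of a fixed bump has mean zero, hence is the
  derivative of a test function; this shows \<open>\<integral> \<psi> (k - c) = 0\<close> for a constant \<open>c\<close> independent of \<open>\<psi>\<close>.\<close>

lemma weak_deriv_zero_AE_const:
  assumes "has_weak_deriv k (\<lambda>x. 0)"
  obtains c where "AE x in lebesgue_on {0<..}. k x = c"
proof -
  have lk: "locally_integrable k" using assms by (simp add: has_weak_deriv_def)
  define \<eta> where "\<eta> = bump 1 1 2"
  have \<eta>out: "\<eta> x = 0" if "x \<notin> {1..2}" for x using that by (auto simp: \<eta>_def intro: bump_eq_0)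
  have \<eta>t: "test_function \<eta>"
    using test_functionI[of \<eta> 1 2] \<eta>out by (auto simp: \<eta>_def smooth_bump)
  have \<eta>sm: "smooth \<eta>" by (simp add: \<eta>_def smooth_bump)
  define E where "E = integral {1..2} \<eta>"
  have "E \<noteq> 0"
  proof
    assume "E = 0"
    then have "\<forall>x\<in>{1..2}. \<eta> x = 0"
      unfolding E_def using bump_range[of 1 1 2] smooth_continuous_on[OF \<eta>sm]
      by (subst (asm) integral_eq_0_iff) (auto simp: \<eta>_def)
    then show False using bump_pos[of 1 "3/2" 1 2] by (auto simp: \<eta>_def dest!: bspec[of _ _ "3/2"])
  qed
  define c where "c = (LINT x|lebesgue_on {0<..}. \<eta> x *\<^sub>R k x) /\<^sub>R E"
  have lc: "locally_integrable (\<lambda>x. c)"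
    by (auto simp: locally_integrable_def)
  have "AE x in lebesgue_on {0<..}. k x - c = 0"
  proof (rule fundamental_lemma_variations)
    show "locally_integrable (\<lambda>x. k x - c)"
      by (rule locally_integrable_diff[OF lk lc])
    fix \<psi> assume \<psi>: "test_function \<psi>"
    obtain a b where ab: "0 < a" "a \<le> b" "\<And>x. x \<notin> {a..b} \<Longrightarrow> \<psi> x = 0"
      using test_function_support[OF \<psi>] by metis
    have \<psi>sm: "smooth \<psi>" by (rule test_function_smooth[OF \<psi>])
    define p where "p = min a 1"
    define r where "r = max b 2"
    define I where "I = integral {p..r} \<psi>"
    define \<theta> where "\<theta> x = \<psi> x - I / E * \<eta> x" for x
    have \<theta>sm: "smooth \<theta>"
      unfolding \<theta>_def using smooth_diff[OF \<psi>sm smooth_mult[OF smooth_const \<eta>sm]] .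
    have pr: "0 < p" "p \<le> r" "p \<le> a" "b \<le> r" "p \<le> 1" "2 \<le> r" using ab by (auto simp: p_def r_def)
    have \<theta>out: "\<theta> x = 0" if "x \<notin> {p..r}" for x
      using that pr ab(3)[of x] \<eta>out[of x] by (auto simp: \<theta>_def)
    have io: "f integrable_on {x..y}" if "smooth f" for f x y
      by (rule integrable_continuous_real[OF smooth_continuous_on[OF that]])
    have Eq: "integral {p..r} \<eta> = E"
      unfolding E_def using pr \<eta>out by (intro integral_restrict_support) auto
    have int0: "integral {p..r} \<theta> = 0"
      unfolding \<theta>_def using io[OF \<psi>sm] io[OF \<eta>sm] \<open>E \<noteq> 0\<close>
      by (subst Henstock_Kurzweil_Integration.integral_diff) (auto intro: integrable_on_mult_right simp: Eq I_def)
    \<comment> \<open>The primitive starts left of the support of \<theta>, so that every x \<ge> p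
      is an interior point of an interval on which the fundamental theorem applies.\<close>
    define \<phi> where "\<phi> x = integral {p - 1..x} \<theta>" for x
    have \<phi>d: "(\<phi> has_field_derivative \<theta> x) (at x)" for x
    proof (cases "x < p")
      case True
      have "\<phi> y = 0" if "y < p" for y
        unfolding \<phi>_def using \<theta>out that by (subst integral_restrict_support[of "{}"]) auto
      moreover have "eventually (\<lambda>y. y < p) (nhds x)"
        using True eventually_nhds_in_open[of "{..<p}" x] by simp
      ultimately have "eventually (\<lambda>y. \<phi> y = 0) (nhds x)"
        by (auto elim: eventually_mono)
      moreover have "((\<lambda>y. 0) has_field_derivative \<theta> x) (at x)"
        using True by (simp add: \<theta>out)
      ultimately show ?thesis
        by (subst DERIV_cong_ev[OF refl _ refl])
    next
      case False
      have "(\<phi> has_vector_derivative \<theta> x) (at x within {p - 1..x + 1})"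
        unfolding \<phi>_def using False
        by (intro integral_has_vector_derivative smooth_continuous_on[OF \<theta>sm]) auto
      moreover have "at x within {p - 1..x + 1} = at x"
        using False by (intro at_within_interior) auto
      ultimately show ?thesis
        by (simp add: has_real_derivative_iff_has_vector_derivative)
    qed
    have d\<phi>: "deriv \<phi> = \<theta>" using \<phi>d by (auto intro: DERIV_imp_deriv)
    have \<phi>sm: "smooth \<phi>" by (rule smooth_if_deriv_smooth[OF \<phi>d \<theta>sm])
    have \<phi>out: "\<phi> x = 0" if "x \<notin> {p..r}" for x
    proof (cases "x < p")
      case True
      then show ?thesis
        unfolding \<phi>_def using \<theta>out True by (subst integral_restrict_support[of "{}"]) auto
    next
      case False
      then have "x > r" using that by auto
      then have "integral {p - 1..x} \<theta> = integral {p..r} \<theta>"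
        using pr \<theta>out by (intro integral_restrict_support) auto
      then show ?thesis using int0 by (simp add: \<phi>_def)
    qed
    have \<phi>t: "test_function \<phi>" by (rule test_functionI[OF \<phi>sm pr(1) \<phi>out])
    have ik: "integrable (lebesgue_on {0<..}) (\<lambda>x. \<psi> x *\<^sub>R k x)" "integrable (lebesgue_on {0<..}) (\<lambda>x. \<eta> x *\<^sub>R k x)"
       "integrable (lebesgue_on {0<..}) (\<lambda>x. \<psi> x *\<^sub>R c)"
      using integrable_test_function lk lc \<psi> \<eta>t by blast+
    have "0 = (LINT x|lebesgue_on {0<..}. \<theta> x *\<^sub>R k x)"
      using assms \<phi>t unfolding has_weak_deriv_def by (simp flip: d\<phi>)
    also have "\<dots> = (LINT x|lebesgue_on {0<..}. \<psi> x *\<^sub>R k x - (I / E) *\<^sub>R (\<eta> x *\<^sub>R k x))"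
      by (simp add: \<theta>_def scaleR_diff_left)
    also have "\<dots> = (LINT x|lebesgue_on {0<..}. \<psi> x *\<^sub>R k x) - (I / E) *\<^sub>R (LINT x|lebesgue_on {0<..}. \<eta> x *\<^sub>R k x)"
      using Bochner_Integration.integral_diff[OF ik(1) integrable_scaleR_right[OF ik(2), of "I / E"]]
      by (simp only: integral_scaleR_right)
    also have "\<dots> = (LINT x|lebesgue_on {0<..}. \<psi> x *\<^sub>R k x) - I *\<^sub>R c"
      by (simp add: c_def divide_inverse)
    also have "I *\<^sub>R c = (LINT x|lebesgue_on {0<..}. \<psi> x *\<^sub>R c)"
    proof -
      have "(LINT x|lebesgue_on {0<..}. \<psi> x *\<^sub>R c) = (LINT x|lebesgue_on {p..r}. \<psi> x *\<^sub>R c)"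
        using pr ab by (intro lebesgue_on_restrict_support) force+
      also have "\<dots> = (LINT x|lebesgue_on {p..r}. \<psi> x) *\<^sub>R c"
        by (intro integral_scaleR_left continuous_imp_integrable_real smooth_continuous_on[OF \<psi>sm])
      also have "(LINT x|lebesgue_on {p..r}. \<psi> x) = I"
        unfolding I_def
        by (intro lebesgue_integral_eq_integral continuous_imp_integrable_real smooth_continuous_on[OF \<psi>sm]) auto
      finally show ?thesis by simp
    qed
    finally show "(LINT x|lebesgue_on {0<..}. \<psi> x *\<^sub>R (k x - c)) = 0"
      using ik by (simp add: scaleR_diff_right)
  qed
  then show ?thesis using that by (auto elim: eventually_mono)
qed

text \<open>The set of disagreement is relatively open in [0,\<infinity>), so if it contains x it
  contains an interval to the right of x, which is not a null set. The argument includes x = 0,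
  where the boundary data live.\<close>

lemma AE_continuous_eq:
  fixes f h :: "real \<Rightarrow> complex"
  assumes "continuous_on {0..} f" "continuous_on {0..} h" "AE x in lebesgue_on {0<..}. f x = h x" "0 \<le> x"
  shows "f x = h x"
proof (rule ccontr)
  assume ne: "f x \<noteq> h x"
  have "continuous_on {0..} (\<lambda>y. dist (f y) (h y))"
    by (intro continuous_intros assms)
  then have "((\<lambda>y. dist (f y) (h y)) \<longlongrightarrow> dist (f x) (h x)) (at x within {0..})"
    using assms(4) by (auto simp: continuous_on_def)
  then have "eventually (\<lambda>y. dist (f y) (h y) > 0) (at x within {0..})"
    using ne by (intro order_tendstoD(1)) auto
  then obtain d where d: "d > 0" "\<And>y. y \<in> {0..} \<Longrightarrow> y \<noteq> x \<Longrightarrow> dist y x < d \<Longrightarrow> f y \<noteq> h y"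
    unfolding eventually_at by auto
  obtain N where N: "N \<in> null_sets (lebesgue_on {0<..})" "{y \<in> {0<..}. f y \<noteq> h y} \<subseteq> N"
    using assms(3) unfolding eventually_ae_filter by auto
  have "{x<..<x+d} \<subseteq> N"
    using d N(2) assms(4) by (force simp: dist_real_def)
  moreover have "negligible N"
    using N(1) by (auto simp: negligible_iff_null_sets null_sets_restrict_space)
  ultimately have "negligible {x<..<x+d}" using negligible_subset by blast
  then show False using d(1) open_not_negligible[of "{x<..<x+d}"] by simp
qed

text \<open>Subtracting the primitive of \<open>g\<close> leaves a function with weak derivative 0,
  which is constant almost everywhere. Integrability of \<open>g\<close> up to 0 is required for the
  primitive; the weak derivative alone gives it only away from 0.\<close>

lemma weak_deriv_AE_AC:
  assumes w: "has_weak_deriv f g" and g: "\<And>x. g absolutely_integrable_on {0..x}"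
  obtains f1 where "AC_deriv f1 g" "AE x in lebesgue_on {0<..}. f x = f1 x"
proof -
  define G where "G x = integral {0..x} g" for x
  have G: "AC_deriv (\<lambda>x. c + G x) g" for c
    unfolding AC_deriv_def using g by (simp add: G_def)
  have "has_weak_deriv (\<lambda>x. f x - (0 + G x)) (\<lambda>x. g x - g x)"
    by (intro has_weak_deriv_diff w AC_deriv_has_weak_deriv G)
  then have "has_weak_deriv (\<lambda>x. f x - G x) (\<lambda>x. 0)" by simp
  then obtain c where "AE x in lebesgue_on {0<..}. f x - G x = c"
    using weak_deriv_zero_AE_const by blast
  then have "AE x in lebesgue_on {0<..}. f x = c + G x"
    by eventually_elim (simp add: algebra_simps)
  then show ?thesis using that G by blast
qed

text \<open>\<open>weak_deriv\<close> is a choice, so it is known only almost everywhere. For the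
  second derivative the choice is made for the already chosen first one, and the weak derivative
  must first be transferred across the null set.\<close>

lemma AC_deriv_weak_derivs:
  assumes f: "AC_deriv f w" and w: "AC_deriv w z"
  shows "AE x in lebesgue_on {0<..}. weak_deriv f x = w x"
    "AE x in lebesgue_on {0<..}. weak_deriv (weak_deriv f) x = z x"
proof -
  have wd: "has_weak_deriv f (weak_deriv f)"
    unfolding weak_deriv_def using someI[of "has_weak_deriv f", OF AC_deriv_has_weak_deriv[OF f]] .
  show ae: "AE x in lebesgue_on {0<..}. weak_deriv f x = w x"
    by (rule has_weak_deriv_unique[OF wd AC_deriv_has_weak_deriv[OF f]])
  have *: "has_weak_deriv (weak_deriv f) z"
  proof (rule has_weak_deriv_cong_AE[OF AC_deriv_has_weak_deriv[OF w]])
    show "locally_integrable (weak_deriv f)" using wd by (simp add: has_weak_deriv_def)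
    show "locally_integrable z" by (rule AC_deriv_locally_integrable[OF w])
    show "AE x in lebesgue_on {0<..}. w x = weak_deriv f x" using ae by eventually_elim simp
  qed simp
  have "has_weak_deriv (weak_deriv f) (weak_deriv (weak_deriv f))"
    using someI[of "has_weak_deriv (weak_deriv f)", OF *] by (simp add: weak_deriv_def)
  then show "AE x in lebesgue_on {0<..}. weak_deriv (weak_deriv f) x = z x"
    using has_weak_deriv_unique * by blast
qed

section \<open>The spaces \<open>L\<^sup>2\<close> and \<open>H\<^sup>2\<close>\<close>

abbreviation halfline :: "real measure" where "halfline \<equiv> lebesgue_on {0<..}"

lemma continuous_on_measurable_halfline:
  fixes f :: "real \<Rightarrow> 'a::topological_space"
  assumes "continuous_on {0..} f"
  shows "f \<in> borel_measurable halfline"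
  by (intro continuous_imp_measurable_on_sets_lebesgue continuous_on_subset[OF assms]) auto

lemma L2_measurable: "f \<in> L2 \<Longrightarrow> f \<in> borel_measurable halfline"
  and L2_integrable: "f \<in> L2 \<Longrightarrow> integrable halfline (\<lambda>x. (cmod (f x))\<^sup>2)"
  by (auto simp: L2_def)

lemma L2_norm_nonneg: "0 \<le> L2_norm f"
  by (simp add: L2_norm_def)

lemma L2_norm_power2: "(L2_norm f)\<^sup>2 = (LINT x|halfline. (cmod (f x))\<^sup>2)"
  by (simp add: L2_norm_def)

lemma L2_of_bound:
  assumes "f \<in> L2" "h \<in> borel_measurable halfline" "\<And>x. x > 0 \<Longrightarrow> cmod (h x) \<le> C * cmod (f x)"
  shows "h \<in> L2" and "C \<ge> 0 \<Longrightarrow> L2_norm h \<le> C * L2_norm f"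
proof -
  have i: "integrable halfline (\<lambda>x. C\<^sup>2 * (cmod (f x))\<^sup>2)"
    using L2_integrable[OF assms(1)] by simp
  have le: "(cmod (h x))\<^sup>2 \<le> C\<^sup>2 * (cmod (f x))\<^sup>2" if "x > 0" for x
    using assms(3)[OF that] by (metis norm_ge_zero power_mono power_mult_distrib)
  show h: "h \<in> L2"
    unfolding L2_def using assms(2) le
    by (auto intro!: Bochner_Integration.integrable_bound[OF i] AE_I2)
  show "L2_norm h \<le> C * L2_norm f" if C: "C \<ge> 0"
  proof -
    have "(L2_norm h)\<^sup>2 \<le> (LINT x|halfline. C\<^sup>2 * (cmod (f x))\<^sup>2)"
      unfolding L2_norm_power2 using L2_integrable[OF h] i le by (intro integral_mono) auto
    also have "\<dots> = (C * L2_norm f)\<^sup>2"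
      by (simp add: power_mult_distrib L2_norm_power2)
    finally show ?thesis
      by (rule power2_le_imp_le) (intro mult_nonneg_nonneg L2_norm_nonneg C)
  qed
qed

lemma L2_add:
  assumes "f \<in> L2" "h \<in> L2" shows "(\<lambda>x. f x + h x) \<in> L2"
proof -
  have i: "integrable halfline (\<lambda>x. 2 * (cmod (f x))\<^sup>2 + 2 * (cmod (h x))\<^sup>2)"
    using assms by (intro Bochner_Integration.integrable_add integrable_mult_right L2_integrable)
  have "(cmod (f x + h x))\<^sup>2 \<le> 2 * (cmod (f x))\<^sup>2 + 2 * (cmod (h x))\<^sup>2" for x
  proof -
    have "(cmod (f x + h x))\<^sup>2 \<le> (cmod (f x) + cmod (h x))\<^sup>2"
      by (intro power_mono norm_triangle_ineq) simp
    also have "\<dots> \<le> 2 * (cmod (f x))\<^sup>2 + 2 * (cmod (h x))\<^sup>2"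
      using sum_squares_bound[of "cmod (f x)" "cmod (h x)"] by (simp add: power2_sum)
    finally show ?thesis .
  qed
  then show ?thesis
    unfolding L2_def using L2_measurable[OF assms(1)] L2_measurable[OF assms(2)]
    by (auto intro!: Bochner_Integration.integrable_bound[OF i] borel_measurable_add)
qed

lemma L2_scale: "f \<in> L2 \<Longrightarrow> (\<lambda>x. c * f x) \<in> L2"
  by (rule L2_of_bound(1)[where C = "cmod c"]) (auto simp: norm_mult dest: L2_measurable)

lemma L2_diff: "f \<in> L2 \<Longrightarrow> h \<in> L2 \<Longrightarrow> (\<lambda>x. f x - h x) \<in> L2"
  using L2_add[OF _ L2_scale[of h "-1"], of f] by simp

lemma L2_bounded_mult:
  assumes "f \<in> L2" "b \<in> borel_measurable halfline" "\<And>x. x > 0 \<Longrightarrow> cmod (b x) \<le> C"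
  shows "(\<lambda>x. b x * f x) \<in> L2"
proof (rule L2_of_bound(1)[OF assms(1), where C = C])
  show "(\<lambda>x. b x * f x) \<in> borel_measurable halfline"
    using assms(2) L2_measurable[OF assms(1)] by simp
  show "cmod (b x * f x) \<le> C * cmod (f x)" if "x > 0" for x
    using assms(3)[OF that] by (simp add: norm_mult mult_right_mono)
qed

lemma cnj_measurable: "f \<in> borel_measurable M \<Longrightarrow> (\<lambda>x. cnj (f x)) \<in> borel_measurable M"
  by (rule measurable_compose[OF _ borel_measurable_continuous_onI]) (auto intro: continuous_intros)

lemma L2_cnj: "f \<in> L2 \<Longrightarrow> (\<lambda>x. cnj (f x)) \<in> L2"
  by (rule L2_of_bound(1)[where C = 1]) (auto intro: cnj_measurable dest: L2_measurable)

lemma L2_norm_cnj: "L2_norm (\<lambda>x. cnj (f x)) = L2_norm f"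
  by (simp add: L2_norm_def)

lemma L2_mult_integrable:
  assumes "f \<in> L2" "h \<in> L2"
  shows "integrable halfline (\<lambda>x. f x * h x)"
proof (rule Bochner_Integration.integrable_bound)
  show "integrable halfline (\<lambda>x. (cmod (f x))\<^sup>2 + (cmod (h x))\<^sup>2)"
    using assms by (intro Bochner_Integration.integrable_add L2_integrable)
  show "(\<lambda>x. f x * h x) \<in> borel_measurable halfline"
    using assms by (intro borel_measurable_times L2_measurable)
  have "cmod (f x * h x) \<le> (cmod (f x))\<^sup>2 + (cmod (h x))\<^sup>2" for x
    unfolding norm_mult
    using sum_squares_bound[of "cmod (f x)" "cmod (h x)"] mult_nonneg_nonneg[OF norm_ge_zero[of "f x"] norm_ge_zero[of "h x"]]
    by linarith
  then show "AE x in halfline. norm (f x * h x) \<le> norm ((cmod (f x))\<^sup>2 + (cmod (h x))\<^sup>2)"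
    by (intro AE_I2) (simp add: abs_of_nonneg)
qed

lemma L2_Cauchy_Schwarz:
  assumes "f \<in> L2" "h \<in> L2"
  shows "cmod (LINT x|halfline. f x * h x) \<le> L2_norm f * L2_norm h"
proof -
  define I where "I = (LINT x|halfline. cmod (f x) * cmod (h x))"
  have i: "integrable halfline (\<lambda>x. cmod (f x) * cmod (h x))"
    using integrable_norm[OF L2_mult_integrable[OF assms]] by (simp add: norm_mult)
  have I0: "I \<ge> 0" unfolding I_def by simp
  have "(\<integral>\<^sup>+x. ennreal (cmod (f x)) * ennreal (cmod (h x)) \<partial>halfline)\<^sup>2 \<le>
     (\<integral>\<^sup>+x. (ennreal (cmod (f x)))\<^sup>2 \<partial>halfline) * (\<integral>\<^sup>+x. (ennreal (cmod (h x)))\<^sup>2 \<partial>halfline)"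
    using assms by (intro Cauchy_Schwarz_nn_integral) (auto dest: L2_measurable)
  also have "(\<integral>\<^sup>+x. ennreal (cmod (f x)) * ennreal (cmod (h x)) \<partial>halfline) = ennreal I"
    unfolding I_def using i by (simp add: ennreal_mult[symmetric] nn_integral_eq_integral)
  also have "(\<integral>\<^sup>+x. (ennreal (cmod (f x)))\<^sup>2 \<partial>halfline) = ennreal ((L2_norm f)\<^sup>2)"
    unfolding L2_norm_power2 using L2_integrable[OF assms(1)]
    by (simp add: ennreal_power nn_integral_eq_integral)
  also have "(\<integral>\<^sup>+x. (ennreal (cmod (h x)))\<^sup>2 \<partial>halfline) = ennreal ((L2_norm h)\<^sup>2)"
    unfolding L2_norm_power2 using L2_integrable[OF assms(2)]
    by (simp add: ennreal_power nn_integral_eq_integral)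
  finally have "I\<^sup>2 \<le> (L2_norm f * L2_norm h)\<^sup>2"
    using I0 by (simp add: ennreal_power ennreal_mult[symmetric] power_mult_distrib)
  then have "I \<le> L2_norm f * L2_norm h"
    by (rule power2_le_imp_le) (intro mult_nonneg_nonneg L2_norm_nonneg)
  moreover have "cmod (LINT x|halfline. f x * h x) \<le> I"
    unfolding I_def using integral_norm_bound[of halfline "\<lambda>x. f x * h x"] by (simp add: norm_mult)
  ultimately show ?thesis by linarith
qed

text \<open>On bounded intervals |f| \<le> 1 + |f|^2 is an integrable majorant, also for a = 0.
  Members of \<open>L2\<close> are controlled on the open half-line only, so the endpoint is added
  as a null set.\<close>

lemma L2_absolutely_integrable:
  assumes "f \<in> L2" "0 \<le> a"
  shows "f absolutely_integrable_on {a..b}"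
proof -
  have m: "f \<in> borel_measurable (lebesgue_on {a<..b})"
    using measurable_restrict_mono[OF L2_measurable[OF assms(1)], of "{a<..b}"] assms(2) by (simp add: greaterThanAtMost_def greaterThan_subset_iff le_infI1)
  have i: "integrable (lebesgue_on {a<..b}) (\<lambda>x. 1 + (cmod (f x))\<^sup>2)"
  proof (intro Bochner_Integration.integrable_add)
    show "integrable (lebesgue_on {a<..b}) (\<lambda>x. 1::real)"
      by (intro finite_measure.integrable_const finite_measure_lebesgue_on bounded_set_imp_lmeasurable) auto
    have "set_integrable lebesgue {0<..} (\<lambda>x. (cmod (f x))\<^sup>2)"
      using L2_integrable[OF assms(1)] by (simp add: set_integrable_def integrable_restrict_space)
    then have "set_integrable lebesgue {a<..b} (\<lambda>x. (cmod (f x))\<^sup>2)"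
      by (rule set_integrable_subset) (use assms(2) in auto)
    then show "integrable (lebesgue_on {a<..b}) (\<lambda>x. (cmod (f x))\<^sup>2)"
      by (simp add: set_integrable_def integrable_restrict_space)
  qed
  have "cmod (f x) \<le> 1 + (cmod (f x))\<^sup>2" for x
    using sum_squares_bound[of 1 "cmod (f x)"] norm_ge_zero[of "f x"]
    by (simp only: power_one mult_1_right)
  then have "integrable (lebesgue_on {a<..b}) f"
    by (intro Bochner_Integration.integrable_bound[OF i m]) (auto intro!: AE_I2 simp: abs_of_nonneg)
  moreover have "{a<..b} - {a..b} = {}" "{a..b} - {a<..b} \<subseteq> {a}" by auto
  ultimately have "integrable (lebesgue_on {a..b}) f"
    using lebesgue_on_spike_set(1)[of "{a<..b}" "{a..b}" f] negligible_subset[of "{a}" "{a..b} - {a<..b}"]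
    by simp
  then show ?thesis by (simp add: set_integrable_def integrable_restrict_space)
qed

section \<open>Convergence in the space of square integrable functions\<close>

text \<open>Membership is required separately because a Bochner integral is 0 when the integrand is
  not integrable: \<open>L2_norm\<close> can be 0 for functions outside \<open>L2\<close>.\<close>

definition L2_tendsto :: "('a \<Rightarrow> real \<Rightarrow> complex) \<Rightarrow> (real \<Rightarrow> complex) \<Rightarrow> 'a filter \<Rightarrow> bool" where
  "L2_tendsto F f G \<longleftrightarrow> f \<in> L2 \<and> eventually (\<lambda>s. F s \<in> L2) G \<and>
     ((\<lambda>s. L2_norm (\<lambda>x. F s x - f x)) \<longlongrightarrow> 0) G"

lemma L2_tendsto_const: "f \<in> L2 \<Longrightarrow> L2_tendsto (\<lambda>_. f) f G"
  by (simp add: L2_tendsto_def L2_norm_def)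

lemma L2_tendsto_dominated:
  assumes F: "L2_tendsto F f G" and k: "k \<in> L2" and K: "eventually (\<lambda>s. K s \<in> L2) G"
    and C: "eventually (\<lambda>s. \<forall>x>0. cmod (K s x - k x) \<le> C * cmod (F s x - f x)) G" "C \<ge> 0"
  shows "L2_tendsto K k G"
proof -
  have "eventually (\<lambda>s. F s \<in> L2) G" and lim: "((\<lambda>s. L2_norm (\<lambda>x. F s x - f x)) \<longlongrightarrow> 0) G" and f: "f \<in> L2"
    using F by (auto simp: L2_tendsto_def)
  have step: "L2_norm (\<lambda>x. K s x - k x) \<le> C * L2_norm (\<lambda>x. F s x - f x)"
    if "F s \<in> L2" "K s \<in> L2" "\<forall>x>0. cmod (K s x - k x) \<le> C * cmod (F s x - f x)" for s
    using that C(2) by (intro L2_of_bound(2)[OF L2_diff[OF that(1) f] L2_measurable[OF L2_diff[OF that(2) k]]]) auto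
  have "eventually (\<lambda>s. L2_norm (\<lambda>x. K s x - k x) \<le> C * L2_norm (\<lambda>x. F s x - f x)) G"
    using \<open>eventually (\<lambda>s. F s \<in> L2) G\<close> K C(1) by eventually_elim (rule step)
  moreover have "((\<lambda>s. C * L2_norm (\<lambda>x. F s x - f x)) \<longlongrightarrow> 0) G"
    using tendsto_mult_left[OF lim, of C] by simp
  ultimately have "((\<lambda>s. L2_norm (\<lambda>x. K s x - k x)) \<longlongrightarrow> 0) G"
    by (rule tendsto_sandwich[OF always_eventually[OF allI[OF L2_norm_nonneg]] _ tendsto_const])
  then show ?thesis using k K by (simp add: L2_tendsto_def)
qed

lemma L2_tendsto_cnj: "L2_tendsto F f G \<Longrightarrow> L2_tendsto (\<lambda>s x. cnj (F s x)) (\<lambda>x. cnj (f x)) G"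
  unfolding L2_tendsto_def complex_cnj_diff[symmetric] L2_norm_cnj
  by (auto intro: L2_cnj elim: eventually_mono)

lemma L2_tendsto_bounded_mult:
  assumes F: "L2_tendsto F f G" and b: "b \<in> borel_measurable halfline" "\<And>x. x > 0 \<Longrightarrow> cmod (b x) \<le> C"
  shows "L2_tendsto (\<lambda>s x. b x * F s x) (\<lambda>x. b x * f x) G"
proof (rule L2_tendsto_dominated[OF F])
  have F': "f \<in> L2" "eventually (\<lambda>s. F s \<in> L2) G" using F by (auto simp: L2_tendsto_def)
  show "(\<lambda>x. b x * f x) \<in> L2" by (rule L2_bounded_mult[OF F'(1) b])
  show "eventually (\<lambda>s. (\<lambda>x. b x * F s x) \<in> L2) G"
    using F'(2) by eventually_elim (rule L2_bounded_mult[OF _ b])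
  show "0 \<le> C" using b(2)[of 1] norm_ge_zero[of "b 1"] by linarith
  have "cmod (b x * F s x - b x * f x) \<le> C * cmod (F s x - f x)" if "x > 0" for x s
    using b(2)[OF that] by (simp add: norm_mult mult_right_mono flip: right_diff_distrib)
  then show "eventually (\<lambda>s. \<forall>x>0. cmod (b x * F s x - b x * f x) \<le> C * cmod (F s x - f x)) G"
    by simp
qed

lemma L2_tendsto_integral:
  assumes F: "L2_tendsto F f G" and K: "L2_tendsto K k G"
  shows "((\<lambda>s. LINT x|halfline. F s x * K s x) \<longlongrightarrow> (LINT x|halfline. f x * k x)) G"
proof -
  \<comment> \<open>Cauchy-Schwarz applied to the three terms of F K - f k = (F - f)(K - k) + f (K -
    k) + (F - f) k.\<close>
  let ?d = "\<lambda>s. L2_norm (\<lambda>x. F s x - f x) * L2_norm (\<lambda>x. K s x - k x) +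
     (L2_norm f * L2_norm (\<lambda>x. K s x - k x) + L2_norm (\<lambda>x. F s x - f x) * L2_norm k)"
  have f: "f \<in> L2" "eventually (\<lambda>s. F s \<in> L2) G" "((\<lambda>s. L2_norm (\<lambda>x. F s x - f x)) \<longlongrightarrow> 0) G"
    and k: "k \<in> L2" "eventually (\<lambda>s. K s \<in> L2) G" "((\<lambda>s. L2_norm (\<lambda>x. K s x - k x)) \<longlongrightarrow> 0) G"
    using F K by (auto simp: L2_tendsto_def)
  have "(?d \<longlongrightarrow> 0 * 0 + (L2_norm f * 0 + 0 * L2_norm k)) G"
    by (intro tendsto_intros f k)
  then have d: "(?d \<longlongrightarrow> 0) G" by simp
  have "eventually (\<lambda>s. norm ((LINT x|halfline. F s x * K s x) - (LINT x|halfline. f x * k x)) \<le> ?d s) G"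
    using f(2) k(2)
  proof eventually_elim
    case (elim s)
    have i: "integrable halfline (\<lambda>x. (F s x - f x) * (K s x - k x))"
      "integrable halfline (\<lambda>x. f x * (K s x - k x))" "integrable halfline (\<lambda>x. (F s x - f x) * k x)"
      "integrable halfline (\<lambda>x. F s x * K s x)" "integrable halfline (\<lambda>x. f x * k x)"
      using elim f(1) k(1) by (auto intro!: L2_mult_integrable L2_diff)
    have "(LINT x|halfline. F s x * K s x) - (LINT x|halfline. f x * k x) =
       (LINT x|halfline. (F s x - f x) * (K s x - k x) + (f x * (K s x - k x) + (F s x - f x) * k x))"
      using i by (subst Bochner_Integration.integral_diff[symmetric]) (auto simp: algebra_simps)
    also have "\<dots> = (LINT x|halfline. (F s x - f x) * (K s x - k x)) +
        ((LINT x|halfline. f x * (K s x - k x)) + (LINT x|halfline. (F s x - f x) * k x))"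
      by (simp only: Bochner_Integration.integral_add[OF i(1) Bochner_Integration.integrable_add[OF i(2,3)]]
          Bochner_Integration.integral_add[OF i(2,3)])
    finally have eq: "(LINT x|halfline. F s x * K s x) - (LINT x|halfline. f x * k x) = \<dots>" .
    show ?case
      unfolding eq using elim f(1) k(1)
      by (intro norm_triangle_le add_mono L2_Cauchy_Schwarz L2_diff)
  qed
  then have "((\<lambda>s. (LINT x|halfline. F s x * K s x) - (LINT x|halfline. f x * k x)) \<longlongrightarrow> 0) G"
    by (rule Lim_null_comparison[OF _ d])
  then show ?thesis by (simp add: LIM_zero_iff)
qed

section \<open>Pointwise bounds from integral bounds\<close>

lemma AC_deriv_norm_bound:
  assumes f: "AC_deriv f g" and i: "integrable halfline f" "integrable halfline g" and x: "0 \<le> x"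
  shows "norm (f x) \<le> (LINT y|halfline. norm (g y))"
proof -
  have ni: "integrable halfline (\<lambda>y. norm (g y))" using i(2) by simp
  have lim: "((\<lambda>b. norm (integral {0..b} g - integral {0..x} g)) \<longlongrightarrow>
       norm (integral\<^sup>L halfline g - integral {0..x} g)) at_top"
    by (intro tendsto_intros integral_halfline_limit i)
  have lim2: "((\<lambda>b. integral {0..b} (\<lambda>y. norm (g y))) \<longlongrightarrow> (LINT y|halfline. norm (g y))) at_top"
    by (rule integral_halfline_limit[OF ni])
  have "norm (integral {0..b} g - integral {0..x} g) \<le> integral {0..b} (\<lambda>y. norm (g y))" if "b \<ge> x" for b
  proof -
    have io: "g integrable_on {0..b}" "g integrable_on {x..b}"
      "(\<lambda>y. norm (g y)) integrable_on {0..b}" "(\<lambda>y. norm (g y)) integrable_on {x..b}" "(\<lambda>y. norm (g y)) integrable_on {0..x}"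
      using AC_deriv_abs_integrable[OF f] x by (auto simp: absolutely_integrable_on_def)
    have "integral {0..b} g - integral {0..x} g = integral {x..b} g"
      using Henstock_Kurzweil_Integration.integral_combine[OF x that io(1)] by (metis add_diff_cancel_left')
    also have "norm \<dots> \<le> integral {x..b} (\<lambda>y. norm (g y))"
      using io by (intro integral_norm_bound_integral) auto
    also have "\<dots> \<le> integral {0..b} (\<lambda>y. norm (g y))"
      using Henstock_Kurzweil_Integration.integral_combine[OF x that io(3)]
        Henstock_Kurzweil_Integration.integral_nonneg[OF io(5)] by simp
    finally show ?thesis .
  qed
  then have "norm (integral\<^sup>L halfline g - integral {0..x} g) \<le> (LINT y|halfline. norm (g y))"
    by (intro tendsto_le[OF _ lim2 lim]) (auto intro: eventually_mono[OF eventually_ge_at_top[of x]])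
  moreover have "f x = - (integral\<^sup>L halfline g - integral {0..x} g)"
    using AC_deriv_eq[OF f x] AC_deriv_integral_halfline[OF f i] by simp
  ultimately show ?thesis by (simp only: norm_minus_cancel)
qed

text \<open>The one-dimensional Sobolev embedding: |f|^2 is the integral of its derivative from
  infinity, and that derivative is at most 2 |f| |g|.\<close>

lemma AC_deriv_sup_bound:
  assumes f: "AC_deriv f g" and L: "f \<in> L2" "g \<in> L2" and x: "0 \<le> x"
  shows "(cmod (f x))\<^sup>2 \<le> (L2_norm f)\<^sup>2 + (L2_norm g)\<^sup>2"
proof -
  have ac: "AC_deriv (\<lambda>x. f x * cnj (f x)) (\<lambda>x. g x * cnj (f x) + cnj (g x) * f x)"
    by (rule AC_deriv_mult[OF f AC_deriv_cnj[OF f]])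
  have i: "integrable halfline (\<lambda>x. f x * cnj (f x))" "integrable halfline (\<lambda>x. g x * cnj (f x) + cnj (g x) * f x)"
    using L by (auto intro!: L2_mult_integrable L2_cnj)
  have "(cmod (f x))\<^sup>2 = norm (f x * cnj (f x))"
    by (simp add: norm_mult power2_eq_square)
  also have "\<dots> \<le> (LINT y|halfline. norm (g y * cnj (f y) + cnj (g y) * f y))"
    by (rule AC_deriv_norm_bound[OF ac i x])
  also have "\<dots> \<le> (LINT y|halfline. (cmod (f y))\<^sup>2 + (cmod (g y))\<^sup>2)"
  proof (rule integral_mono)
    show "integrable halfline (\<lambda>y. norm (g y * cnj (f y) + cnj (g y) * f y))" using i(2) by simp
    show "integrable halfline (\<lambda>y. (cmod (f y))\<^sup>2 + (cmod (g y))\<^sup>2)"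
      using L by (auto dest: L2_integrable)
    show "norm (g y * cnj (f y) + cnj (g y) * f y) \<le> (cmod (f y))\<^sup>2 + (cmod (g y))\<^sup>2" for y
    proof -
      have "norm (g y * cnj (f y) + cnj (g y) * f y) \<le> 2 * cmod (f y) * cmod (g y)"
        by (rule order.trans[OF norm_triangle_ineq]) (simp add: norm_mult)
      then show ?thesis
        using sum_squares_bound[of "cmod (f y)" "cmod (g y)"] by linarith
    qed
  qed
  also have "\<dots> = (L2_norm f)\<^sup>2 + (L2_norm g)\<^sup>2"
    using L by (simp add: L2_norm_power2 L2_integrable)
  finally show ?thesis .
qed

text \<open>Convergence of functions and derivatives in \<open>L2\<close> is uniform. This makes
  boundary values continuous in time and keeps the cubic term bounded near a fixed time.\<close>

lemma L2_tendsto_sup: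
  assumes F: "L2_tendsto F f G" "L2_tendsto F' f' G"
    and ac: "eventually (\<lambda>s. AC_deriv (F s) (F' s)) G" "AC_deriv f f'" and e: "e > 0"
  shows "eventually (\<lambda>s. \<forall>x\<ge>0. cmod (F s x - f x) < e) G"
proof -
  let ?d = "\<lambda>s. (L2_norm (\<lambda>x. F s x - f x))\<^sup>2 + (L2_norm (\<lambda>x. F' s x - f' x))\<^sup>2"
  have "(?d \<longlongrightarrow> 0\<^sup>2 + 0\<^sup>2) G"
    using F unfolding L2_tendsto_def by (intro tendsto_intros) auto
  then have ev: "eventually (\<lambda>s. ?d s < e\<^sup>2) G"
    using e by (intro order_tendstoD(2)) auto
  have evL: "eventually (\<lambda>s. F s \<in> L2) G" "eventually (\<lambda>s. F' s \<in> L2) G" and f: "f \<in> L2" "f' \<in> L2"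
    using F by (auto simp: L2_tendsto_def)
  have step: "\<forall>x\<ge>0. cmod (F s x - f x) < e" if s: "?d s < e\<^sup>2" "F s \<in> L2" "F' s \<in> L2" "AC_deriv (F s) (F' s)" for s
  proof (intro allI impI)
    fix x :: real assume x: "x \<ge> 0"
    show "cmod (F s x - f x) < e"
    proof -
      have "(cmod (F s x - f x))\<^sup>2 \<le> ?d s"
        using AC_deriv_sup_bound[OF AC_deriv_diff[OF s(4) ac(2)] L2_diff[OF s(2) f(1)] L2_diff[OF s(3) f(2)] x] .
      also have "\<dots> < e\<^sup>2" by (rule s(1))
      finally show ?thesis using e by (simp add: power2_less_imp_less)
    qed
  qed
  show ?thesis
    using ev evL ac(1) by eventually_elim (rule step)
qed

section \<open>Concrete first and second derivatives of \<open>H2\<close> functions\<close>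

lemma borel_measurable_halfline_AE:
  fixes f h :: "real \<Rightarrow> complex"
  assumes "f \<in> borel_measurable halfline" "AE x in halfline. f x = h x"
  shows "h \<in> borel_measurable halfline"
proof -
  have "AE x in lebesgue. x \<in> {0<..} \<longrightarrow> f x = h x"
    using assms(2) by (simp add: AE_restrict_space_iff)
  then have "AE x in lebesgue. indicat_real {0<..} x *\<^sub>R f x = indicat_real {0<..} x *\<^sub>R h x"
    by eventually_elim (auto simp: indicator_def)
  moreover have "(\<lambda>x. indicat_real {0<..} x *\<^sub>R f x) \<in> borel_measurable lebesgue"
    using assms(1) by (simp add: borel_measurable_restrict_space_iff)
  ultimately have "(\<lambda>x. indicat_real {0<..} x *\<^sub>R h x) \<in> borel_measurable lebesgue"
    by (rule borel_measurable_AE[rotated])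
  then show ?thesis
    by (simp add: borel_measurable_restrict_space_iff)
qed

lemma L2_norm_cong_AE:
  assumes "f \<in> L2" "AE x in halfline. f x = h x"
  shows "L2_norm h = L2_norm f"
proof -
  have "h \<in> borel_measurable halfline"
    using borel_measurable_halfline_AE L2_measurable assms by blast
  then have "(LINT x|halfline. (cmod (h x))\<^sup>2) = (LINT x|halfline. (cmod (f x))\<^sup>2)"
    using assms by (intro integral_cong_AE) (auto dest: L2_measurable elim: eventually_mono)
  then show ?thesis by (simp add: L2_norm_def)
qed

lemma H2_norm_AC:
  assumes "AC_deriv f w" "AC_deriv w z" "w \<in> L2" "z \<in> L2"
  shows "H2_norm f = sqrt ((L2_norm f)\<^sup>2 + (L2_norm w)\<^sup>2 + (L2_norm z)\<^sup>2)"
proof -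
  have "L2_norm (weak_deriv f) = L2_norm w" "L2_norm (weak_deriv (weak_deriv f)) = L2_norm z"
    using AC_deriv_weak_derivs[OF assms(1,2)] assms(3,4)
    by (auto intro!: L2_norm_cong_AE elim: eventually_mono)
  then show ?thesis by (simp add: H2_norm_def)
qed

text \<open>Applying \<open>weak_deriv_AE_AC\<close> to the second derivative gives a continuous
  version \<open>w\<close> of the first, and applying it to \<open>w\<close> gives a primitive that
  equals \<open>f\<close> almost everywhere. As \<open>f\<close> is continuous, the equality holds
  everywhere, in particular at 0.\<close>

lemma H2_AC:
  assumes "f \<in> H2" "continuous_on {0..} f"
  obtains w z where "AC_deriv f w" "AC_deriv w z" "w \<in> L2" "z \<in> L2"
proof -
  obtain g h where gh: "g \<in> L2" "h \<in> L2" "has_weak_deriv f g" "has_weak_deriv g h"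
    using assms(1) by (auto simp: H2_def)
  obtain w where w: "AC_deriv w h" "AE x in halfline. g x = w x"
    using weak_deriv_AE_AC[OF gh(4)] L2_absolutely_integrable[OF gh(2)] by blast
  have "w \<in> borel_measurable halfline"
    by (rule continuous_on_measurable_halfline[OF AC_deriv_continuous_on[OF w(1)]])
  moreover have "integrable halfline (\<lambda>x. (cmod (w x))\<^sup>2)"
    using L2_integrable[OF gh(1)] w(2) calculation L2_measurable[OF gh(1)]
    by (subst integrable_cong_AE[where g = "\<lambda>x. (cmod (g x))\<^sup>2"]) (auto elim: eventually_mono)
  ultimately have wL: "w \<in> L2" by (simp add: L2_def)
  have "has_weak_deriv f w"
    using has_weak_deriv_cong_AE[OF gh(3) _ AC_deriv_locally_integrable(1)[OF w(1)] _ w(2), of f] gh(3)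
    by (simp add: has_weak_deriv_def)
  then obtain f1 where f1: "AC_deriv f1 w" "AE x in halfline. f x = f1 x"
    using weak_deriv_AE_AC[of f w] L2_absolutely_integrable[OF wL] by blast
  have eq: "f x = f1 x" if "0 \<le> x" for x
    by (rule AE_continuous_eq[OF assms(2) AC_deriv_continuous_on[OF f1(1)] f1(2) that])
  have "AC_deriv f w"
    using f1(1) unfolding AC_deriv_def by (metis eq order_refl)
  then show ?thesis using that w(1) wL gh(2) by blast
qed

section \<open>Real calculus\<close>

lemma has_vector_derivative_withinI:
  assumes "((\<lambda>s. (f s - f t) /\<^sub>R (s - t)) \<longlongrightarrow> D) (at t within S)"
  shows "(f has_vector_derivative D) (at t within S)"
  unfolding has_vector_derivative_def has_derivative_iff_norm
proof (intro conjI bounded_linear_scaleR_left)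
  have "((\<lambda>s. norm ((f s - f t) /\<^sub>R (s - t) - D)) \<longlongrightarrow> 0) (at t within S)"
    using assms by (simp add: tendsto_norm_zero_iff LIM_zero_iff)
  moreover have "norm ((f s - f t) /\<^sub>R (s - t) - D) = norm (f s - f t - (s - t) *\<^sub>R D) / norm (s - t)" if "s \<noteq> t" for s
  proof -
    have "(f s - f t) /\<^sub>R (s - t) - D = (f s - f t - (s - t) *\<^sub>R D) /\<^sub>R (s - t)"
      using that by (simp add: scaleR_diff_right)
    then show ?thesis by (simp add: divide_inverse mult.commute)
  qed
  ultimately show "((\<lambda>s. norm (f s - f t - (s - t) *\<^sub>R D) / norm (s - t)) \<longlongrightarrow> 0) (at t within S)"
    by (elim Lim_transform_eventually) (auto simp: eventually_at_filter)
qed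

lemma has_vector_derivative_quotient_tendsto:
  assumes "(f has_vector_derivative D) (at t within S)"
  shows "((\<lambda>s. (f s - f t) /\<^sub>R (s - t)) \<longlongrightarrow> D) (at t within S)"
proof -
  have "((\<lambda>s. norm (f s - f t - (s - t) *\<^sub>R D) / norm (s - t)) \<longlongrightarrow> 0) (at t within S)"
    using assms unfolding has_vector_derivative_def has_derivative_iff_norm by blast
  moreover have "norm (f s - f t - (s - t) *\<^sub>R D) / norm (s - t) = norm ((f s - f t) /\<^sub>R (s - t) - D)" if "s \<noteq> t" for s
  proof -
    have "(f s - f t) /\<^sub>R (s - t) - D = (f s - f t - (s - t) *\<^sub>R D) /\<^sub>R (s - t)"
      using that by (simp add: scaleR_diff_right)
    then show ?thesis by (simp add: divide_inverse mult.commute)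
  qed
  ultimately have "((\<lambda>s. norm ((f s - f t) /\<^sub>R (s - t) - D)) \<longlongrightarrow> 0) (at t within S)"
    by (elim Lim_transform_eventually) (auto simp: eventually_at_filter)
  then show ?thesis by (simp add: tendsto_norm_zero_iff LIM_zero_iff)
qed

lemma at_within_pos: "t > 0 \<Longrightarrow> at t within {0..} = at (t::real)"
  by (intro at_within_interior) simp

lemma real_derivative_of_complex:
  assumes "(f has_vector_derivative D) (at t within {0..})" "t > 0"
  shows "((\<lambda>s. Re (f s)) has_real_derivative Re D) (at t)" "((\<lambda>s. Im (f s)) has_real_derivative Im D) (at t)"
  using bounded_linear.has_vector_derivative[OF bounded_linear_Re assms(1)]
    bounded_linear.has_vector_derivative[OF bounded_linear_Im assms(1)] assms(2)
  by (simp_all add: at_within_pos has_real_derivative_iff_has_vector_derivative)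

lemma derivative_comparison:
  fixes f g :: "real \<Rightarrow> real"
  assumes "a \<le> b" "continuous_on {a..b} f" "continuous_on {a..b} g"
    and "\<And>x. a < x \<Longrightarrow> x < b \<Longrightarrow> (f has_real_derivative f' x) (at x)"
    and "\<And>x. a < x \<Longrightarrow> x < b \<Longrightarrow> (g has_real_derivative g' x) (at x)"
    and "\<And>x. a < x \<Longrightarrow> x < b \<Longrightarrow> f' x \<le> g' x"
  shows "f b - f a \<le> g b - g a"
proof -
  have "g a - f a \<le> g b - f b"
  proof (rule DERIV_nonneg_imp_increasing_open[OF assms(1)])
    show "continuous_on {a..b} (\<lambda>x. g x - f x)" by (intro continuous_intros assms)
    show "\<exists>y. ((\<lambda>x. g x - f x) has_real_derivative y) (at x) \<and> y \<ge> 0" if "a < x" "x < b" for x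
      using DERIV_diff[OF assms(5)[OF that] assms(4)[OF that]] assms(6)[OF that] by force
  qed
  then show ?thesis by simp
qed

lemma integral_upto_has_derivative:
  fixes h :: "real \<Rightarrow> real"
  assumes "continuous_on {0..} h"
  shows "t > 0 \<Longrightarrow> ((\<lambda>t. integral {0..t} h) has_real_derivative h t) (at t)"
    "continuous_on {0..} (\<lambda>t. integral {0..t} h)"
proof -
  show "((\<lambda>t. integral {0..t} h) has_real_derivative h t) (at t)" if t: "t > 0"
  proof -
    have "((\<lambda>t. integral {0..t} h) has_vector_derivative h t) (at t within {0..t + 1})"
      using t by (intro integral_has_vector_derivative continuous_on_subset[OF assms]) auto
    moreover have "at t within {0..t + 1} = at t" using t by (intro at_within_interior) simp
    ultimately show ?thesis by (simp add: has_real_derivative_iff_has_vector_derivative)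
  qed
  show "continuous_on {0..} (\<lambda>t. integral {0..t} h)"
    by (intro continuous_on_halfline indefinite_integral_continuous_1 integrable_continuous_real
        continuous_on_subset[OF assms]) auto
qed

lemma bounded_integral_of_decay:
  fixes h :: "real \<Rightarrow> real"
  assumes h: "continuous_on {0..} h" "\<And>t. t \<ge> 0 \<Longrightarrow> 0 \<le> h t"
    and T: "T > 0" "\<And>t. t \<ge> T \<Longrightarrow> h t \<le> C * t powr (- \<gamma>)" and \<gamma>: "\<gamma> > 1"
  obtains K where "\<And>t. t \<ge> 0 \<Longrightarrow> integral {0..t} h \<le> K"
proof -
  let ?H = "\<lambda>t. integral {0..t} h"
  \<comment> \<open>The primitive of the majorant that vanishes at infinity; being \<le> 0
    throughout, it bounds the tail by -p(T) uniformly in t.\<close>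
  define p where "p t = - (C / (\<gamma> - 1)) * t powr (1 - \<gamma>)" for t
  have C0: "C \<ge> 0"
  proof -
    have "0 \<le> C * T powr (- \<gamma>)" using h(2)[of T] T(2)[of T] T(1) by linarith
    then show ?thesis using T(1) by (simp add: zero_le_mult_iff)
  qed
  have hint: "h integrable_on {0..t}" for t
    by (intro integrable_continuous_real continuous_on_subset[OF h(1)]) auto
  have mono: "?H s \<le> ?H t" if "0 \<le> s" "s \<le> t" for s t
    using that hint h(2) by (intro integral_subset_le) auto
  have "?H t \<le> ?H T - p T" if t: "t \<ge> 0" for t
  proof (cases "t \<le> T")
    case True
    have "p T \<le> 0" unfolding p_def using C0 \<gamma> by simp
    then show ?thesis using mono[OF t True] by simp
  next
    case False
    have "?H t - ?H T \<le> p t - p T"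
    proof (rule derivative_comparison)
      show "T \<le> t" using False by simp
      show "continuous_on {T..t} ?H"
        using T(1) by (intro continuous_on_subset[OF integral_upto_has_derivative(2)[OF h(1)]]) auto
      show "continuous_on {T..t} p"
        unfolding p_def[abs_def] using T(1) by (intro continuous_intros) auto
      fix x assume x: "T < x" "x < t"
      show "(?H has_real_derivative h x) (at x)"
        using x T(1) by (intro integral_upto_has_derivative(1) h(1)) auto
      have "(p has_real_derivative - (C / (\<gamma> - 1)) * ((1 - \<gamma>) * x powr (1 - \<gamma> - 1))) (at x)"
        unfolding p_def[abs_def] using x T(1) by (intro DERIV_cmult has_real_derivative_powr) simp
      moreover have "- (C / (\<gamma> - 1)) * ((1 - \<gamma>) * x powr (1 - \<gamma> - 1)) = C * x powr (- \<gamma>)"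
        using \<gamma> by (simp add: field_simps)
      ultimately show "(p has_real_derivative C * x powr (- \<gamma>)) (at x)" by simp
      show "h x \<le> C * x powr (- \<gamma>)" using T(2) x by simp
    qed
    moreover have "p t \<le> 0" unfolding p_def using C0 \<gamma> by simp
    ultimately show ?thesis by simp
  qed
  then show ?thesis using that by blast
qed

lemma bounded_weighted_integral_of_decay:
  fixes f :: "real \<Rightarrow> complex"
  assumes f: "continuous_on {0..} f" and T: "T > 0" "\<And>t. t \<ge> T \<Longrightarrow> cmod (f t) \<le> C * t powr (- \<alpha>)"
    and \<gamma>: "real m * \<alpha> - real k > 1"
  obtains K where "\<And>t. t \<ge> 0 \<Longrightarrow> integral {0..t} (\<lambda>s. s ^ k * cmod (f s) ^ m) \<le> K"
proof (rule bounded_integral_of_decay[OF _ _ T(1) _ \<gamma>, of "\<lambda>s. s ^ k * cmod (f s) ^ m" "C ^ m"])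
  show "continuous_on {0..} (\<lambda>s. s ^ k * cmod (f s) ^ m)" by (intro continuous_intros f)
  show "0 \<le> t ^ k * cmod (f t) ^ m" if "t \<ge> 0" for t using that by simp
  show "t ^ k * cmod (f t) ^ m \<le> C ^ m * t powr - (real m * \<alpha> - real k)" if t: "t \<ge> T" for t
  proof -
    have t0: "t > 0" using t T(1) by simp
    have "t ^ k * cmod (f t) ^ m \<le> t ^ k * (C * t powr (- \<alpha>)) ^ m"
      using t0 T(2)[OF t] by (intro mult_left_mono power_mono) auto
    also have "\<dots> = C ^ m * (t powr real k * t powr (real m * (- \<alpha>)))"
      using t0 by (simp add: power_mult_distrib powr_realpow powr_power mult.commute)
    also have "t powr real k * t powr (real m * (- \<alpha>)) = t powr - (real m * \<alpha> - real k)"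
      by (simp flip: powr_add)
    finally show ?thesis .
  qed
qed (use that in blast)

text \<open>(|a|^2 + |b|^2)(a + b) is the difference-quotient form of the gradient of the quartic;
  on the diagonal it equals 4 |b|^2 b. The estimate makes the passage to the diagonal Lipschitz on
  bounded sets.\<close>

lemma cubic_difference_bound:
  fixes a b :: complex
  assumes "cmod a \<le> M" "cmod b \<le> M"
  shows "cmod (complex_of_real ((cmod a)\<^sup>2 + (cmod b)\<^sup>2) * (a + b) - 4 * (complex_of_real ((cmod b)\<^sup>2) * b)) \<le> 6 * M\<^sup>2 * cmod (a - b)"
proof -
  have M0: "0 \<le> M" using assms(1) norm_ge_zero[of a] by linarith
  have "complex_of_real ((cmod a)\<^sup>2 + (cmod b)\<^sup>2) * (a + b) - 4 * (complex_of_real ((cmod b)\<^sup>2) * b)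
     = complex_of_real ((cmod a)\<^sup>2 + (cmod b)\<^sup>2) * (a - b) + 2 * complex_of_real ((cmod a)\<^sup>2 - (cmod b)\<^sup>2) * b"
    by (simp add: algebra_simps)
  also have "cmod \<dots> \<le> ((cmod a)\<^sup>2 + (cmod b)\<^sup>2) * cmod (a - b) + 2 * \<bar>(cmod a)\<^sup>2 - (cmod b)\<^sup>2\<bar> * cmod b"
    by (rule order.trans[OF norm_triangle_ineq]) (simp add: norm_mult del: of_real_add of_real_diff)
  also have "\<dots> \<le> (M\<^sup>2 + M\<^sup>2) * cmod (a - b) + 2 * (2 * M * cmod (a - b)) * M"
  proof (intro add_mono mult_mono mult_right_mono mult_left_mono power_mono assms)
    have "\<bar>(cmod a)\<^sup>2 - (cmod b)\<^sup>2\<bar> = (cmod a + cmod b) * \<bar>cmod a - cmod b\<bar>"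
      by (simp add: power2_eq_square square_diff_square_factored abs_mult)
    also have "\<dots> \<le> (M + M) * cmod (a - b)"
      using assms M0 by (intro mult_mono add_mono norm_triangle_ineq3) auto
    finally show "\<bar>(cmod a)\<^sup>2 - (cmod b)\<^sup>2\<bar> \<le> 2 * M * cmod (a - b)" by simp
  qed (use M0 in auto)
  also have "\<dots> = 6 * M\<^sup>2 * cmod (a - b)" by (simp add: algebra_simps power2_eq_square)
  finally show ?thesis .
qed

lemma eventually_at_within_halfline: "eventually (\<lambda>s. s \<ge> 0) (at t within {0..})"
  by (auto simp: eventually_at_filter)

section \<open>Weighted inner products\<close>

definition bdd_weight :: "(real \<Rightarrow> real) \<Rightarrow> bool" where
  "bdd_weight b \<longleftrightarrow> continuous_on {0..} b \<and> (\<exists>C. \<forall>x\<ge>0. \<bar>b x\<bar> \<le> C)"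

definition weight_deriv :: "(real \<Rightarrow> real) \<Rightarrow> (real \<Rightarrow> real) \<Rightarrow> bool" where
  "weight_deriv b b' \<longleftrightarrow> bdd_weight b \<and> bdd_weight b' \<and>
     (\<forall>x\<ge>0. (b has_real_derivative b' x) (at x within {0..}))"

definition weighted_inner :: "(real \<Rightarrow> real) \<Rightarrow> (real \<Rightarrow> complex) \<Rightarrow> (real \<Rightarrow> complex) \<Rightarrow> complex" where
  "weighted_inner b f h = (LINT x|halfline. complex_of_real (b x) * (cnj (f x) * h x))"

lemma bdd_weight_const: "bdd_weight (\<lambda>x. c)"
  by (auto simp: bdd_weight_def)

lemma weight_deriv_const: "weight_deriv (\<lambda>x. c) (\<lambda>x. 0)"
  by (auto simp: weight_deriv_def bdd_weight_const)

lemma bdd_weight_measurable: "bdd_weight b \<Longrightarrow> (\<lambda>x. complex_of_real (b x)) \<in> borel_measurable halfline"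
  by (rule continuous_on_measurable_halfline) (auto simp: bdd_weight_def intro: continuous_intros)

lemma L2_weight:
  assumes "bdd_weight b" "h \<in> L2"
  shows "(\<lambda>x. complex_of_real (b x) * h x) \<in> L2"
proof -
  obtain C where "\<forall>x\<ge>0. \<bar>b x\<bar> \<le> C" using assms(1) by (auto simp: bdd_weight_def)
  then show ?thesis
    by (intro L2_bounded_mult[where C = C] assms bdd_weight_measurable) auto
qed

lemma weighted_inner_integrable:
  assumes "bdd_weight b" "f \<in> L2" "h \<in> L2"
  shows "integrable halfline (\<lambda>x. complex_of_real (b x) * (cnj (f x) * h x))"
  using L2_mult_integrable[OF L2_cnj[OF assms(2)] L2_weight[OF assms(1,3)]]
  by (simp add: mult.left_commute)

lemma weighted_inner_tendsto:
  assumes b: "bdd_weight b" and "L2_tendsto F f G" "L2_tendsto K k G"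
  shows "((\<lambda>s. weighted_inner b (F s) (K s)) \<longlongrightarrow> weighted_inner b f k) G"
proof -
  obtain C where C: "\<forall>x\<ge>0. \<bar>b x\<bar> \<le> C" using b by (auto simp: bdd_weight_def)
  have "L2_tendsto (\<lambda>s x. complex_of_real (b x) * K s x) (\<lambda>x. complex_of_real (b x) * k x) G"
    using C by (intro L2_tendsto_bounded_mult[where C = C] assms bdd_weight_measurable) auto
  from L2_tendsto_integral[OF L2_tendsto_cnj[OF assms(2)] this]
  show ?thesis by (simp add: weighted_inner_def mult.left_commute)
qed

lemma weighted_inner_cnj: "weighted_inner b h f = cnj (weighted_inner b f h)"
  unfolding weighted_inner_def Bochner_Integration.integral_cnj[symmetric] by (simp add: mult.commute)

lemma weighted_inner_linear:
  assumes "bdd_weight b" "f \<in> L2" "h \<in> L2" "k \<in> L2"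
  shows "weighted_inner b f (\<lambda>x. h x - k x) = weighted_inner b f h - weighted_inner b f k"
    "weighted_inner b (\<lambda>x. h x - k x) f = weighted_inner b h f - weighted_inner b k f"
    "weighted_inner b f (\<lambda>x. c * h x) = c * weighted_inner b f h"
    "weighted_inner b (\<lambda>x. c * h x) f = cnj c * weighted_inner b h f"
proof -
  note i = weighted_inner_integrable[OF assms(1)]
  show "weighted_inner b f (\<lambda>x. h x - k x) = weighted_inner b f h - weighted_inner b f k"
    unfolding weighted_inner_def Bochner_Integration.integral_diff[OF i[OF assms(2,3)] i[OF assms(2,4)], symmetric]
    by (simp add: algebra_simps)
  show "weighted_inner b (\<lambda>x. h x - k x) f = weighted_inner b h f - weighted_inner b k f"
    unfolding weighted_inner_def Bochner_Integration.integral_diff[OF i[OF assms(3,2)] i[OF assms(4,2)], symmetric]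
    by (simp add: algebra_simps)
  show "weighted_inner b f (\<lambda>x. c * h x) = c * weighted_inner b f h"
    unfolding weighted_inner_def integral_mult_right_zero[symmetric] by (simp add: mult_ac)
  show "weighted_inner b (\<lambda>x. c * h x) f = cnj c * weighted_inner b h f"
    unfolding weighted_inner_def integral_mult_right_zero[symmetric] by (simp add: mult_ac)
qed

lemma weighted_inner_weight_scale: "weighted_inner (\<lambda>x. c * b x) f h = complex_of_real c * weighted_inner b f h"
  unfolding weighted_inner_def integral_mult_right_zero[symmetric] by (simp add: mult_ac)

lemma weighted_inner_cong_AE:
  assumes "bdd_weight b" "f \<in> L2" "h \<in> L2" "h1 \<in> L2" "AE x in halfline. h x = h1 x"
  shows "weighted_inner b f h = weighted_inner b f h1"
  unfolding weighted_inner_def using assms weighted_inner_integrable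
  by (intro integral_cong_AE) (auto elim: eventually_mono)

lemma Re_weighted_inner:
  assumes "bdd_weight b" "f \<in> L2" "h \<in> L2"
  shows "Re (weighted_inner b f h) = (LINT x|halfline. b x * Re (cnj (f x) * h x))"
    "integrable halfline (\<lambda>x. b x * Re (cnj (f x) * h x))"
proof -
  have eq: "Re (complex_of_real r * c) = r * Re c" for r c by simp
  have "Re (weighted_inner b f h) = (LINT x|halfline. Re (complex_of_real (b x) * (cnj (f x) * h x)))"
    unfolding weighted_inner_def by (rule integral_Re[symmetric]) (rule weighted_inner_integrable[OF assms])
  then show "Re (weighted_inner b f h) = (LINT x|halfline. b x * Re (cnj (f x) * h x))"
    by (simp only: eq)
  show "integrable halfline (\<lambda>x. b x * Re (cnj (f x) * h x))"
    using integrable_Re[OF weighted_inner_integrable[OF assms]] by (simp only: eq)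
qed

lemma Im_weighted_inner:
  assumes "bdd_weight b" "f \<in> L2" "h \<in> L2"
  shows "Im (weighted_inner b f h) = (LINT x|halfline. b x * Im (cnj (f x) * h x))"
    "integrable halfline (\<lambda>x. b x * Im (cnj (f x) * h x))"
proof -
  have eq: "Im (complex_of_real r * c) = r * Im c" for r c by simp
  have "Im (weighted_inner b f h) = (LINT x|halfline. Im (complex_of_real (b x) * (cnj (f x) * h x)))"
    unfolding weighted_inner_def by (rule integral_Im[symmetric]) (rule weighted_inner_integrable[OF assms])
  then show "Im (weighted_inner b f h) = (LINT x|halfline. b x * Im (cnj (f x) * h x))"
    by (simp only: eq)
  show "integrable halfline (\<lambda>x. b x * Im (cnj (f x) * h x))"
    using integrable_Im[OF weighted_inner_integrable[OF assms]] by (simp only: eq)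
qed

text \<open>A bounded weight times two \<open>L2\<close> factors is integrable, so
  \<open>AC_deriv_integral_halfline\<close> applies to the triple product and only x = 0 contributes
  a boundary term.\<close>

lemma weighted_inner_integration_by_parts:
  assumes b: "weight_deriv b b'" and f: "AC_deriv f f'" "f \<in> L2" "f' \<in> L2"
    and h: "AC_deriv h h'" "h \<in> L2" "h' \<in> L2"
  shows "weighted_inner b f h' = - complex_of_real (b 0) * (cnj (f 0) * h 0) - weighted_inner b' f h - weighted_inner b f' h"
proof -
  have bw: "bdd_weight b" "bdd_weight b'" using b by (auto simp: weight_deriv_def)
  have "AC_deriv (\<lambda>x. complex_of_real (b x)) (\<lambda>x. complex_of_real (b' x))"
  proof (rule AC_derivI_has_derivative)
    show "((\<lambda>x. complex_of_real (b x)) has_vector_derivative complex_of_real (b' x)) (at x within {0..})" if "x \<ge> 0" for x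
      using b that by (intro has_vector_derivative_of_real)
        (auto simp: weight_deriv_def simp flip: has_real_derivative_iff_has_vector_derivative)
    show "continuous_on {0..} (\<lambda>x. complex_of_real (b' x))"
      using bw(2) by (auto simp: bdd_weight_def intro: continuous_intros)
  qed
  from AC_deriv_mult[OF this AC_deriv_mult[OF AC_deriv_cnj[OF f(1)] h(1)]]
  have ac: "AC_deriv (\<lambda>x. complex_of_real (b x) * (cnj (f x) * h x))
     (\<lambda>x. complex_of_real (b' x) * (cnj (f x) * h x) + (complex_of_real (b x) * (cnj (f' x) * h x) + complex_of_real (b x) * (cnj (f x) * h' x)))"
    by (simp add: algebra_simps)
  note i = weighted_inner_integrable[OF bw(2) f(2) h(2)] weighted_inner_integrable[OF bw(1) f(3) h(2)] weighted_inner_integrable[OF bw(1) f(2) h(3)]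
  have "weighted_inner b' f h + (weighted_inner b f' h + weighted_inner b f h') = - (complex_of_real (b 0) * (cnj (f 0) * h 0))"
    using AC_deriv_integral_halfline[OF ac weighted_inner_integrable[OF bw(1) f(2) h(2)]
       Bochner_Integration.integrable_add[OF i(1) Bochner_Integration.integrable_add[OF i(2,3)]]]
    unfolding weighted_inner_def by (simp only: Bochner_Integration.integral_add[OF i(1) Bochner_Integration.integrable_add[OF i(2,3)]]
       Bochner_Integration.integral_add[OF i(2,3)])
  then show ?thesis by (simp add: algebra_simps add_eq_0_iff2)
qed

lemma Re_weighted_inner_commute: "Re (weighted_inner b f h) = Re (weighted_inner b h f)" and Im_weighted_inner_commute: "Im (weighted_inner b f h) = - Im (weighted_inner b h f)"
  using weighted_inner_cnj[of b f h] by simp_all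

lemma weighted_inner_self_real: "Im (weighted_inner b f f) = 0"
  using Im_weighted_inner_commute[of b f f] by simp

lemma weighted_inner_dominated_convergence:
  assumes b: "\<And>n. bdd_weight (b n)" "bdd_weight b0" and C: "\<And>n x. \<bar>b n x\<bar> \<le> C"
    and lim: "\<And>x. (\<lambda>n. b n x) \<longlonglongrightarrow> b0 x" and L: "f \<in> L2" "h \<in> L2"
  shows "(\<lambda>n. weighted_inner (b n) f h) \<longlonglongrightarrow> weighted_inner b0 f h"
  unfolding weighted_inner_def
proof (rule integral_dominated_convergence[where w = "\<lambda>x. C * cmod (cnj (f x) * h x)"])
  have i: "integrable halfline (\<lambda>x. cnj (f x) * h x)" by (intro L2_mult_integrable L2_cnj L)
  show "(\<lambda>x. complex_of_real (b0 x) * (cnj (f x) * h x)) \<in> borel_measurable halfline"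
    by (rule borel_measurable_integrable[OF weighted_inner_integrable[OF b(2) L]])
  show "(\<lambda>x. complex_of_real (b n x) * (cnj (f x) * h x)) \<in> borel_measurable halfline" for n
    by (rule borel_measurable_integrable[OF weighted_inner_integrable[OF b(1) L]])
  show "integrable halfline (\<lambda>x. C * cmod (cnj (f x) * h x))"
    using i by (intro integrable_mult_right integrable_norm)
  show "AE x in halfline. (\<lambda>n. complex_of_real (b n x) * (cnj (f x) * h x)) \<longlonglongrightarrow> complex_of_real (b0 x) * (cnj (f x) * h x)"
    by (intro AE_I2 tendsto_intros lim)
  show "AE x in halfline. norm (complex_of_real (b n x) * (cnj (f x) * h x)) \<le> C * cmod (cnj (f x) * h x)" for n
    using C by (intro AE_I2) (auto simp: norm_mult intro!: mult_right_mono)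
qed

text \<open>\<open>virial e\<close> is the bounded substitute for the weight \<open>x\<^sup>2\<close>; the others are its first
  three derivatives.  Its square root still dominates half of \<open>virial1 e\<close>, as for \<open>x\<^sup>2\<close>.\<close>

definition virial :: "real \<Rightarrow> real \<Rightarrow> real" where "virial e x = (sin (e * x))\<^sup>2 / e\<^sup>2"
definition virial1 :: "real \<Rightarrow> real \<Rightarrow> real" where "virial1 e x = sin (2 * (e * x)) / e"
definition virial2 :: "real \<Rightarrow> real \<Rightarrow> real" where "virial2 e x = 2 * cos (2 * (e * x))"
definition virial3 :: "real \<Rightarrow> real \<Rightarrow> real" where "virial3 e x = - 4 * e * sin (2 * (e * x))"

text \<open>The first two bounds blow up as e tends to 0 and serve only to make the functionals
  finite for fixed e. The remainder that passes to the limit contains \<open>virial2\<close> and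
  \<open>virial3\<close>, whose bounds are uniform for e \<le> 1.\<close>

lemma virial_bounds:
  assumes "e > 0"
  shows "\<bar>virial e x\<bar> \<le> 1 / e\<^sup>2" "\<bar>virial1 e x\<bar> \<le> 1 / e" "\<bar>virial2 e x\<bar> \<le> 2" "\<bar>virial3 e x\<bar> \<le> 4 * e"
  using assms abs_sin_le_one[of "2 * (e * x)"] abs_cos_le_one[of "2 * (e * x)"] abs_square_le_1[of "sin (e * x)"]
  by (auto simp: virial_def virial1_def virial2_def virial3_def divide_right_mono abs_mult)

lemma virial_bdd_weight:
  assumes "e > 0"
  shows "bdd_weight (virial e)" "bdd_weight (virial1 e)" "bdd_weight (virial2 e)" "bdd_weight (virial3 e)"
proof -
  have *: "bdd_weight b" if "continuous_on {0..} b" "\<And>x. \<bar>b x\<bar> \<le> C" for b C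
    using that by (auto simp: bdd_weight_def)
  show "bdd_weight (virial e)"
    by (rule *[OF _ virial_bounds(1)[OF assms]])
       (use assms in \<open>auto simp: virial_def[abs_def] intro!: continuous_intros\<close>)
  show "bdd_weight (virial1 e)"
    by (rule *[OF _ virial_bounds(2)[OF assms]])
       (use assms in \<open>auto simp: virial1_def[abs_def] intro!: continuous_intros\<close>)
  show "bdd_weight (virial2 e)"
    by (rule *[OF _ virial_bounds(3)[OF assms]])
       (auto simp: virial2_def[abs_def] intro!: continuous_intros)
  show "bdd_weight (virial3 e)"
    by (rule *[OF _ virial_bounds(4)[OF assms]])
       (auto simp: virial3_def[abs_def] intro!: continuous_intros)
qed

lemma virial_weight_deriv:
  assumes "e > 0"
  shows "weight_deriv (virial e) (virial1 e)" "weight_deriv (virial1 e) (virial2 e)" "weight_deriv (virial2 e) (virial3 e)"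
proof -
  have "(virial e has_real_derivative virial1 e x) (at x)" for x
    using assms unfolding virial_def[abs_def] virial1_def
    by (auto intro!: derivative_eq_intros simp: sin_double power2_eq_square)
  moreover have "(virial1 e has_real_derivative virial2 e x) (at x)" for x
    using assms unfolding virial1_def[abs_def] virial2_def by (auto intro!: derivative_eq_intros)
  moreover have "(virial2 e has_real_derivative virial3 e x) (at x)" for x
    unfolding virial2_def[abs_def] virial3_def by (auto intro!: derivative_eq_intros)
  ultimately show "weight_deriv (virial e) (virial1 e)" "weight_deriv (virial1 e) (virial2 e)" "weight_deriv (virial2 e) (virial3 e)"
    unfolding weight_deriv_def
    using virial_bdd_weight[OF assms] by (auto intro: has_field_derivative_at_within)
qed

text \<open>By the double angle formula, |sin 2y| \<le> 2 |sin y|. This is the inequality needed to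
  complete the square in \<open>virial_energy_lower_bound\<close>.\<close>

lemma virial1_le:
  assumes "e > 0"
  shows "\<bar>virial1 e x\<bar> \<le> 2 * sqrt (virial e x)"
proof -
  have "\<bar>virial1 e x\<bar> = 2 * (\<bar>sin (e * x)\<bar> / e) * \<bar>cos (e * x)\<bar>"
    using assms by (simp add: virial1_def sin_double abs_mult)
  also have "\<dots> \<le> 2 * (\<bar>sin (e * x)\<bar> / e)"
    using assms by (intro mult_left_le) auto
  also have "\<bar>sin (e * x)\<bar> / e = sqrt (virial e x)"
    using assms by (simp add: virial_def real_sqrt_divide)
  finally show ?thesis .
qed

section \<open>Conservation laws\<close>

text \<open>\<open>w\<close>, \<open>z\<close>, \<open>v\<close> play the roles of \<open>q\<^sub>x\<close>, \<open>q\<^sub>x\<^sub>x\<close>, \<open>q\<^sub>t\<close>, with time as the first argument.\<close>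

locale nls_flow =
  fixes u w z v :: "real \<Rightarrow> real \<Rightarrow> complex" and Q Q' :: "real \<Rightarrow> complex"
  assumes AC_u: "t \<ge> 0 \<Longrightarrow> AC_deriv (u t) (w t)"
    and AC_w: "t \<ge> 0 \<Longrightarrow> AC_deriv (w t) (z t)"
    and u_tendsto: "t \<ge> 0 \<Longrightarrow> L2_tendsto u (u t) (at t within {0..})"
    and w_tendsto: "t \<ge> 0 \<Longrightarrow> L2_tendsto w (w t) (at t within {0..})"
    and z_tendsto: "t \<ge> 0 \<Longrightarrow> L2_tendsto z (z t) (at t within {0..})"
    and quot_tendsto: "t \<ge> 0 \<Longrightarrow>
      L2_tendsto (\<lambda>s x. (u s x - u t x) / complex_of_real (s - t)) (v t) (at t within {0..})"
    and pde: "t > 0 \<Longrightarrow> AE x in halfline.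
      \<i> * v t x + z t x - 2 * complex_of_real ((cmod (u t x))\<^sup>2) * u t x = 0"
    and bdry: "t \<ge> 0 \<Longrightarrow> u t 0 = Q t"
    and Q_deriv: "t \<ge> 0 \<Longrightarrow> (Q has_vector_derivative Q' t) (at t within {0..})"
begin

definition cub :: "real \<Rightarrow> real \<Rightarrow> complex" where
  "cub t x = complex_of_real ((cmod (u t x))\<^sup>2) * u t x"

definition quot :: "real \<Rightarrow> real \<Rightarrow> real \<Rightarrow> complex" where
  "quot t s x = (u s x - u t x) / complex_of_real (s - t)"

lemma L2_members: "t \<ge> 0 \<Longrightarrow> u t \<in> L2" "t \<ge> 0 \<Longrightarrow> w t \<in> L2" "t \<ge> 0 \<Longrightarrow> z t \<in> L2" "t \<ge> 0 \<Longrightarrow> v t \<in> L2"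
  using u_tendsto w_tendsto z_tendsto quot_tendsto by (auto simp: L2_tendsto_def)

lemma u_bounded: "t \<ge> 0 \<Longrightarrow> \<exists>M. \<forall>x\<ge>0. cmod (u t x) \<le> M"
  using AC_deriv_sup_bound[OF AC_u L2_members(1) L2_members(2)] by (meson real_le_rsqrt)

lemma u_measurable: "t \<ge> 0 \<Longrightarrow> u t \<in> borel_measurable halfline"
  using L2_members(1) L2_measurable by blast

lemma cub_L2: "t \<ge> 0 \<Longrightarrow> cub t \<in> L2"
proof -
  assume t: "t \<ge> 0"
  then obtain M where M: "\<forall>x\<ge>0. cmod (u t x) \<le> M" using u_bounded by blast
  have "(\<lambda>x. complex_of_real ((cmod (u t x))\<^sup>2) * u t x) \<in> L2"
    using u_measurable[OF t] M
    by (intro L2_bounded_mult[where C = "M\<^sup>2"] L2_members t) (auto simp: norm_power intro: power_mono)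
  then show ?thesis by (simp add: cub_def[abs_def])
qed

lemma L2_tendsto_quot: "t \<ge> 0 \<Longrightarrow> L2_tendsto (quot t) (v t) (at t within {0..})"
  using quot_tendsto by (simp add: quot_def[abs_def])

lemma weighted_inner_quot:
  assumes "bdd_weight b" "s \<ge> 0" "t \<ge> 0" "h \<in> L2"
  shows "weighted_inner b (quot t s) h = (weighted_inner b (u s) h - weighted_inner b (u t) h) /\<^sub>R (s - t)"
    "weighted_inner b h (quot t s) = (weighted_inner b h (u s) - weighted_inner b h (u t)) /\<^sub>R (s - t)"
proof -
  have L: "(\<lambda>x. u s x - u t x) \<in> L2" using assms by (intro L2_diff L2_members)
  have q: "quot t s = (\<lambda>x. complex_of_real (1 / (s - t)) * (u s x - u t x))"
    by (auto simp: quot_def divide_inverse mult.commute)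
  show "weighted_inner b (quot t s) h = (weighted_inner b (u s) h - weighted_inner b (u t) h) /\<^sub>R (s - t)"
    unfolding q weighted_inner_linear(4)[OF assms(1,4) L L] weighted_inner_linear(2)[OF assms(1,4) L2_members(1)[OF assms(2)] L2_members(1)[OF assms(3)]]
    by (simp add: scaleR_conv_of_real divide_inverse)
  show "weighted_inner b h (quot t s) = (weighted_inner b h (u s) - weighted_inner b h (u t)) /\<^sub>R (s - t)"
    unfolding q weighted_inner_linear(3)[OF assms(1,4) L L] weighted_inner_linear(1)[OF assms(1,4) L2_members(1)[OF assms(2)] L2_members(1)[OF assms(3)]]
    by (simp add: scaleR_conv_of_real divide_inverse)
qed

text \<open>The increment of \<open>w\<close> is the x-derivative of the increment of
  \<open>u\<close>. After integration by parts only the difference quotients of \<open>u\<close> and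
  \<open>Q\<close> remain, which converge, whereas those of \<open>w\<close> need not.\<close>

lemma weighted_inner_parts_quot:
  assumes b: "weight_deriv b b'" and f: "AC_deriv f f'" "f \<in> L2" "f' \<in> L2" and t: "s \<ge> 0" "t \<ge> 0"
  shows "(weighted_inner b f (w s) - weighted_inner b f (w t)) /\<^sub>R (s - t) =
     - complex_of_real (b 0) * cnj (f 0) * ((Q s - Q t) /\<^sub>R (s - t)) - weighted_inner b' f (quot t s) - weighted_inner b f' (quot t s)"
proof -
  have bw: "bdd_weight b" "bdd_weight b'" using b by (auto simp: weight_deriv_def)
  have "weighted_inner b f (w s) - weighted_inner b f (w t) = weighted_inner b f (\<lambda>x. w s x - w t x)"
    using weighted_inner_linear(1)[OF bw(1) f(2) L2_members(2) L2_members(2)] t by simp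
  also have "\<dots> = - complex_of_real (b 0) * (cnj (f 0) * (u s 0 - u t 0))
       - weighted_inner b' f (\<lambda>x. u s x - u t x) - weighted_inner b f' (\<lambda>x. u s x - u t x)"
    using t by (intro weighted_inner_integration_by_parts b f AC_deriv_diff AC_u L2_diff L2_members)
  also have "\<dots> = - complex_of_real (b 0) * cnj (f 0) * (Q s - Q t)
       - (weighted_inner b' f (u s) - weighted_inner b' f (u t)) - (weighted_inner b f' (u s) - weighted_inner b f' (u t))"
    using t bdry weighted_inner_linear(1)[OF bw(2) f(2) L2_members(1) L2_members(1)] weighted_inner_linear(1)[OF bw(1) f(3) L2_members(1) L2_members(1)]
    by simp
  finally have eq: "weighted_inner b f (w s) - weighted_inner b f (w t) = \<dots>" .
  show ?thesis
    unfolding weighted_inner_quot(2)[OF bw(2) t f(2)] weighted_inner_quot(2)[OF bw(1) t f(3)] eq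
    by (simp add: scaleR_conv_of_real algebra_simps)
qed

lemma Q_quot_tendsto: "t \<ge> 0 \<Longrightarrow> ((\<lambda>s. (Q s - Q t) /\<^sub>R (s - t)) \<longlongrightarrow> Q' t) (at t within {0..})"
  by (rule has_vector_derivative_quotient_tendsto[OF Q_deriv])

section \<open>Time derivatives of the quadratic and quartic functionals\<close>

lemma weighted_inner_uu_has_derivative:
  assumes b: "bdd_weight b" and t: "t \<ge> 0"
  shows "((\<lambda>s. weighted_inner b (u s) (u s)) has_vector_derivative weighted_inner b (v t) (u t) + weighted_inner b (u t) (v t)) (at t within {0..})"
proof (rule has_vector_derivative_withinI)
  \<comment> \<open>Discrete product rule: one increment is paired with the other factor at time s,
    the second with its partner at time t, so no quadratic error term appears.\<close>
  have "((\<lambda>s. weighted_inner b (quot t s) (u s) + weighted_inner b (u t) (quot t s)) \<longlongrightarrow> weighted_inner b (v t) (u t) + weighted_inner b (u t) (v t)) (at t within {0..})"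
    by (intro tendsto_intros weighted_inner_tendsto b L2_tendsto_quot u_tendsto t L2_tendsto_const L2_members)
  then show "((\<lambda>s. (weighted_inner b (u s) (u s) - weighted_inner b (u t) (u t)) /\<^sub>R (s - t)) \<longlongrightarrow> weighted_inner b (v t) (u t) + weighted_inner b (u t) (v t)) (at t within {0..})"
  proof (rule Lim_transform_eventually)
    show "eventually (\<lambda>s. weighted_inner b (quot t s) (u s) + weighted_inner b (u t) (quot t s) = (weighted_inner b (u s) (u s) - weighted_inner b (u t) (u t)) /\<^sub>R (s - t)) (at t within {0..})"
      using eventually_at_within_halfline
    proof eventually_elim
      case (elim s)
      then show ?case
        using t by (simp add: weighted_inner_quot b L2_members flip: scaleR_add_right)
    qed
  qed
qed

text \<open>The split passes through the mixed pairing of \<open>u t\<close> with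
  \<open>w s\<close>: the increment of \<open>u\<close> meets \<open>w s\<close>, and the increment
  of \<open>w\<close> meets the fixed function \<open>u t\<close>, where
  \<open>weighted_inner_parts_quot\<close> applies.\<close>

lemma weighted_inner_uw_has_derivative:
  assumes b: "weight_deriv b b'" and t: "t \<ge> 0"
  shows "((\<lambda>s. weighted_inner b (u s) (w s)) has_vector_derivative
     weighted_inner b (v t) (w t) - complex_of_real (b 0) * cnj (Q t) * Q' t - weighted_inner b' (u t) (v t) - weighted_inner b (w t) (v t)) (at t within {0..})"
proof (rule has_vector_derivative_withinI)
  have bw: "bdd_weight b" "bdd_weight b'" using b by (auto simp: weight_deriv_def)
  have "((\<lambda>s. weighted_inner b (quot t s) (w s) + (- complex_of_real (b 0) * cnj (u t 0) * ((Q s - Q t) /\<^sub>R (s - t)) - weighted_inner b' (u t) (quot t s) - weighted_inner b (w t) (quot t s))) \<longlongrightarrow>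
     weighted_inner b (v t) (w t) + (- complex_of_real (b 0) * cnj (u t 0) * Q' t - weighted_inner b' (u t) (v t) - weighted_inner b (w t) (v t))) (at t within {0..})"
    by (intro tendsto_add tendsto_diff tendsto_mult[OF tendsto_const] Q_quot_tendsto weighted_inner_tendsto bw L2_tendsto_quot w_tendsto t L2_tendsto_const L2_members)
  then have "((\<lambda>s. weighted_inner b (quot t s) (w s) + (- complex_of_real (b 0) * cnj (u t 0) * ((Q s - Q t) /\<^sub>R (s - t)) - weighted_inner b' (u t) (quot t s) - weighted_inner b (w t) (quot t s))) \<longlongrightarrow>
     weighted_inner b (v t) (w t) - complex_of_real (b 0) * cnj (Q t) * Q' t - weighted_inner b' (u t) (v t) - weighted_inner b (w t) (v t)) (at t within {0..})"
    using bdry[OF t] by (simp add: algebra_simps)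
  then show "((\<lambda>s. (weighted_inner b (u s) (w s) - weighted_inner b (u t) (w t)) /\<^sub>R (s - t)) \<longlongrightarrow>
     weighted_inner b (v t) (w t) - complex_of_real (b 0) * cnj (Q t) * Q' t - weighted_inner b' (u t) (v t) - weighted_inner b (w t) (v t)) (at t within {0..})"
  proof (rule Lim_transform_eventually)
    show "eventually (\<lambda>s. weighted_inner b (quot t s) (w s) + (- complex_of_real (b 0) * cnj (u t 0) * ((Q s - Q t) /\<^sub>R (s - t)) - weighted_inner b' (u t) (quot t s) - weighted_inner b (w t) (quot t s))
       = (weighted_inner b (u s) (w s) - weighted_inner b (u t) (w t)) /\<^sub>R (s - t)) (at t within {0..})"
      using eventually_at_within_halfline
    proof eventually_elim
      case (elim s)
      have "weighted_inner b (quot t s) (w s) = (weighted_inner b (u s) (w s) - weighted_inner b (u t) (w s)) /\<^sub>R (s - t)"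
        using elim t by (intro weighted_inner_quot bw L2_members)
      moreover have "- complex_of_real (b 0) * cnj (u t 0) * ((Q s - Q t) /\<^sub>R (s - t)) - weighted_inner b' (u t) (quot t s) - weighted_inner b (w t) (quot t s)
         = (weighted_inner b (u t) (w s) - weighted_inner b (u t) (w t)) /\<^sub>R (s - t)"
        using elim t by (intro weighted_inner_parts_quot[symmetric] b AC_u L2_members)
      ultimately show ?case
        by (simp only: scaleR_add_right[symmetric]) simp
    qed
  qed
qed

lemma w0_tendsto: "t \<ge> 0 \<Longrightarrow> ((\<lambda>s. w s 0) \<longlongrightarrow> w t 0) (at t within {0..})"
proof (rule tendstoI)
  fix e :: real assume t: "t \<ge> 0" and e: "e > 0"
  have "eventually (\<lambda>s. AC_deriv (w s) (z s)) (at t within {0..})"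
    using eventually_at_within_halfline by eventually_elim (rule AC_w)
  then have "eventually (\<lambda>s. \<forall>x\<ge>0. cmod (w s x - w t x) < e) (at t within {0..})"
    using t e by (intro L2_tendsto_sup[OF w_tendsto z_tendsto _ AC_w])
  then show "eventually (\<lambda>s. dist (w s 0) (w t 0) < e) (at t within {0..})"
    by eventually_elim (simp add: dist_norm)
qed

text \<open>Both increments now fall on \<open>w\<close> and both are moved by parts: once against
  \<open>w s\<close> and, after conjugation, once against \<open>w t\<close>. The limit of the first
  uses convergence of \<open>z s\<close> and of \<open>w s 0\<close>, that is, continuity of the
  curve in \<open>H2\<close>.\<close>

lemma weighted_inner_ww_has_derivative:
  assumes t: "t \<ge> 0"
  shows "((\<lambda>s. weighted_inner (\<lambda>x. 1) (w s) (w s)) has_vector_derivative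
     complex_of_real (- 2 * Re (cnj (Q' t) * w t 0) - 2 * Re (weighted_inner (\<lambda>x. 1) (v t) (z t)))) (at t within {0..})"
proof (rule has_vector_derivative_withinI)
  let ?W = "weighted_inner (\<lambda>x. 1)"
  let ?A = "\<lambda>s r. - cnj (w r 0) * ((Q s - Q t) /\<^sub>R (s - t)) - ?W (z r) (quot t s)"
  have A: "(?W (w r) (w s) - ?W (w r) (w t)) /\<^sub>R (s - t) = ?A s r" if "s \<ge> 0" "r \<ge> 0" for s r
  proof -
    have "weighted_inner (\<lambda>x. 0) (w r) (quot t s) = 0" by (simp add: weighted_inner_def)
    then show ?thesis
      using weighted_inner_parts_quot[OF weight_deriv_const[of 1] AC_w L2_members(2) L2_members(3) that(1) t, of r] that by simp
  qed
  let ?L = "- cnj (w t 0) * Q' t - ?W (z t) (v t)"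
  have "((\<lambda>s. cnj (?A s s) + ?A s t) \<longlongrightarrow> cnj ?L + ?L) (at t within {0..})"
    by (intro tendsto_add tendsto_diff tendsto_mult tendsto_cnj tendsto_minus w0_tendsto Q_quot_tendsto weighted_inner_tendsto bdd_weight_const
        L2_tendsto_quot z_tendsto t L2_tendsto_const L2_members tendsto_const)
  moreover have "cnj ?L + ?L = complex_of_real (- 2 * Re (cnj (Q' t) * w t 0) - 2 * Re (?W (v t) (z t)))"
  proof -
    have "?W (z t) (v t) = cnj (?W (v t) (z t))" by (rule weighted_inner_cnj)
    then show ?thesis by (simp add: complex_eq_iff)
  qed
  ultimately have "((\<lambda>s. cnj (?A s s) + ?A s t) \<longlongrightarrow> complex_of_real (- 2 * Re (cnj (Q' t) * w t 0) - 2 * Re (?W (v t) (z t)))) (at t within {0..})"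
    by simp
  then show "((\<lambda>s. (?W (w s) (w s) - ?W (w t) (w t)) /\<^sub>R (s - t)) \<longlongrightarrow>
      complex_of_real (- 2 * Re (cnj (Q' t) * w t 0) - 2 * Re (?W (v t) (z t)))) (at t within {0..})"
  proof (rule Lim_transform_eventually)
    show "eventually (\<lambda>s. cnj (?A s s) + ?A s t = (?W (w s) (w s) - ?W (w t) (w t)) /\<^sub>R (s - t)) (at t within {0..})"
      using eventually_at_within_halfline
    proof eventually_elim
      case (elim s)
      have "cnj (?A s s) + ?A s t = cnj ((?W (w s) (w s) - ?W (w s) (w t)) /\<^sub>R (s - t)) + (?W (w t) (w s) - ?W (w t) (w t)) /\<^sub>R (s - t)"
        using A[OF elim elim] A[OF elim t] by simp
      also have "\<dots> = ((?W (w s) (w s) - ?W (w t) (w s)) + (?W (w t) (w s) - ?W (w t) (w t))) /\<^sub>R (s - t)"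
      proof -
        have "cnj (?W (w s) (w s)) = ?W (w s) (w s)" "cnj (?W (w s) (w t)) = ?W (w t) (w s)"
          by (rule weighted_inner_cnj[symmetric])+
        then show ?thesis by (simp add: scaleR_conv_of_real algebra_simps)
      qed
      finally show ?case by simp
    qed
  qed
qed

text \<open>Written as a pairing with \<open>cub\<close> because the cubic term of the equation
  enters the identities in this form; \<open>quart_eq\<close> recovers the weighted integral of
  |u|^4.\<close>

definition quart :: "(real \<Rightarrow> real) \<Rightarrow> real \<Rightarrow> real" where
  "quart b t = Re (weighted_inner b (u t) (cub t))"

lemma quart_eq:
  assumes "bdd_weight b" "t \<ge> 0"
  shows "quart b t = (LINT x|halfline. b x * cmod (u t x) ^ 4)" "integrable halfline (\<lambda>x. b x * cmod (u t x) ^ 4)"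
    "weighted_inner b (u t) (cub t) = complex_of_real (quart b t)"
proof -
  have eq: "cnj (u t x) * cub t x = complex_of_real (cmod (u t x) ^ 4)" for x
  proof -
    have "cnj (u t x) * cub t x = complex_of_real ((cmod (u t x))\<^sup>2) * (u t x * cnj (u t x))"
      by (simp add: cub_def mult_ac)
    also have "\<dots> = complex_of_real ((cmod (u t x))\<^sup>2 * (cmod (u t x))\<^sup>2)"
      by (simp only: complex_norm_square[symmetric] of_real_mult)
    finally show ?thesis by (simp flip: power_add)
  qed
  show "quart b t = (LINT x|halfline. b x * cmod (u t x) ^ 4)" "integrable halfline (\<lambda>x. b x * cmod (u t x) ^ 4)"
    using Re_weighted_inner[OF assms(1) L2_members(1)[OF assms(2)] cub_L2[OF assms(2)]]
    unfolding quart_def eq Re_complex_of_real by blast+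
  have "weighted_inner b (cub t) (u t) = weighted_inner b (u t) (cub t)"
    unfolding weighted_inner_def cub_def by (simp add: mult_ac)
  then have "Im (weighted_inner b (u t) (cub t)) = 0"
    using weighted_inner_cnj[of b "u t" "cub t"] by (simp add: complex_eq_iff)
  then show "weighted_inner b (u t) (cub t) = complex_of_real (quart b t)"
    by (simp add: quart_def complex_eq_iff)
qed

text \<open>The factor that makes Re (conj (a - b) c) equal to |a|^4 - |b|^4, with a and b the
  values of \<open>u\<close> at times s and t. The difference quotient of \<open>quart\<close> thus
  becomes a pairing of \<open>quot\<close> with an \<open>L2\<close>-convergent family.\<close>

definition cub_sum :: "real \<Rightarrow> real \<Rightarrow> real \<Rightarrow> complex" where
  "cub_sum t s x = complex_of_real ((cmod (u s x))\<^sup>2 + (cmod (u t x))\<^sup>2) * (u s x + u t x)"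

lemma cub_sum_L2:
  assumes "s \<ge> 0" "t \<ge> 0"
  shows "cub_sum t s \<in> L2"
proof -
  obtain M where M: "\<forall>x\<ge>0. cmod (u t x) \<le> M" using u_bounded assms by blast
  obtain N where N: "\<forall>x\<ge>0. cmod (u s x) \<le> N" using u_bounded assms by blast
  have "(\<lambda>x. complex_of_real ((cmod (u s x))\<^sup>2 + (cmod (u t x))\<^sup>2) * (u s x + u t x)) \<in> L2"
  proof (rule L2_bounded_mult[where C = "N\<^sup>2 + M\<^sup>2"])
    show "(\<lambda>x. u s x + u t x) \<in> L2" using assms by (intro L2_add L2_members)
    show "(\<lambda>x. complex_of_real ((cmod (u s x))\<^sup>2 + (cmod (u t x))\<^sup>2)) \<in> borel_measurable halfline"
      using u_measurable assms by measurable
    fix x :: real assume x: "x > 0"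
    have "(cmod (u s x))\<^sup>2 + (cmod (u t x))\<^sup>2 \<le> N\<^sup>2 + M\<^sup>2"
      using M N x by (intro add_mono power_mono) auto
    then show "cmod (complex_of_real ((cmod (u s x))\<^sup>2 + (cmod (u t x))\<^sup>2)) \<le> N\<^sup>2 + M\<^sup>2"
      by (simp only: norm_of_real) (simp add: abs_of_nonneg)
  qed
  then show ?thesis by (simp add: cub_sum_def[abs_def])
qed

lemma cub_sum_tendsto:
  assumes t: "t \<ge> 0"
  shows "L2_tendsto (cub_sum t) (\<lambda>x. 4 * cub t x) (at t within {0..})"
proof -
  obtain M where M: "\<forall>x\<ge>0. cmod (u t x) \<le> M" using u_bounded t by blast
  show ?thesis
  proof (rule L2_tendsto_dominated[OF u_tendsto[OF t]])
    show "(\<lambda>x. 4 * cub t x) \<in> L2" using cub_L2[OF t] by (rule L2_scale)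
    show "eventually (\<lambda>s. cub_sum t s \<in> L2) (at t within {0..})"
      using eventually_at_within_halfline by eventually_elim (rule cub_sum_L2[OF _ t])
    have "eventually (\<lambda>s. AC_deriv (u s) (w s)) (at t within {0..})"
      using eventually_at_within_halfline by eventually_elim (rule AC_u)
    \<comment> \<open>Uniform convergence in x gives the common bound M + 1 at times near t, as
      \<open>cubic_difference_bound\<close> requires.\<close>
    then have "eventually (\<lambda>s. \<forall>x\<ge>0. cmod (u s x - u t x) < 1) (at t within {0..})"
      using t by (intro L2_tendsto_sup[OF u_tendsto w_tendsto _ AC_u]) auto
    then show "eventually (\<lambda>s. \<forall>x>0. cmod (cub_sum t s x - 4 * cub t x) \<le> 6 * (M + 1)\<^sup>2 * cmod (u s x - u t x)) (at t within {0..})"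
    proof eventually_elim
      case (elim s)
      show ?case
      proof (intro allI impI)
        fix x :: real assume x: "x > 0"
        have 1: "cmod (u t x) \<le> M" "cmod (u s x - u t x) < 1" using M elim x by auto
        have "cmod (u t x) \<le> M + 1" "cmod (u s x) \<le> M + 1"
          using 1 norm_triangle_sub[of "u s x" "u t x"] by linarith+
        then show "cmod (cub_sum t s x - 4 * cub t x) \<le> 6 * (M + 1)\<^sup>2 * cmod (u s x - u t x)"
          unfolding cub_sum_def cub_def by (intro cubic_difference_bound)
      qed
    qed
  qed simp
qed

lemma quart_has_derivative:
  assumes 1: "bdd_weight b" and t: "t \<ge> 0"
  shows "((\<lambda>s. quart b s) has_vector_derivative 4 * Re (weighted_inner b (v t) (cub t))) (at t within {0..})"
proof (rule has_vector_derivative_withinI)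
  let ?W = "weighted_inner b"
  have "((\<lambda>s. Re (?W (quot t s) (cub_sum t s))) \<longlongrightarrow> Re (?W (v t) (\<lambda>x. 4 * cub t x))) (at t within {0..})"
    by (intro tendsto_Re weighted_inner_tendsto 1 L2_tendsto_quot cub_sum_tendsto t)
  moreover have "?W (v t) (\<lambda>x. 4 * cub t x) = 4 * ?W (v t) (cub t)"
    by (rule weighted_inner_linear(3)[OF 1 L2_members(4)[OF t] cub_L2[OF t] cub_L2[OF t]])
  ultimately have "((\<lambda>s. Re (?W (quot t s) (cub_sum t s))) \<longlongrightarrow> 4 * Re (?W (v t) (cub t))) (at t within {0..})"
    by simp
  then show "((\<lambda>s. (quart b s - quart b t) /\<^sub>R (s - t)) \<longlongrightarrow> 4 * Re (?W (v t) (cub t))) (at t within {0..})"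
  proof (rule Lim_transform_eventually)
    show "eventually (\<lambda>s. Re (?W (quot t s) (cub_sum t s)) = (quart b s - quart b t) /\<^sub>R (s - t)) (at t within {0..})"
      using eventually_at_within_halfline
    proof eventually_elim
      case (elim s)
      have id: "Re (cnj (a - b) * (complex_of_real ((cmod a)\<^sup>2 + (cmod b)\<^sup>2) * (a + b))) = cmod a ^ 4 - cmod b ^ 4" for a b
      proof -
        have "Re (cnj (a - b) * (complex_of_real r * (a + b))) = r * ((cmod a)\<^sup>2 - (cmod b)\<^sup>2)" for r
          unfolding cmod_power2 by (simp add: algebra_simps power2_eq_square)
        then have "Re (cnj (a - b) * (complex_of_real ((cmod a)\<^sup>2 + (cmod b)\<^sup>2) * (a + b)))
           = ((cmod a)\<^sup>2 + (cmod b)\<^sup>2) * ((cmod a)\<^sup>2 - (cmod b)\<^sup>2)" .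
        also have "\<dots> = cmod a ^ 4 - cmod b ^ 4"
          by (simp add: power4_eq_xxxx power2_eq_square algebra_simps)
        finally show ?thesis .
      qed
      have L: "(\<lambda>x. u s x - u t x) \<in> L2" using elim t by (intro L2_diff L2_members)
      have "Re (?W (\<lambda>x. u s x - u t x) (cub_sum t s)) = (LINT x|halfline. b x * (cmod (u s x) ^ 4 - cmod (u t x) ^ 4))"
        unfolding Re_weighted_inner(1)[OF 1 L cub_sum_L2[OF elim t]] cub_sum_def id ..
      also have "\<dots> = quart b s - quart b t"
        using quart_eq[OF 1 elim] quart_eq[OF 1 t] by (simp add: Bochner_Integration.integral_diff right_diff_distrib)
      finally have "Re (?W (u s) (cub_sum t s) - ?W (u t) (cub_sum t s)) = quart b s - quart b t"
        using weighted_inner_linear(2)[OF 1 cub_sum_L2[OF elim t] L2_members(1)[OF elim] L2_members(1)[OF t]] by simp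
      then show ?case
        unfolding weighted_inner_quot(1)[OF 1 elim t cub_sum_L2[OF elim t]] by simp
    qed
  qed
qed

definition mass :: "(real \<Rightarrow> real) \<Rightarrow> real \<Rightarrow> real" where "mass b t = Re (weighted_inner b (u t) (u t))"
definition kin :: "(real \<Rightarrow> real) \<Rightarrow> real \<Rightarrow> real" where "kin b t = Re (weighted_inner b (w t) (w t))"
definition mom :: "(real \<Rightarrow> real) \<Rightarrow> real \<Rightarrow> real" where "mom b t = Im (weighted_inner b (u t) (w t))"

section \<open>The equation in weak form and integrations by parts in space\<close>

text \<open>Multiplying the equation by -i solves it for \<open>v\<close>. It holds only almost
  everywhere, hence its use inside pairings.\<close>

lemma weighted_inner_v:
  assumes b: "bdd_weight b" and t: "t > 0" and h: "h \<in> L2"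
  shows "weighted_inner b h (v t) = \<i> * weighted_inner b h (z t) - 2 * \<i> * weighted_inner b h (cub t)"
    "weighted_inner b (v t) h = cnj (\<i> * weighted_inner b h (z t) - 2 * \<i> * weighted_inner b h (cub t))"
proof -
  have t0: "t \<ge> 0" using t by simp
  have L: "(\<lambda>x. \<i> * z t x) \<in> L2" "(\<lambda>x. (2 * \<i>) * cub t x) \<in> L2"
    using t0 by (intro L2_scale L2_members cub_L2; simp)+
  have "AE x in halfline. v t x = \<i> * z t x - (2 * \<i>) * cub t x"
    using pde[OF t]
  proof eventually_elim
    case (elim x)
    have "v t x = - \<i> * (\<i> * v t x)" by simp
    also have "\<i> * v t x = 2 * cub t x - z t x"
      using elim by (simp add: cub_def algebra_simps)
    finally show ?case by (simp add: algebra_simps)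
  qed
  then have "weighted_inner b h (v t) = weighted_inner b h (\<lambda>x. \<i> * z t x - (2 * \<i>) * cub t x)"
    by (intro weighted_inner_cong_AE b h L2_members t0 L2_diff L)
  also have "\<dots> = \<i> * weighted_inner b h (z t) - 2 * \<i> * weighted_inner b h (cub t)"
    using weighted_inner_linear(1)[OF b h L] weighted_inner_linear(3)[OF b h L2_members(3)[OF t0] L2_members(3)[OF t0]] weighted_inner_linear(3)[OF b h cub_L2[OF t0] cub_L2[OF t0]]
    by simp
  finally show *: "weighted_inner b h (v t) = \<i> * weighted_inner b h (z t) - 2 * \<i> * weighted_inner b h (cub t)" .
  show "weighted_inner b (v t) h = cnj (\<i> * weighted_inner b h (z t) - 2 * \<i> * weighted_inner b h (cub t))"
    unfolding *[symmetric] by (rule weighted_inner_cnj)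
qed

lemma parts_u_z:
  assumes "weight_deriv b b'" "t \<ge> 0"
  shows "weighted_inner b (u t) (z t) = - complex_of_real (b 0) * (cnj (Q t) * w t 0) - weighted_inner b' (u t) (w t) - weighted_inner b (w t) (w t)"
  using weighted_inner_integration_by_parts[OF assms(1) AC_u L2_members(1) L2_members(2) AC_w L2_members(2) L2_members(3)] assms(2) bdry by simp

text \<open>Integration by parts returns the conjugate of the same pairing, so twice its real part
  is determined; this integrates b times the derivative of |w|^2.\<close>

lemma parts_w_z:
  assumes "weight_deriv b b'" "t \<ge> 0"
  shows "2 * Re (weighted_inner b (w t) (z t)) = - b 0 * (cmod (w t 0))\<^sup>2 - kin b' t"
proof -
  have "weighted_inner b (w t) (z t) = - complex_of_real (b 0) * (cnj (w t 0) * w t 0) - weighted_inner b' (w t) (w t) - weighted_inner b (z t) (w t)"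
    using assms(2) by (intro weighted_inner_integration_by_parts assms(1) AC_w L2_members)
  then have "Re (weighted_inner b (w t) (z t)) = - b 0 * Re (cnj (w t 0) * w t 0) - kin b' t - Re (weighted_inner b (w t) (z t))"
    using Re_weighted_inner_commute[of b "z t" "w t"] by (simp add: kin_def)
  moreover have "Re (cnj (w t 0) * w t 0) = (cmod (w t 0))\<^sup>2"
    unfolding cmod_power2 by (simp add: power2_eq_square)
  ultimately show ?thesis by simp
qed

text \<open>The left integrand is b times the derivative of |u|^4. Writing |u|^4 as r^2 with r =
  |u|^2 reduces this to integration by parts of r against itself; boundedness of \<open>u\<close>
  puts r and its derivative into \<open>L2\<close>.\<close>

lemma parts_cub_w:
  assumes b: "weight_deriv b b'" and t: "t \<ge> 0"
  shows "4 * Re (weighted_inner b (cub t) (w t)) = - b 0 * cmod (Q t) ^ 4 - quart b' t"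
proof -
  have bw: "bdd_weight b" "bdd_weight b'" using b by (auto simp: weight_deriv_def)
  obtain M where M: "\<forall>x\<ge>0. cmod (u t x) \<le> M" using u_bounded t by blast
  define r where "r x = u t x * cnj (u t x)" for x
  define r' where "r' x = w t x * cnj (u t x) + cnj (w t x) * u t x" for x
  have ac: "AC_deriv r r'"
    unfolding r_def[abs_def] r'_def[abs_def] by (intro AC_deriv_mult AC_deriv_cnj AC_u t)
  have m: "(\<lambda>x. cnj (u t x)) \<in> borel_measurable halfline" by (intro cnj_measurable u_measurable t)
  have L: "r \<in> L2" "r' \<in> L2"
  proof -
    have "(\<lambda>x. cnj (u t x) * u t x) \<in> L2"
      using M by (intro L2_bounded_mult[where C = M] L2_members t m) auto
    then show "r \<in> L2" by (simp add: r_def[abs_def] mult.commute)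
    have "(\<lambda>x. cnj (u t x) * w t x + u t x * cnj (w t x)) \<in> L2"
      using M by (intro L2_add L2_bounded_mult[where C = M] L2_cnj L2_members t m u_measurable) auto
    then show "r' \<in> L2" by (simp add: r'_def[abs_def] mult.commute)
  qed
  have "weighted_inner b r r' = - complex_of_real (b 0) * (cnj (r 0) * r 0) - weighted_inner b' r r - weighted_inner b r' r"
    by (rule weighted_inner_integration_by_parts[OF b ac L ac L])
  then have "2 * Re (weighted_inner b r r') = - b 0 * Re (cnj (r 0) * r 0) - Re (weighted_inner b' r r)"
    using Re_weighted_inner_commute[of b r' r] by simp
  moreover have r4: "Re (cnj (r x) * r x) = cmod (u t x) ^ 4" for x
  proof -
    have "Re (cnj (r x) * r x) = (cmod (r x))\<^sup>2" unfolding cmod_power2 by (simp add: power2_eq_square)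
    also have "cmod (r x) = (cmod (u t x))\<^sup>2" by (simp add: r_def norm_mult power2_eq_square)
    finally show ?thesis by simp
  qed
  moreover have "Re (weighted_inner b' r r) = quart b' t"
    unfolding Re_weighted_inner(1)[OF bw(2) L(1) L(1)] r4 quart_eq(1)[OF bw(2) t] ..
  moreover have "Re (weighted_inner b r r') = 2 * Re (weighted_inner b (cub t) (w t))"
  proof -
    have "Re (cnj (r x) * r' x) = 2 * Re (cnj (cub t x) * w t x)" for x
    proof -
      have "r x = complex_of_real ((cmod (u t x))\<^sup>2)"
        by (simp only: r_def complex_norm_square)
      then show ?thesis by (simp add: r'_def cub_def algebra_simps del: of_real_power)
    qed
    then have "Re (weighted_inner b r r') = (LINT x|halfline. 2 * (b x * Re (cnj (cub t x) * w t x)))"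
      unfolding Re_weighted_inner(1)[OF bw(1) L] by (simp add: mult_ac)
    also have "\<dots> = 2 * Re (weighted_inner b (cub t) (w t))"
      unfolding Re_weighted_inner(1)[OF bw(1) cub_L2[OF t] L2_members(2)[OF t]] by (rule integral_mult_right_zero)
    finally show ?thesis .
  qed
  ultimately show ?thesis using bdry[OF t] by simp
qed

section \<open>Balance laws for mass, momentum and energy\<close>

text \<open>The nonlinearity drops out because its pairing with \<open>u\<close> is real, and the
  gradient term because the pairing of \<open>w\<close> with itself is real.\<close>

lemma mass_has_derivative:
  assumes b: "weight_deriv b b'" and t: "t > 0"
  shows "(mass b has_real_derivative 2 * mom b' t + 2 * b 0 * Im (cnj (Q t) * w t 0)) (at t)"
proof -
  have bw: "bdd_weight b" using b by (auto simp: weight_deriv_def)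
  have t0: "t \<ge> 0" using t by simp
  have "(mass b has_real_derivative Re (weighted_inner b (v t) (u t) + weighted_inner b (u t) (v t))) (at t)"
    unfolding mass_def[abs_def] by (rule real_derivative_of_complex(1)[OF weighted_inner_uu_has_derivative[OF bw t0] t])
  moreover have "Re (weighted_inner b (v t) (u t) + weighted_inner b (u t) (v t)) = 2 * mom b' t + 2 * b 0 * Im (cnj (Q t) * w t 0)"
    using Re_weighted_inner_commute[of b "v t" "u t"] weighted_inner_v(1)[OF bw t L2_members(1)[OF t0]] parts_u_z[OF b t0]
      quart_eq(3)[OF bw t0] weighted_inner_self_real[of b "w t"]
    by (simp add: mom_def)
  ultimately show ?thesis by simp
qed

text \<open>Used with two weights: for b = 1 the terms with derivatives of b vanish and |q_x(0,t)|^2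
  appears with coefficient 1, while for \<open>virial1\<close> the weight is 0 at x = 0 and this
  quadratic boundary term disappears.\<close>

lemma mom_has_derivative:
  assumes b: "weight_deriv b b'" "weight_deriv b' b''" and t: "t > 0"
  shows "(mom b has_real_derivative b 0 * ((cmod (w t 0))\<^sup>2 - cmod (Q t) ^ 4 - Im (cnj (Q t) * Q' t))
     + b' 0 * Re (cnj (Q t) * w t 0) + 2 * kin b' t + quart b' t + Re (weighted_inner b'' (u t) (w t))) (at t)"
proof -
  have bw: "bdd_weight b" "bdd_weight b'" using b by (auto simp: weight_deriv_def)
  have t0: "t \<ge> 0" using t by simp
  let ?D = "weighted_inner b (v t) (w t) - complex_of_real (b 0) * cnj (Q t) * Q' t - weighted_inner b' (u t) (v t) - weighted_inner b (w t) (v t)"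
  have "(mom b has_real_derivative Im ?D) (at t)"
    unfolding mom_def[abs_def] by (rule real_derivative_of_complex(2)[OF weighted_inner_uw_has_derivative[OF b(1) t0] t])
  moreover have "Im ?D = b 0 * ((cmod (w t 0))\<^sup>2 - cmod (Q t) ^ 4 - Im (cnj (Q t) * Q' t))
     + b' 0 * Re (cnj (Q t) * w t 0) + 2 * kin b' t + quart b' t + Re (weighted_inner b'' (u t) (w t))"
  proof -
    have 1: "Im (weighted_inner b (w t) (v t)) = Re (weighted_inner b (w t) (z t)) - 2 * Re (weighted_inner b (cub t) (w t))"
      using weighted_inner_v(1)[OF bw(1) t L2_members(2)[OF t0]] Re_weighted_inner_commute[of b "cub t" "w t"] by simp
    have 2: "Im (weighted_inner b' (u t) (v t)) = - b' 0 * Re (cnj (Q t) * w t 0) - Re (weighted_inner b'' (u t) (w t)) - kin b' t - 2 * quart b' t"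
      using weighted_inner_v(1)[OF bw(2) t L2_members(1)[OF t0]] parts_u_z[OF b(2) t0] quart_eq(3)[OF bw(2) t0]
      by (simp add: kin_def)
    have "Im ?D = - 2 * Im (weighted_inner b (w t) (v t)) - b 0 * Im (cnj (Q t) * Q' t) - Im (weighted_inner b' (u t) (v t))"
      using Im_weighted_inner_commute[of b "v t" "w t"] by (simp add: mult.assoc)
    then show ?thesis
      unfolding 1 2 using parts_w_z[OF b(1) t0] parts_cub_w[OF b(1) t0] by (simp add: algebra_simps)
  qed
  ultimately show ?thesis by simp
qed

definition energy :: "real \<Rightarrow> real" where
  "energy t = kin (\<lambda>x. 1) t + quart (\<lambda>x. 1) t"

text \<open>Pairing the equation with \<open>v\<close> itself gives the cancellation: the pairing of
  \<open>v\<close> with \<open>v\<close> is real, so the contributions of \<open>z\<close> and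
  \<open>cub\<close> match, and only the boundary term with Q' is left.\<close>

lemma energy_has_derivative:
  assumes t: "t > 0"
  shows "(energy has_real_derivative - 2 * Re (cnj (Q' t) * w t 0)) (at t)"
proof -
  have t0: "t \<ge> 0" using t by simp
  let ?W = "weighted_inner (\<lambda>x. 1)"
  have "(kin (\<lambda>x. 1) has_real_derivative - 2 * Re (cnj (Q' t) * w t 0) - 2 * Re (?W (v t) (z t))) (at t)"
    using real_derivative_of_complex(1)[OF weighted_inner_ww_has_derivative[OF t0] t] by (simp add: kin_def[abs_def])
  moreover have "(quart (\<lambda>x. 1) has_real_derivative 4 * Re (?W (v t) (cub t))) (at t)"
    using quart_has_derivative[OF bdd_weight_const t0] t by (simp add: at_within_pos has_real_derivative_iff_has_vector_derivative)
  ultimately have "(energy has_real_derivative - 2 * Re (cnj (Q' t) * w t 0) - 2 * Re (?W (v t) (z t)) + 4 * Re (?W (v t) (cub t))) (at t)"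
    unfolding energy_def[abs_def] by (rule DERIV_add)
  moreover have "Re (?W (v t) (z t)) = 2 * Re (?W (v t) (cub t))"
  proof -
    have "Im (?W (v t) (v t)) = Re (?W (v t) (z t)) - 2 * Re (?W (v t) (cub t))"
      using weighted_inner_v(1)[OF bdd_weight_const t L2_members(4)[OF t0], of 1] by simp
    then show ?thesis using weighted_inner_self_real[of "\<lambda>x. 1" "v t"] by simp
  qed
  ultimately show ?thesis by simp
qed

section \<open>Continuity in time, bounds by unweighted functionals, and the boundary flux\<close>

lemma continuous_on_weighted_inner_functionals:
  assumes b: "bdd_weight b"
  shows "continuous_on {0..} (mass b)" "continuous_on {0..} (mom b)" "continuous_on {0..} (kin b)"
    "continuous_on {0..} (\<lambda>t. Re (weighted_inner b (u t) (w t)))"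
  unfolding continuous_on_def mass_def[abs_def] mom_def[abs_def] kin_def[abs_def]
  by (auto intro!: tendsto_Re tendsto_Im weighted_inner_tendsto b u_tendsto w_tendsto)

lemma continuous_on_quart: "bdd_weight b \<Longrightarrow> continuous_on {0..} (quart b)"
  unfolding continuous_on_eq_continuous_within
  using quart_has_derivative has_vector_derivative_continuous by fastforce

lemma continuous_on_energy: "continuous_on {0..} energy"
  unfolding energy_def[abs_def]
  by (intro continuous_intros continuous_on_quart continuous_on_weighted_inner_functionals(3) bdd_weight_const)

lemma continuous_on_w0: "continuous_on {0..} (\<lambda>t. w t 0)"
  unfolding continuous_on_def by (auto intro!: w0_tendsto)

text \<open>Pointwise AM-GM. The last bound keeps the factor 1/2, since with C = 1 it is exactly
  what lets (mass + energy)/2 absorb the momentum.\<close>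

lemma Re_weighted_inner_abs_le:
  assumes b: "bdd_weight b" "\<And>x. \<bar>b x\<bar> \<le> C" and t: "t \<ge> 0"
  shows "\<bar>kin b t\<bar> \<le> C * kin (\<lambda>x. 1) t" "\<bar>quart b t\<bar> \<le> C * quart (\<lambda>x. 1) t"
    "\<bar>Re (weighted_inner b (u t) (w t))\<bar> \<le> C * (mass (\<lambda>x. 1) t + kin (\<lambda>x. 1) t)"
    "\<bar>Im (weighted_inner b (u t) (w t))\<bar> \<le> C * ((mass (\<lambda>x. 1) t + kin (\<lambda>x. 1) t) / 2)"
proof -
  have C0: "0 \<le> C" using b(2)[of 0] by linarith
  have mul: "\<bar>b x * r\<bar> \<le> C * \<bar>r\<bar>" for x r using b(2) by (simp add: abs_mult mult_right_mono)
  note i1 = bdd_weight_const[of 1]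
  have sq: "Re (cnj y * y) = (cmod y)\<^sup>2" for y unfolding cmod_power2 by (simp add: power2_eq_square)
  have kin: "kin b t = (LINT x|halfline. b x * (cmod (w t x))\<^sup>2)" if "bdd_weight b" for b
    using Re_weighted_inner(1)[OF that L2_members(2)[OF t] L2_members(2)[OF t]] by (simp only: kin_def sq)
  have mass: "mass b t = (LINT x|halfline. b x * (cmod (u t x))\<^sup>2)" if "bdd_weight b" for b
    using Re_weighted_inner(1)[OF that L2_members(1)[OF t] L2_members(1)[OF t]] by (simp only: mass_def sq)
  have iw: "integrable halfline (\<lambda>x. (cmod (w t x))\<^sup>2)" and iu: "integrable halfline (\<lambda>x. (cmod (u t x))\<^sup>2)"
    using L2_members t L2_integrable by auto
  have *: "\<bar>LINT x|halfline. p x\<bar> \<le> C * (LINT x|halfline. q x)"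
    if "integrable halfline p" "integrable halfline q" "\<And>x. \<bar>p x\<bar> \<le> C * q x" for p q :: "real \<Rightarrow> real"
  proof -
    have "\<bar>LINT x|halfline. p x\<bar> \<le> (LINT x|halfline. \<bar>p x\<bar>)" by (rule integral_abs_bound)
    also have "\<dots> \<le> (LINT x|halfline. C * q x)"
      using that by (intro integral_mono) auto
    finally show ?thesis by simp
  qed
  show "\<bar>kin b t\<bar> \<le> C * kin (\<lambda>x. 1) t"
    unfolding kin[OF b(1)] kin[OF i1] mult_1_left
    using Re_weighted_inner(2)[OF b(1) L2_members(2)[OF t] L2_members(2)[OF t]] iw mul[of _ "(cmod _)\<^sup>2"] by (intro *) (auto simp only: sq abs_power2)
  show "\<bar>quart b t\<bar> \<le> C * quart (\<lambda>x. 1) t"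
  proof -
    have "integrable halfline (\<lambda>x. cmod (u t x) ^ 4)" using quart_eq(2)[OF i1 t] by simp
    then show ?thesis
      unfolding quart_eq(1)[OF b(1) t] quart_eq(1)[OF i1 t] mult_1_left
      using quart_eq(2)[OF b(1) t] mul[of _ "cmod _ ^ 4"] by (intro *) auto
  qed
  have mk: "(LINT x|halfline. (cmod (u t x))\<^sup>2 + (cmod (w t x))\<^sup>2) = mass (\<lambda>x. 1) t + kin (\<lambda>x. 1) t"
    unfolding kin[OF i1] mass[OF i1] mult_1_left by (rule Bochner_Integration.integral_add[OF iu iw])
  have cw: "cmod (cnj y * y') \<le> ((cmod y)\<^sup>2 + (cmod y')\<^sup>2) / 2" for y y'
    using sum_squares_bound[of "cmod y" "cmod y'"] by (simp add: norm_mult)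
  have "\<bar>b x * Re (cnj (u t x) * w t x)\<bar> \<le> C * (((cmod (u t x))\<^sup>2 + (cmod (w t x))\<^sup>2) / 2)" for x
    by (rule order.trans[OF mul mult_left_mono[OF order.trans[OF abs_Re_le_cmod cw] C0]])
  then have "\<bar>Re (weighted_inner b (u t) (w t))\<bar> \<le> C * (LINT x|halfline. ((cmod (u t x))\<^sup>2 + (cmod (w t x))\<^sup>2) / 2)"
    unfolding Re_weighted_inner(1)[OF b(1) L2_members(1)[OF t] L2_members(2)[OF t]]
    using Re_weighted_inner(2)[OF b(1) L2_members(1)[OF t] L2_members(2)[OF t]] iu iw by (intro *) auto
  moreover have mk0: "0 \<le> mass (\<lambda>x. 1) t + kin (\<lambda>x. 1) t"
    unfolding mk[symmetric] by (intro Bochner_Integration.integral_nonneg) auto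
  then have "C * ((mass (\<lambda>x. 1) t + kin (\<lambda>x. 1) t) / 2) \<le> C * (mass (\<lambda>x. 1) t + kin (\<lambda>x. 1) t)"
    using C0 by (intro mult_left_mono) auto
  ultimately show "\<bar>Re (weighted_inner b (u t) (w t))\<bar> \<le> C * (mass (\<lambda>x. 1) t + kin (\<lambda>x. 1) t)"
    using mk by simp
  have "\<bar>b x * Im (cnj (u t x) * w t x)\<bar> \<le> C * (((cmod (u t x))\<^sup>2 + (cmod (w t x))\<^sup>2) / 2)" for x
    by (rule order.trans[OF mul mult_left_mono[OF order.trans[OF abs_Im_le_cmod cw] C0]])
  then have "\<bar>Im (weighted_inner b (u t) (w t))\<bar> \<le> C * (LINT x|halfline. ((cmod (u t x))\<^sup>2 + (cmod (w t x))\<^sup>2) / 2)"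
    unfolding Im_weighted_inner(1)[OF b(1) L2_members(1)[OF t] L2_members(2)[OF t]]
    using Im_weighted_inner(2)[OF b(1) L2_members(1)[OF t] L2_members(2)[OF t]] iu iw by (intro *) auto
  then show "\<bar>Im (weighted_inner b (u t) (w t))\<bar> \<le> C * ((mass (\<lambda>x. 1) t + kin (\<lambda>x. 1) t) / 2)"
    using mk by simp
qed

lemma quart_nonneg: "t \<ge> 0 \<Longrightarrow> 0 \<le> quart (\<lambda>x. 1) t"
  using Re_weighted_inner_abs_le(2)[OF bdd_weight_const[of 1], of 1 t] by simp

lemma continuous_on_Q: "continuous_on {0..} Q"
  unfolding continuous_on_eq_continuous_within
  using Q_deriv has_vector_derivative_continuous by fastforce

text \<open>The momentum law produces the square of q_x(0,t), whereas the mass and energy laws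
  contain it only linearly. Combining the three in one functional of known sign avoids the circle of
  bounding mass and energy by the flux and the flux by mass and energy.\<close>

lemma boundary_flux_bounded:
  assumes Q': "continuous_on {0..} Q'"
    and B: "\<And>t. t \<ge> 0 \<Longrightarrow> integral {0..t} (\<lambda>s. cmod (Q s) ^ 4 + 2 * (cmod (Q s))\<^sup>2 + 2 * (cmod (Q' s))\<^sup>2) \<le> B"
  obtains K where "\<And>t. t \<ge> 0 \<Longrightarrow> integral {0..t} (\<lambda>s. (cmod (w s 0))\<^sup>2) \<le> K"
proof -
  let ?one = "\<lambda>x::real. 1::real"
  let ?b = "\<lambda>s. cmod (Q s) ^ 4 + 2 * (cmod (Q s))\<^sup>2 + 2 * (cmod (Q' s))\<^sup>2"
  have cont: "continuous_on {0..} (\<lambda>s. (cmod (w s 0))\<^sup>2)" "continuous_on {0..} ?b"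
    by (intro continuous_intros continuous_on_w0 continuous_on_Q Q')+
  \<comment> \<open>Momentum minus its AM-GM majorant; the quartic part of the energy is
    nonnegative, so \<Psi> \<le> 0 at all times.\<close>
  define \<Psi> where "\<Psi> t = mom ?one t - (mass ?one t + energy t) / 2" for t
  have w1: "weight_deriv ?one (\<lambda>x. 0)" "weight_deriv (\<lambda>x. 0) (\<lambda>x. 0)" by (rule weight_deriv_const)+
  have zero: "mom (\<lambda>x. 0) t = 0" "kin (\<lambda>x. 0) t = 0" "quart (\<lambda>x. 0) t = 0" "weighted_inner (\<lambda>x. 0) f h = 0" for t f h
    by (simp_all add: mom_def kin_def quart_def weighted_inner_def)
  have \<Psi>c: "continuous_on {0..} \<Psi>"
    unfolding \<Psi>_def[abs_def]
    by (intro continuous_intros continuous_on_weighted_inner_functionals continuous_on_energy bdd_weight_const) simp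
  have \<Psi>_le: "\<Psi> t \<le> 0" if t: "t \<ge> 0" for t
  proof -
    have "mom ?one t \<le> (mass ?one t + kin ?one t) / 2"
      using Re_weighted_inner_abs_le(4)[OF bdd_weight_const[of 1], of 1 t] t by (simp add: mom_def)
    then show ?thesis using quart_nonneg[OF t] by (simp add: \<Psi>_def energy_def)
  qed
  have "integral {0..t} (\<lambda>s. (cmod (w s 0))\<^sup>2) \<le> 2 * (B - \<Psi> 0)" if t: "t \<ge> 0" for t
  proof -
    let ?G = "\<lambda>t. integral {0..t} (\<lambda>s. (cmod (w s 0))\<^sup>2) / 2 - integral {0..t} ?b"
    have "?G t - ?G 0 \<le> \<Psi> t - \<Psi> 0"
    proof (rule derivative_comparison[OF t])
      show "continuous_on {0..t} ?G"
        by (intro continuous_intros continuous_on_subset[OF integral_upto_has_derivative(2)] cont) auto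
      show "continuous_on {0..t} \<Psi>" by (rule continuous_on_subset[OF \<Psi>c]) auto
      fix s assume s: "0 < s" "s < t"
      show "(?G has_real_derivative (cmod (w s 0))\<^sup>2 / 2 - ?b s) (at s)"
        by (intro DERIV_diff DERIV_cdivide integral_upto_has_derivative(1) cont s)
      let ?g = "w s 0"
      let ?D = "((cmod ?g)\<^sup>2 - cmod (Q s) ^ 4 - Im (cnj (Q s) * Q' s)) - (2 * Im (cnj (Q s) * ?g) + - 2 * Re (cnj (Q' s) * ?g)) / 2"
      have d: "(mom ?one has_real_derivative ((cmod ?g)\<^sup>2 - cmod (Q s) ^ 4 - Im (cnj (Q s) * Q' s))) (at s)"
        "(mass ?one has_real_derivative 2 * Im (cnj (Q s) * ?g)) (at s)"
        using mom_has_derivative[OF w1 s(1)] mass_has_derivative[OF w1(1) s(1)] by (simp_all only: zero) simp_all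
      show "(\<Psi> has_real_derivative ?D) (at s)"
        unfolding \<Psi>_def[abs_def]
        by (intro DERIV_diff DERIV_cdivide DERIV_add d energy_has_derivative s(1))
      \<comment> \<open>Each of the two cross terms containing q_x(0,s) costs a quarter of its
        square, so half of the square survives; the remaining costs add up to the coefficients 1, 2,
        2 in \<open>?b\<close>.\<close>
      have arith: "g2 / 2 - (q4 + 2 * q2 + 2 * r2) \<le> (g2 - q4 - A) - (2 * B + - 2 * C) / 2"
        if "A \<le> x" "B \<le> y" "- C \<le> y'" "x \<le> q2 + r2" "y \<le> q2 + g2 / 4" "y' \<le> r2 + g2 / 4"
        for A B C x y y' g2 q2 q4 r2 :: real
        using that by (simp add: field_simps)
      have "Im (cnj (Q s) * Q' s) \<le> cmod (Q s) * cmod (Q' s)"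
        "Im (cnj (Q s) * ?g) \<le> cmod (Q s) * cmod ?g"
        "- Re (cnj (Q' s) * ?g) \<le> cmod (Q' s) * cmod ?g"
        using abs_Im_le_cmod[of "cnj (Q s) * Q' s"] abs_Im_le_cmod[of "cnj (Q s) * ?g"] abs_Re_le_cmod[of "cnj (Q' s) * ?g"]
        unfolding norm_mult complex_mod_cnj by linarith+
      moreover have "cmod (Q s) * cmod (Q' s) \<le> (cmod (Q s))\<^sup>2 + (cmod (Q' s))\<^sup>2"
        using sum_squares_bound[of "cmod (Q s)" "cmod (Q' s)"] mult_nonneg_nonneg[OF norm_ge_zero[of "Q s"] norm_ge_zero[of "Q' s"]]
        by linarith
      moreover have "cmod (Q s) * cmod ?g \<le> (cmod (Q s))\<^sup>2 + (cmod ?g)\<^sup>2 / 4"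
        using sum_squares_bound[of "cmod (Q s)" "cmod ?g / 2"] by (simp add: power_divide)
      moreover have "cmod (Q' s) * cmod ?g \<le> (cmod (Q' s))\<^sup>2 + (cmod ?g)\<^sup>2 / 4"
        using sum_squares_bound[of "cmod (Q' s)" "cmod ?g / 2"] by (simp add: power_divide)
      ultimately show "(cmod ?g)\<^sup>2 / 2 - ?b s \<le> ?D" by (rule arith)
    qed
    then have "integral {0..t} (\<lambda>s. (cmod (w s 0))\<^sup>2) / 2 \<le> integral {0..t} ?b + \<Psi> t - \<Psi> 0"
      by simp
    then show ?thesis using B[OF t] \<Psi>_le[OF t] by simp
  qed
  then show ?thesis using that by blast
qed

section \<open>The pseudoconformal estimate\<close>

text \<open>For the weight \<open>x\<^sup>2\<close> in place of \<open>virial e\<close> this is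
  \<open>\<integral> |x u + 2 \<i> t w|\<^sup>2 + 4 t\<^sup>2 |u|\<^sup>4\<close>, and \<open>virial_rem e\<close>, which collects the terms coming from
  \<open>virial2 e - 2\<close> and \<open>virial3 e\<close>, vanishes.\<close>

definition virial_energy :: "real \<Rightarrow> real \<Rightarrow> real" where
  "virial_energy e t = mass (virial e) t - 2 * t * mom (virial1 e) t + 4 * t\<^sup>2 * energy t"

definition virial_rem :: "real \<Rightarrow> real \<Rightarrow> real" where
  "virial_rem e t = 4 * t * (2 * kin (\<lambda>x. 1) t - kin (virial2 e) t)
     + 2 * t * (2 * quart (\<lambda>x. 1) t - quart (virial2 e) t) - 2 * t * Re (weighted_inner (virial3 e) (u t) (w t))"

text \<open>The factor -2t makes the \<open>virial1\<close> momenta cancel. For weight x^2 the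
  kinetic terms 8t and -8t cancel as well, and the quartic terms leave 8t - 4t = 4t. The values 0,
  0, 2 of the weights at x = 0 leave a single boundary term from the momentum law.\<close>

lemma virial_energy_has_derivative:
  assumes e: "e > 0" and t: "t > 0"
  shows "(virial_energy e has_real_derivative 4 * t * quart (\<lambda>x. 1) t + virial_rem e t
     - 4 * t * Re (cnj (Q t) * w t 0) - 8 * t\<^sup>2 * Re (cnj (Q' t) * w t 0)) (at t)"
proof -
  have z: "virial e 0 = 0" "virial1 e 0 = 0" "virial2 e 0 = 2"
    by (simp_all add: virial_def virial1_def virial2_def)
  define P where "P = 2 * Re (cnj (Q t) * w t 0) + 2 * kin (virial2 e) t + quart (virial2 e) t + Re (weighted_inner (virial3 e) (u t) (w t))"
  have d: "(mass (virial e) has_real_derivative 2 * mom (virial1 e) t) (at t)"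
    "(mom (virial1 e) has_real_derivative P) (at t)"
    using mass_has_derivative[OF virial_weight_deriv(1)[OF e] t]
      mom_has_derivative[OF virial_weight_deriv(2,3)[OF e] t] by (simp_all only: z P_def) simp_all
  have "(virial_energy e has_real_derivative
      2 * mom (virial1 e) t - (2 * mom (virial1 e) t + P * (2 * t))
      + (8 * t * energy t + (- 2 * Re (cnj (Q' t) * w t 0)) * (4 * t\<^sup>2))) (at t)"
    unfolding virial_energy_def[abs_def]
    by (intro DERIV_add DERIV_diff DERIV_mult d energy_has_derivative t)
       (auto intro!: derivative_eq_intros)
  moreover have "2 * mom (virial1 e) t - (2 * mom (virial1 e) t + P * (2 * t))
      + (8 * t * energy t + (- 2 * Re (cnj (Q' t) * w t 0)) * (4 * t\<^sup>2)) =
      4 * t * quart (\<lambda>x. 1) t + virial_rem e t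
       - 4 * t * Re (cnj (Q t) * w t 0) - 8 * t\<^sup>2 * Re (cnj (Q' t) * w t 0)"
    unfolding virial_rem_def energy_def P_def by (simp only: algebra_simps)
  ultimately show ?thesis by simp
qed

text \<open>Apart from the quartic term, the integrand is at least (sqrt b |u| - 2t |w|)^2 with b =
  \<open>virial e\<close>, because |b'| \<le> 2 sqrt b.\<close>

lemma virial_energy_lower_bound:
  assumes e: "e > 0" and t: "t \<ge> 0"
  shows "4 * t\<^sup>2 * quart (\<lambda>x. 1) t \<le> virial_energy e t"
proof -
  note b = virial_bdd_weight[OF e] and L = L2_members(1,2)[OF t]
  have sq: "Re (cnj y * y) = (cmod y)\<^sup>2" for y unfolding cmod_power2 by (simp add: power2_eq_square)
  note i = Re_weighted_inner(2)[OF b(1) L(1) L(1)] Im_weighted_inner(2)[OF b(2) L] Re_weighted_inner(2)[OF bdd_weight_const[of 1] L(2) L(2)]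
  have "mass (virial e) t - 2 * t * mom (virial1 e) t + 4 * t\<^sup>2 * kin (\<lambda>x. 1) t =
     (LINT x|halfline. virial e x * Re (cnj (u t x) * u t x) - 2 * t * (virial1 e x * Im (cnj (u t x) * w t x))
        + 4 * t\<^sup>2 * (1 * Re (cnj (w t x) * w t x)))"
    unfolding mass_def mom_def kin_def Re_weighted_inner(1)[OF b(1) L(1) L(1)] Im_weighted_inner(1)[OF b(2) L] Re_weighted_inner(1)[OF bdd_weight_const[of 1] L(2) L(2)]
    using i by (simp add: Bochner_Integration.integral_diff Bochner_Integration.integral_add)
  also have "\<dots> \<ge> 0"
  proof (rule Bochner_Integration.integral_nonneg)
    fix x
    let ?s = "sqrt (virial e x)" and ?u = "cmod (u t x)" and ?w = "cmod (w t x)"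
    have v0: "virial e x \<ge> 0" by (simp add: virial_def)
    have "virial1 e x * Im (cnj (u t x) * w t x) \<le> \<bar>virial1 e x\<bar> * \<bar>Im (cnj (u t x) * w t x)\<bar>"
      by (metis abs_ge_self abs_mult)
    also have "\<dots> \<le> (2 * ?s) * (?u * ?w)"
      using virial1_le[OF e] abs_Im_le_cmod[of "cnj (u t x) * w t x"] v0
      by (intro mult_mono) (auto simp: norm_mult)
    finally have "2 * t * (virial1 e x * Im (cnj (u t x) * w t x)) \<le> 2 * t * ((2 * ?s) * (?u * ?w))"
      using t by (intro mult_left_mono) auto
    moreover have "0 \<le> (?s * ?u - 2 * t * ?w)\<^sup>2" by simp
    moreover have "(?s * ?u - 2 * t * ?w)\<^sup>2 = virial e x * ?u\<^sup>2 - 2 * t * ((2 * ?s) * (?u * ?w)) + 4 * t\<^sup>2 * ?w\<^sup>2"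
      using v0 by (simp add: power2_diff power_mult_distrib)
    ultimately show "0 \<le> virial e x * Re (cnj (u t x) * u t x) - 2 * t * (virial1 e x * Im (cnj (u t x) * w t x))
        + 4 * t\<^sup>2 * (1 * Re (cnj (w t x) * w t x))"
      unfolding sq by simp
  qed
  finally show ?thesis
    unfolding virial_energy_def energy_def by (simp add: algebra_simps)
qed

lemma continuous_on_virial:
  assumes e: "e > 0"
  shows "continuous_on {0..} (virial_energy e)" "continuous_on {0..} (virial_rem e)"
  unfolding virial_energy_def[abs_def] virial_rem_def[abs_def]
  by (intro continuous_intros continuous_on_weighted_inner_functionals continuous_on_energy continuous_on_quart
      virial_bdd_weight[OF e] bdd_weight_const)+

text \<open>The limit in e is taken in \<open>virial2\<close> and \<open>virial3\<close> only, which
  are uniformly bounded; the weights \<open>virial\<close> and \<open>virial1\<close> stay at fixed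
  e, so no moment of \<open>u\<close> in x has to be finite.\<close>

lemma virial_rem_tendsto:
  assumes t: "t \<ge> 0"
  shows "(\<lambda>n. virial_rem (inverse (real (Suc n))) t) \<longlonglongrightarrow> 0"
proof -
  let ?e = "\<lambda>n. inverse (real (Suc n))"
  have e0: "?e n > 0" "?e n \<le> 1" for n by (auto simp: field_simps)
  have e_lim: "?e \<longlonglongrightarrow> 0" by (rule LIMSEQ_inverse_real_of_nat)
  have l2: "(\<lambda>n. virial2 (?e n) x) \<longlonglongrightarrow> 2" for x
  proof -
    have "(\<lambda>n. virial2 (?e n) x) \<longlonglongrightarrow> 2 * cos (2 * (0 * x))"
      unfolding virial2_def by (intro tendsto_intros e_lim)
    then show ?thesis by simp
  qed
  have l3: "(\<lambda>n. virial3 (?e n) x) \<longlonglongrightarrow> 0" for x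
  proof -
    have "(\<lambda>n. virial3 (?e n) x) \<longlonglongrightarrow> - 4 * 0 * sin (2 * (0 * x))"
      unfolding virial3_def by (intro tendsto_intros e_lim)
    then show ?thesis by simp
  qed
  have b3: "\<bar>virial3 (?e n) x\<bar> \<le> 4" for n x
    using virial_bounds(4)[OF e0(1)[of n], of x] e0(2)[of n] by linarith
  have W2: "(\<lambda>n. weighted_inner (virial2 (?e n)) f h) \<longlonglongrightarrow> 2 * weighted_inner (\<lambda>x. 1) f h" if "f \<in> L2" "h \<in> L2" for f h
  proof -
    have "(\<lambda>n. weighted_inner (virial2 (?e n)) f h) \<longlonglongrightarrow> weighted_inner (\<lambda>x. 2 * 1) f h"
      by (rule weighted_inner_dominated_convergence[OF virial_bdd_weight(3)[OF e0(1)] bdd_weight_const virial_bounds(3)[OF e0(1)] _ that])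
         (use l2 in simp)
    then show ?thesis by (simp only: weighted_inner_weight_scale) simp
  qed
  have W3: "(\<lambda>n. weighted_inner (virial3 (?e n)) f h) \<longlonglongrightarrow> 0" if "f \<in> L2" "h \<in> L2" for f h
  proof -
    have "(\<lambda>n. weighted_inner (virial3 (?e n)) f h) \<longlonglongrightarrow> weighted_inner (\<lambda>x. 0) f h"
      by (rule weighted_inner_dominated_convergence[OF virial_bdd_weight(4)[OF e0(1)] bdd_weight_const b3 l3 that])
    then show ?thesis by (simp add: weighted_inner_def)
  qed
  have "(\<lambda>n. virial_rem (?e n) t) \<longlonglongrightarrow> 4 * t * (2 * kin (\<lambda>x. 1) t - Re (2 * weighted_inner (\<lambda>x. 1) (w t) (w t)))
     + 2 * t * (2 * quart (\<lambda>x. 1) t - Re (2 * weighted_inner (\<lambda>x. 1) (u t) (cub t))) - 2 * t * Re 0"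
    unfolding virial_rem_def kin_def[of "virial2 _"] quart_def[of "virial2 _"]
    by (intro tendsto_intros W2 W3 L2_members cub_L2 t)
  then show ?thesis by (simp add: kin_def quart_def)
qed

text \<open>A majorant independent of e and continuous in t, as needed to pass to the limit under
  the time integral.\<close>

lemma virial_rem_bound:
  assumes e: "0 < e" "e \<le> 1" and t: "t \<ge> 0"
  shows "\<bar>virial_rem e t\<bar> \<le> 8 * t * (mass (\<lambda>x. 1) t + 3 * kin (\<lambda>x. 1) t + quart (\<lambda>x. 1) t)"
proof -
  have b3: "\<bar>virial3 e x\<bar> \<le> 4" for x
    using virial_bounds(4)[OF e(1), of x] e(2) by linarith
  have arith: "\<bar>4 * (2 * k - k') + 2 * (2 * r - r') - 2 * p\<bar> \<le> 8 * (m + 3 * k + r)"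
    if "\<bar>k'\<bar> \<le> 2 * k" "\<bar>r'\<bar> \<le> 2 * r" "\<bar>p\<bar> \<le> 4 * (m + k)" for k k' r r' p m :: real
  proof -
    have "k' \<le> 2 * k" "- k' \<le> 2 * k" "r' \<le> 2 * r" "- r' \<le> 2 * r" "p \<le> 4 * (m + k)" "- p \<le> 4 * (m + k)"
      using that by (simp_all only: abs_le_iff)
    then show ?thesis
      by (intro abs_leI) (simp_all add: algebra_simps)
  qed
  have "\<bar>kin (virial2 e) t\<bar> \<le> 2 * kin (\<lambda>x. 1) t" "\<bar>quart (virial2 e) t\<bar> \<le> 2 * quart (\<lambda>x. 1) t"
    using Re_weighted_inner_abs_le(1,2)[OF virial_bdd_weight(3)[OF e(1)] virial_bounds(3)[OF e(1)] t] .
  moreover have "\<bar>Re (weighted_inner (virial3 e) (u t) (w t))\<bar> \<le> 4 * (mass (\<lambda>x. 1) t + kin (\<lambda>x. 1) t)"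
    using Re_weighted_inner_abs_le(3)[OF virial_bdd_weight(4)[OF e(1)] b3 t] .
  ultimately have "\<bar>4 * (2 * kin (\<lambda>x. 1) t - kin (virial2 e) t)
     + 2 * (2 * quart (\<lambda>x. 1) t - quart (virial2 e) t) - 2 * Re (weighted_inner (virial3 e) (u t) (w t))\<bar>
     \<le> 8 * (mass (\<lambda>x. 1) t + 3 * kin (\<lambda>x. 1) t + quart (\<lambda>x. 1) t)" by (rule arith)
  then have "t * \<bar>4 * (2 * kin (\<lambda>x. 1) t - kin (virial2 e) t)
     + 2 * (2 * quart (\<lambda>x. 1) t - quart (virial2 e) t) - 2 * Re (weighted_inner (virial3 e) (u t) (w t))\<bar>
     \<le> t * (8 * (mass (\<lambda>x. 1) t + 3 * kin (\<lambda>x. 1) t + quart (\<lambda>x. 1) t))"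
    using t by (rule mult_left_mono)
  moreover have "virial_rem e t = t * (4 * (2 * kin (\<lambda>x. 1) t - kin (virial2 e) t)
     + 2 * (2 * quart (\<lambda>x. 1) t - quart (virial2 e) t) - 2 * Re (weighted_inner (virial3 e) (u t) (w t)))"
    by (simp add: virial_rem_def algebra_simps)
  ultimately show ?thesis using t by (simp add: abs_mult mult_ac)
qed

text \<open>AM-GM bounds the boundary terms by 2 s^2 |Q|^2 + 2 |q_x|^2 and 4 s^4 |Q'|^2 + 4 |q_x|^2,
  whence the coefficient 6. Once the virial energy is replaced by its lower bound, e survives only
  in the remainder, and its time integral tends to 0.\<close>

lemma quart_integral_inequality:
  assumes ic: "\<And>x. x > 0 \<Longrightarrow> u 0 x = 0" and Q': "continuous_on {0..} Q'" and t: "t \<ge> 0"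
  shows "4 * t\<^sup>2 * quart (\<lambda>x. 1) t \<le> integral {0..t} (\<lambda>s. 4 * s * quart (\<lambda>x. 1) s
      + (2 * (s\<^sup>2 * (cmod (Q s))\<^sup>2) + 4 * (s ^ 4 * (cmod (Q' s))\<^sup>2) + 6 * (cmod (w s 0))\<^sup>2))"
    (is "_ \<le> integral _ ?h")
proof -
  let ?one = "\<lambda>x::real. 1::real"
  let ?e = "\<lambda>n. inverse (real (Suc n))"
  have e0: "?e n > 0" "?e n \<le> 1" for n by (auto simp: field_simps)
  have hc: "continuous_on {0..} ?h"
    by (intro continuous_intros continuous_on_quart bdd_weight_const continuous_on_Q Q' continuous_on_w0)
  have ineq: "4 * t\<^sup>2 * quart ?one t \<le> integral {0..t} ?h + integral {0..t} (virial_rem (?e n))" for n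
  proof -
    let ?r = "virial_rem (?e n)"
    have rc: "continuous_on {0..} ?r" by (rule continuous_on_virial(2)[OF e0(1)])
    let ?G = "\<lambda>t. integral {0..t} ?h + integral {0..t} ?r"
    have "virial_energy (?e n) t - virial_energy (?e n) 0 \<le> ?G t - ?G 0"
    proof (rule derivative_comparison[OF t])
      show "continuous_on {0..t} (virial_energy (?e n))"
        by (rule continuous_on_subset[OF continuous_on_virial(1)[OF e0(1)]]) auto
      show "continuous_on {0..t} ?G"
        by (intro continuous_intros continuous_on_subset[OF integral_upto_has_derivative(2)] hc rc) auto
      fix s assume s: "0 < s" "s < t"
      show "(?G has_real_derivative ?h s + ?r s) (at s)"
        by (intro DERIV_add integral_upto_has_derivative(1) hc rc s)
      show "(virial_energy (?e n) has_real_derivative 4 * s * quart ?one s + ?r s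
         - 4 * s * Re (cnj (Q s) * w s 0) - 8 * s\<^sup>2 * Re (cnj (Q' s) * w s 0)) (at s)"
        by (rule virial_energy_has_derivative[OF e0(1) s(1)])
      let ?g = "cmod (w s 0)"
      have "- (4 * s * Re (cnj (Q s) * w s 0)) \<le> 2 * (s\<^sup>2 * (cmod (Q s))\<^sup>2) + 2 * ?g\<^sup>2"
      proof -
        have "- Re (cnj (Q s) * w s 0) \<le> cmod (Q s) * ?g"
          using abs_Re_le_cmod[of "cnj (Q s) * w s 0"] unfolding norm_mult complex_mod_cnj by linarith
        then have "4 * s * (- Re (cnj (Q s) * w s 0)) \<le> 4 * s * (cmod (Q s) * ?g)"
          using s by (intro mult_left_mono) auto
        moreover have "4 * s * (cmod (Q s) * ?g) \<le> 2 * (s\<^sup>2 * (cmod (Q s))\<^sup>2) + 2 * ?g\<^sup>2"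
          using sum_squares_bound[of "s * cmod (Q s)" ?g] by (simp add: power_mult_distrib mult.assoc)
        ultimately show ?thesis
          unfolding mult_minus_right by (rule order.trans)
      qed
      moreover have "- (8 * s\<^sup>2 * Re (cnj (Q' s) * w s 0)) \<le> 4 * (s ^ 4 * (cmod (Q' s))\<^sup>2) + 4 * ?g\<^sup>2"
      proof -
        have "- Re (cnj (Q' s) * w s 0) \<le> cmod (Q' s) * ?g"
          using abs_Re_le_cmod[of "cnj (Q' s) * w s 0"] unfolding norm_mult complex_mod_cnj by linarith
        then have "8 * s\<^sup>2 * (- Re (cnj (Q' s) * w s 0)) \<le> 8 * s\<^sup>2 * (cmod (Q' s) * ?g)"
          by (intro mult_left_mono) auto
        moreover have "8 * s\<^sup>2 * (cmod (Q' s) * ?g) \<le> 4 * (s ^ 4 * (cmod (Q' s))\<^sup>2) + 4 * ?g\<^sup>2"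
          using sum_squares_bound[of "s\<^sup>2 * cmod (Q' s)" ?g] by (simp add: power_mult_distrib mult.assoc)
        ultimately show ?thesis
          unfolding mult_minus_right by (rule order.trans)
      qed
      ultimately show "4 * s * quart ?one s + ?r s
         - 4 * s * Re (cnj (Q s) * w s 0) - 8 * s\<^sup>2 * Re (cnj (Q' s) * w s 0) \<le> ?h s + ?r s"
        by linarith
    qed
    \<comment> \<open>At time 0 the factors t remove momentum and energy, and zero initial data
      remove the weighted mass.\<close>
    moreover have "virial_energy (?e n) 0 = 0"
    proof -
      have "mass (virial (?e n)) 0 = (LINT x|halfline. virial (?e n) x * Re (cnj (u 0 x) * u 0 x))"
        unfolding mass_def by (rule Re_weighted_inner(1)) (use virial_bdd_weight(1)[OF e0(1)] L2_members in auto)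
      also have "\<dots> = (LINT x|halfline. 0)"
        using ic by (intro Bochner_Integration.integral_cong) auto
      finally show ?thesis by (simp add: virial_energy_def)
    qed
    ultimately have "virial_energy (?e n) t \<le> ?G t" by simp
    then show ?thesis
      using virial_energy_lower_bound[OF e0(1) t, of n] by linarith
  qed
  have lim: "(\<lambda>n. integral {0..t} (virial_rem (?e n))) \<longlonglongrightarrow> integral {0..t} (\<lambda>s. 0)"
  proof (rule dominated_convergence(2))
    show "virial_rem (?e n) integrable_on {0..t}" for n
      by (intro integrable_continuous_real continuous_on_subset[OF continuous_on_virial(2)[OF e0(1)]]) auto
    have "continuous_on {0..} (\<lambda>s. 8 * s * (mass ?one s + 3 * kin ?one s + quart ?one s))"
      by (intro continuous_intros continuous_on_weighted_inner_functionals continuous_on_quart bdd_weight_const)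
    then show "(\<lambda>s. 8 * s * (mass ?one s + 3 * kin ?one s + quart ?one s)) integrable_on {0..t}"
      by (intro integrable_continuous_real) (auto elim: continuous_on_subset)
    show "norm (virial_rem (?e n) s) \<le> 8 * s * (mass ?one s + 3 * kin ?one s + quart ?one s)" if "s \<in> {0..t}" for n s
      using virial_rem_bound[OF e0, of s n] that by (simp del: of_nat_Suc)
    show "(\<lambda>n. virial_rem (?e n) s) \<longlonglongrightarrow> 0" if "s \<in> {0..t}" for s
      using virial_rem_tendsto that by simp
  qed
  have "(\<lambda>n. integral {0..t} ?h + integral {0..t} (virial_rem (?e n))) \<longlonglongrightarrow> integral {0..t} ?h + integral {0..t} (\<lambda>s. 0)"
    by (intro tendsto_intros lim)
  then show ?thesis
    using LIMSEQ_le_const[of _ _ "4 * t\<^sup>2 * quart ?one t"] ineq by fastforce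
qed

lemma quart_decay:
  assumes ic: "\<And>x. x > 0 \<Longrightarrow> u 0 x = 0" and Q': "continuous_on {0..} Q'"
    and \<alpha>: "\<alpha> > 3/2" "T > 0" "\<And>t. t \<ge> T \<Longrightarrow> cmod (Q t) \<le> C * t powr (- \<alpha>)"
    and \<beta>: "\<beta> > 5/2" "T' > 0" "\<And>t. t \<ge> T' \<Longrightarrow> cmod (Q' t) \<le> C' * t powr (- \<beta>)"
  shows "\<exists>c>0. \<forall>t\<ge>1. quart (\<lambda>x. 1) t \<le> c / t"
proof -
  let ?q = "quart (\<lambda>x. 1)"
  note bQ = bounded_weighted_integral_of_decay[OF continuous_on_Q \<alpha>(2,3)]
    and bQ' = bounded_weighted_integral_of_decay[OF Q' \<beta>(2,3)]
  obtain K1 where K1: "\<And>t. t \<ge> 0 \<Longrightarrow> integral {0..t} (\<lambda>s. s ^ 0 * cmod (Q s) ^ 4) \<le> K1"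
    by (rule bQ[of 4 0]) (use \<alpha>(1) in auto)
  obtain K2 where K2: "\<And>t. t \<ge> 0 \<Longrightarrow> integral {0..t} (\<lambda>s. s ^ 0 * cmod (Q s) ^ 2) \<le> K2"
    by (rule bQ[of 2 0]) (use \<alpha>(1) in auto)
  obtain K3 where K3: "\<And>t. t \<ge> 0 \<Longrightarrow> integral {0..t} (\<lambda>s. s ^ 0 * cmod (Q' s) ^ 2) \<le> K3"
    by (rule bQ'[of 2 0]) (use \<beta>(1) in auto)
  \<comment> \<open>Here and for \<open>K5\<close> the decay is used at its threshold: 2\<alpha> - 2
    > 1 and 2\<beta> - 4 > 1.\<close>
  obtain K4 where K4: "\<And>t. t \<ge> 0 \<Longrightarrow> integral {0..t} (\<lambda>s. s ^ 2 * cmod (Q s) ^ 2) \<le> K4"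
    by (rule bQ[of 2 2]) (use \<alpha>(1) in auto)
  obtain K5 where K5: "\<And>t. t \<ge> 0 \<Longrightarrow> integral {0..t} (\<lambda>s. s ^ 4 * cmod (Q' s) ^ 2) \<le> K5"
    by (rule bQ'[of 2 4]) (use \<beta>(1) in auto)
  have io: "f integrable_on {0..t}" if "continuous_on {0..} f" for f :: "real \<Rightarrow> real" and t
    by (intro integrable_continuous_real continuous_on_subset[OF that]) auto
  note ci = continuous_intros continuous_on_Q Q' continuous_on_w0 continuous_on_quart bdd_weight_const
  have "integral {0..t} (\<lambda>s. cmod (Q s) ^ 4 + 2 * (cmod (Q s))\<^sup>2 + 2 * (cmod (Q' s))\<^sup>2) \<le> K1 + 2 * K2 + 2 * K3" if "t \<ge> 0" for t
  proof -
    have "integral {0..t} (\<lambda>s. cmod (Q s) ^ 4 + 2 * (cmod (Q s))\<^sup>2 + 2 * (cmod (Q' s))\<^sup>2) =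
      integral {0..t} (\<lambda>s. cmod (Q s) ^ 4) + 2 * integral {0..t} (\<lambda>s. (cmod (Q s))\<^sup>2) + 2 * integral {0..t} (\<lambda>s. (cmod (Q' s))\<^sup>2)"
      by (subst Henstock_Kurzweil_Integration.integral_add; (intro io ci)?)+ simp
    then show ?thesis using K1[OF that] K2[OF that] K3[OF that] by simp
  qed
  then obtain K6 where K6: "\<And>t. t \<ge> 0 \<Longrightarrow> integral {0..t} (\<lambda>s. (cmod (w s 0))\<^sup>2) \<le> K6"
    using boundary_flux_bounded[OF Q'] by blast
  define K where "K = 2 * K4 + 4 * K5 + 6 * K6"
  define J where "J t = integral {0..t} (\<lambda>s. 4 * s * ?q s)" for t
  have qc: "continuous_on {0..} (\<lambda>s. 4 * s * ?q s)" by (intro ci)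
  have ineq: "4 * t\<^sup>2 * ?q t \<le> K + J t" if t: "t \<ge> 0" for t
  proof -
    have "4 * t\<^sup>2 * ?q t \<le> integral {0..t} (\<lambda>s. 4 * s * ?q s
      + (2 * (s\<^sup>2 * (cmod (Q s))\<^sup>2) + 4 * (s ^ 4 * (cmod (Q' s))\<^sup>2) + 6 * (cmod (w s 0))\<^sup>2))"
      by (rule quart_integral_inequality[OF ic Q' t])
    also have "\<dots> = J t + (2 * integral {0..t} (\<lambda>s. s\<^sup>2 * (cmod (Q s))\<^sup>2) + 4 * integral {0..t} (\<lambda>s. s ^ 4 * (cmod (Q' s))\<^sup>2)
        + 6 * integral {0..t} (\<lambda>s. (cmod (w s 0))\<^sup>2))"
      unfolding J_def
      by (subst Henstock_Kurzweil_Integration.integral_add; (intro io ci)?)+ simp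
    also have "\<dots> \<le> J t + K"
      unfolding K_def using K4[OF t] K5[OF t] K6[OF t] by simp
    finally show ?thesis by simp
  qed
  \<comment> \<open>The quarter undoes the factor 4 in \<open>ineq\<close>; the summand 1 makes the
    constant strictly positive.\<close>
  define c where "c = \<bar>K + J 1\<bar> / 4 + 1"
  have "?q t \<le> c / t" if t: "t \<ge> 1" for t
  proof -
    \<comment> \<open>Gronwall in explicit form: \<open>ineq\<close> says that s J'(s) \<le> K +
      J(s), so (K + J)/s is nonincreasing. Starting at time 1 keeps the quotient finite.\<close>
    have "(K + J t) / t - (K + J 1) / 1 \<le> 0 - 0"
    proof (rule derivative_comparison[OF t, where g = "\<lambda>_. 0" and g' = "\<lambda>_. 0"])
      show "continuous_on {1..t} (\<lambda>t. (K + J t) / t)"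
        unfolding J_def by (intro continuous_intros continuous_on_subset[OF integral_upto_has_derivative(2)[OF qc]]) auto
      fix s :: real assume s: "1 < s" "s < t"
      have "(J has_real_derivative 4 * s * ?q s) (at s)"
        unfolding J_def[abs_def] using s by (intro integral_upto_has_derivative(1) qc) auto
      then show "((\<lambda>t. (K + J t) / t) has_real_derivative (4 * s\<^sup>2 * ?q s - (K + J s)) / s\<^sup>2) (at s)"
        using s by (auto intro!: derivative_eq_intros simp: power2_eq_square field_simps)
      show "(4 * s\<^sup>2 * ?q s - (K + J s)) / s\<^sup>2 \<le> 0"
        using ineq[of s] s by (intro divide_nonpos_nonneg) auto
    qed auto
    then have "K + J t \<le> (K + J 1) * t"
      using t by (simp add: field_simps)
    also have "\<dots> \<le> \<bar>K + J 1\<bar> * t"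
      using t by (intro mult_right_mono) auto
    finally have "4 * t\<^sup>2 * ?q t \<le> \<bar>K + J 1\<bar> * t" using ineq[of t] t by linarith
    then have "4 * (t * ?q t) \<le> \<bar>K + J 1\<bar>"
      using t by (simp add: power2_eq_square mult.assoc)
    then have "t * ?q t \<le> c" by (simp add: c_def)
    then show ?thesis using t by (simp add: field_simps)
  qed
  moreover have "c > 0" by (simp add: c_def add_nonneg_pos)
  ultimately show ?thesis by blast
qed

end

section \<open>From the solution class to the locale, and the conclusion\<close>

text \<open>Continuity of each q(.,t) on [0,\<infinity>) lets \<open>H2_AC\<close> represent the
  function itself and not merely one equal to it almost everywhere; hence Q(t) really is the
  boundary term in the integrations by parts.\<close>

lemma defocusing_NLS_solution_nls_flow:
  assumes sol: "defocusing_NLS_solution Q q"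
    and Q: "\<And>t. t \<ge> 0 \<Longrightarrow> (Q has_vector_derivative Q' t) (at t within {0..})"
  obtains w z v where "nls_flow (\<lambda>t x. q x t) w z v Q Q'"
proof -
  define u where "u t x = q x t" for t x
  obtain v where v: "C1_L2_curve u v"
    and eq: "\<And>t. t > 0 \<Longrightarrow> AE x in halfline. \<i> * v t x + weak_deriv (weak_deriv (u t)) x
             - 2 * complex_of_real ((cmod (u t x))\<^sup>2) * u t x = 0"
    and H: "C0_curve H2 H2_norm u" and cont: "\<And>t. t \<ge> 0 \<Longrightarrow> continuous_on {0..} (u t)"
    and bd: "\<And>t. t \<ge> 0 \<Longrightarrow> u t 0 = Q t"
    using sol unfolding defocusing_NLS_solution_def u_def[abs_def] by blast
  have uH: "u t \<in> H2" if "t \<ge> 0" for t using H that by (simp add: C0_curve_def)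
  have "\<exists>p. AC_deriv (u t) (fst p) \<and> AC_deriv (fst p) (snd p) \<and> fst p \<in> L2 \<and> snd p \<in> L2" if t: "t \<ge> 0" for t
    by (rule H2_AC[OF uH[OF t] cont[OF t]]) (metis fst_conv snd_conv)
  then obtain p where p: "\<And>t. t \<ge> 0 \<Longrightarrow> AC_deriv (u t) (fst (p t)) \<and> AC_deriv (fst (p t)) (snd (p t)) \<and> fst (p t) \<in> L2 \<and> snd (p t) \<in> L2"
    by metis
  define w where "w t = fst (p t)" for t
  define z where "z t = snd (p t)" for t
  have AC: "AC_deriv (u t) (w t)" "AC_deriv (w t) (z t)" and wz: "w t \<in> L2" "z t \<in> L2" if "t \<ge> 0" for t
    using p[OF that] by (auto simp: w_def z_def)
  have uL: "u t \<in> L2" and vL: "v t \<in> L2" if "t \<ge> 0" for t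
    using v that by (auto simp: C1_L2_curve_def C0_curve_def)
  have ev: "eventually (\<lambda>s. s \<ge> 0) (at t within {0..})" for t :: real
    by (auto simp: eventually_at_filter)
  have ev_in: "eventually (\<lambda>s. f s \<in> L2) (at t within {0..})" if "\<And>s. s \<ge> 0 \<Longrightarrow> f s \<in> L2" for f and t :: real
    using ev by eventually_elim (rule that)
  have Hlim: "((\<lambda>s. H2_norm (\<lambda>x. u s x - u t x)) \<longlongrightarrow> 0) (at t within {0..})" if "t \<ge> 0" for t
    using H that by (simp add: C0_curve_def)
  \<comment> \<open>\<open>H2_norm\<close> uses weak derivatives chosen for the difference,
    unrelated to those chosen at s and t. The differences of \<open>w\<close> and of
    \<open>z\<close> represent them almost everywhere, so the \<open>H2\<close> distance controls
    all three \<open>L2\<close> distances.\<close>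
  have Hn: "H2_norm (\<lambda>x. u s x - u t x) =
      sqrt ((L2_norm (\<lambda>x. u s x - u t x))\<^sup>2 + (L2_norm (\<lambda>x. w s x - w t x))\<^sup>2 + (L2_norm (\<lambda>x. z s x - z t x))\<^sup>2)"
    if "s \<ge> 0" "t \<ge> 0" for s t
    using that by (intro H2_norm_AC AC_deriv_diff AC L2_diff wz)
  have sand: "((\<lambda>s. L2_norm (F s)) \<longlongrightarrow> 0) (at t within {0..})"
    if t: "t \<ge> 0" and F: "\<And>s. s \<ge> 0 \<Longrightarrow> L2_norm (F s) \<le> H2_norm (\<lambda>x. u s x - u t x)" for F t
  proof (rule tendsto_sandwich[OF _ _ tendsto_const Hlim[OF t]])
    show "eventually (\<lambda>s. 0 \<le> L2_norm (F s)) (at t within {0..})" by (simp add: L2_norm_nonneg)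
    show "eventually (\<lambda>s. L2_norm (F s) \<le> H2_norm (\<lambda>x. u s x - u t x)) (at t within {0..})"
      using ev by eventually_elim (rule F)
  qed
  have "nls_flow u w z v Q Q'"
  proof
    fix t :: real assume t: "t \<ge> 0"
    show "AC_deriv (u t) (w t)" "AC_deriv (w t) (z t)" using AC[OF t] .
    show "L2_tendsto u (u t) (at t within {0..})"
      unfolding L2_tendsto_def using t
      by (intro conjI uL ev_in sand) (auto simp: Hn intro!: real_le_rsqrt)
    show "L2_tendsto w (w t) (at t within {0..})"
      unfolding L2_tendsto_def using t
      by (intro conjI wz ev_in sand) (auto simp: Hn intro!: real_le_rsqrt)
    show "L2_tendsto z (z t) (at t within {0..})"
      unfolding L2_tendsto_def using t
      by (intro conjI wz ev_in sand) (auto simp: Hn intro!: real_le_rsqrt)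
    show "L2_tendsto (\<lambda>s x. (u s x - u t x) / complex_of_real (s - t)) (v t) (at t within {0..})"
      unfolding L2_tendsto_def
    proof (intro conjI vL t ev_in)
      show "(\<lambda>x. (u s x - u t x) / complex_of_real (s - t)) \<in> L2" if "s \<ge> 0" for s
        using L2_scale[OF L2_diff[OF uL[OF that] uL[OF t]], of "inverse (complex_of_real (s - t))"]
        by (simp add: divide_inverse mult.commute)
      show "((\<lambda>s. L2_norm (\<lambda>x. (u s x - u t x) / complex_of_real (s - t) - v t x)) \<longlongrightarrow> 0) (at t within {0..})"
        using v t by (simp add: C1_L2_curve_def)
    qed
    show "u t 0 = Q t" by (rule bd[OF t])
    show "(Q has_vector_derivative Q' t) (at t within {0..})" by (rule Q[OF t])
  next
    fix t :: real assume t: "t > 0"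
    have "AE x in halfline. weak_deriv (weak_deriv (u t)) x = z t x"
      using AC_deriv_weak_derivs(2)[OF AC] t by simp
    with eq[OF t] show "AE x in halfline. \<i> * v t x + z t x - 2 * complex_of_real ((cmod (u t x))\<^sup>2) * u t x = 0"
      by eventually_elim simp
  qed
  then show ?thesis using that by (simp add: u_def[abs_def])
qed

lemma bigo_powr_bound:
  fixes f :: "real \<Rightarrow> complex"
  assumes "f \<in> O[at_top](\<lambda>t. complex_of_real (t powr (- a)))"
  obtains C T where "T > 0" "\<And>t. t \<ge> T \<Longrightarrow> cmod (f t) \<le> C * t powr (- a)"
proof -
  obtain C where "eventually (\<lambda>t. cmod (f t) \<le> C * cmod (complex_of_real (t powr (- a)))) at_top"
    using landau_o.bigE[OF assms] by blast
  then obtain T where T: "\<And>t. t \<ge> T \<Longrightarrow> cmod (f t) \<le> C * t powr (- a)"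
    by (auto simp: eventually_at_top_linorder)
  show ?thesis by (rule that[of "max T 1" C]) (use T in auto)
qed

theorem theorem3p1:
  fixes Q :: "real \<Rightarrow> complex"
    and q :: "real \<Rightarrow> real \<Rightarrow> complex"
    and \<alpha> \<beta> :: real
  assumes "C2_halfline Q"
    and "Q 0 = 0"
    and "defocusing_NLS_solution Q q"
    and "\<alpha> > 3/2"
    and "\<beta> > 5/2"
    and "(\<lambda>t. q 0 t) \<in> O[at_top](\<lambda>t. complex_of_real (t powr (- \<alpha>)))"
    and "(\<lambda>t. vector_derivative (\<lambda>s. q 0 s) (at t)) \<in> O[at_top](\<lambda>t. complex_of_real (t powr (- \<beta>)))"
  shows "\<exists>c>0. \<forall>t\<ge>1.
           integrable (lebesgue_on {0<..}) (\<lambda>x. cmod (q x t) ^ 4) \<and>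
           (LINT x|lebesgue_on {0<..}. cmod (q x t) ^ 4) \<le> c / t"
proof -
  obtain Q' Q'' where Q': "\<And>t. t \<ge> 0 \<Longrightarrow> (Q has_vector_derivative Q' t) (at t within {0..})"
    and Q'': "\<And>t. t \<ge> 0 \<Longrightarrow> (Q' has_vector_derivative Q'' t) (at t within {0..})"
    using assms(1) unfolding C2_halfline_def by blast
  obtain w z v where "nls_flow (\<lambda>t x. q x t) w z v Q Q'"
    using defocusing_NLS_solution_nls_flow[OF assms(3) Q'] by blast
  then interpret nls_flow "\<lambda>t x. q x t" w z v Q Q' .
  have Q'c: "continuous_on {0..} Q'"
    unfolding continuous_on_eq_continuous_within
    using Q'' has_vector_derivative_continuous by fastforce
  \<comment> \<open>q(0,s) is tied to Q(s) for s \<ge> 0 only, so the two-sided derivative is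
    identified at t > 0, which covers the range of the decay bound.\<close>
  have vd: "vector_derivative (\<lambda>s. q 0 s) (at t) = Q' t" if t: "t > 0" for t
  proof -
    have "(Q has_vector_derivative Q' t) (at t)"
      using Q'[of t] t at_within_pos[OF t] by simp
    then have "((\<lambda>s. q 0 s) has_vector_derivative Q' t) (at t)"
      by (rule has_vector_derivative_transform_within_open[of _ _ _ "{0<..}"]) (use t bdry in auto)
    then show ?thesis by (rule vector_derivative_at)
  qed
  obtain C T where C: "T > 0" "\<And>t. t \<ge> T \<Longrightarrow> cmod (q 0 t) \<le> C * t powr (- \<alpha>)"
    using bigo_powr_bound[OF assms(6)] by blast
  obtain C' T' where C': "T' > 0" "\<And>t. t \<ge> T' \<Longrightarrow> cmod (vector_derivative (\<lambda>s. q 0 s) (at t)) \<le> C' * t powr (- \<beta>)"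
    using bigo_powr_bound[OF assms(7)] by blast
  have "\<exists>c>0. \<forall>t\<ge>1. quart (\<lambda>x. 1) t \<le> c / t"
  proof (rule quart_decay[OF _ Q'c assms(4) C(1) _ assms(5) C'(1)])
    show "q x 0 = 0" if "x > 0" for x
      using assms(3) that by (simp add: defocusing_NLS_solution_def)
    show "cmod (Q t) \<le> C * t powr (- \<alpha>)" if "t \<ge> T" for t
      using C(2)[OF that] bdry[of t] C(1) that by simp
    show "cmod (Q' t) \<le> C' * t powr (- \<beta>)" if "t \<ge> T'" for t
      using C'(2)[OF that] vd[of t] C'(1) that by simp
  qed
  then obtain c where "c > 0" "\<And>t. t \<ge> 1 \<Longrightarrow> quart (\<lambda>x. 1) t \<le> c / t" by blast
  then show ?thesis
    using quart_eq(1,2)[OF bdd_weight_const[of 1]] by (intro exI[of _ c]) auto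
qed

end
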